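(* Let $T$ be an additive ternary $\Gamma$-ring; write $\mathcal A=\mathcal A(T,\Gamma)$, $\mathcal R=\mathcal R_T$ for its regular operator ring, $K$ for its unital regular defect, $\mathcal C(T,\Gamma)=K/K^2$, and $\mathcal C_n(T,\Gamma)=K^n/K^{n+1}$ for $n\ge1$. Each $\mathcal C_n(T,\Gamma)$ is an $\mathcal R$-bimodule, and multiplication induces natural surjections $$\mathcal C(T,\Gamma)^{\otimes_{\mathcal R}n}\twoheadrightarrow\mathcal C_n(T,\Gamma).$$ Consequently, the graded defect algebra $\operatorname{gr}_K(\mathcal A)=\mathcal R\oplus\bigoplus_{n\ge1}\mathcal C_n(T,\Gamma)$ is generated as a graded $\mathcal R$-algebra by its degree-one part $\mathcal C(T,\Gamma)$.
   Context: An additive ternary $\Gamma$-ring consists of abelian groups $(T,+)$, $(\Gamma,+)$ and a map $T\times\Gamma\times T\times\Gamma\times T\to T$, $(x,\alpha,y,\beta,z)\mapsto x\alpha y\beta z$, additive in each of the five variables, with $(x\alpha y\beta z)\gamma u\delta v=x\alpha(y\beta z\gamma u)\delta v=x\alpha y\beta(z\gamma u\delta v)$. Let $F(T,\Gamma)=T\otimes_{\mathbb Z}\Gamma\otimes_{\mathbb Z}T\otimes_{\mathbb Z}\Gamma$ with the associative bilinear multiplication $(a\otimes\alpha\otimes b\otimes\beta)(c\otimes\gamma\otimes d\otimes\delta)=(a\alpha b\beta c)\otimes\gamma\otimes d\otimes\delta$, let $J(T,\Gamma)$ be the two-sided ideal generated by all $(a\alpha b\beta c)\otimes\gamma\otimes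 d\otimes\delta-a\otimes\alpha\otimes(b\beta c\gamma d)\otimes\delta$, and let $\mathcal O(T,\Gamma)=F(T,\Gamma)/J(T,\Gamma)$; $[a,\alpha,b,\beta]$ is the class of a pure tensor. The unital ring $\mathcal A(T,\Gamma)=\mathbb Z\ltimes\mathcal O(T,\Gamma)$ is $\mathbb Z\oplus\mathcal O(T,\Gamma)$ with $(n,r)(m,s)=(nm,ns+mr+rs)$. The regular representation is $\rho_T:\mathcal O(T,\Gamma)\to\operatorname{End}_{\mathbb Z}(T)$, $\rho_T([a,\alpha,b,\beta])(x)=a\alpha b\beta x$, and its unital extension is $\widehat\rho_T:\mathcal A(T,\Gamma)\to\operatorname{End}_{\mathbb Z}(T)$, $\widehat\rho_T(n,u)=n\operatorname{id}_T+\rho_T(u)$. The unital regular defect is $K=\ker\widehat\rho_T$ and the regular operator ring is $\mathcal R_T=\operatorname{im}\widehat\rho_T\cong\mathcal A/K$. The actions of $\mathcal R_T$ on $K^n/K^{n+1}$ are those induced by multiplication in $\mathcal A$ after lifting elements of $\mathcal R_T$ to $\mathcal A$. *)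

theory Defs
  imports
    "HOL-Algebra.QuotRing"
    "HOL-Algebra.Ideal_Product"
    "HOL-Algebra.Generated_Groups"
    "HOL-Algebra.Generated_Rings"
    "HOL-Algebra.Free_Abelian_Groups"
begin

section \<open>Additive ternary Gamma-rings\<close>

text \<open>Abelian groups are written additively as \<^locale>\<open>abelian_group\<close>; the multiplicative fields of
  the records \<open>T\<close> and \<open>\<Gamma>\<close> are not used. The term \<open>m x \<alpha> y \<beta> z\<close> is the product \<open>x\<alpha>y\<beta>z\<close>.\<close>

locale ternary_gamma_ring = T: abelian_group T + \<Gamma>: abelian_group \<Gamma>
  for T :: "('t, 'x) ring_scheme" and \<Gamma> :: "('g, 'y) ring_scheme" +
  fixes m :: "'t \<Rightarrow> 'g \<Rightarrow> 't \<Rightarrow> 'g \<Rightarrow> 't \<Rightarrow> 't"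
  assumes closed:
    "\<lbrakk>x \<in> carrier T; \<alpha> \<in> carrier \<Gamma>; y \<in> carrier T; \<beta> \<in> carrier \<Gamma>; z \<in> carrier T\<rbrakk>
      \<Longrightarrow> m x \<alpha> y \<beta> z \<in> carrier T"
  and add1:
    "\<lbrakk>x \<in> carrier T; x' \<in> carrier T; \<alpha> \<in> carrier \<Gamma>; y \<in> carrier T; \<beta> \<in> carrier \<Gamma>; z \<in> carrier T\<rbrakk>
      \<Longrightarrow> m (x \<oplus>\<^bsub>T\<^esub> x') \<alpha> y \<beta> z = m x \<alpha> y \<beta> z \<oplus>\<^bsub>T\<^esub> m x' \<alpha> y \<beta> z"
  and add2:
    "\<lbrakk>x \<in> carrier T; \<alpha> \<in> carrier \<Gamma>; \<alpha>' \<in> carrier \<Gamma>; y \<in> carrier T; \<beta> \<in> carrier \<Gamma>; z \<in> carrier T\<rbrakk>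
      \<Longrightarrow> m x (\<alpha> \<oplus>\<^bsub>\<Gamma>\<^esub> \<alpha>') y \<beta> z = m x \<alpha> y \<beta> z \<oplus>\<^bsub>T\<^esub> m x \<alpha>' y \<beta> z"
  and add3:
    "\<lbrakk>x \<in> carrier T; \<alpha> \<in> carrier \<Gamma>; y \<in> carrier T; y' \<in> carrier T; \<beta> \<in> carrier \<Gamma>; z \<in> carrier T\<rbrakk>
      \<Longrightarrow> m x \<alpha> (y \<oplus>\<^bsub>T\<^esub> y') \<beta> z = m x \<alpha> y \<beta> z \<oplus>\<^bsub>T\<^esub> m x \<alpha> y' \<beta> z"
  and add4:
    "\<lbrakk>x \<in> carrier T; \<alpha> \<in> carrier \<Gamma>; y \<in> carrier T; \<beta> \<in> carrier \<Gamma>; \<beta>' \<in> carrier \<Gamma>; z \<in> carrier T\<rbrakk>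
      \<Longrightarrow> m x \<alpha> y (\<beta> \<oplus>\<^bsub>\<Gamma>\<^esub> \<beta>') z = m x \<alpha> y \<beta> z \<oplus>\<^bsub>T\<^esub> m x \<alpha> y \<beta>' z"
  and add5:
    "\<lbrakk>x \<in> carrier T; \<alpha> \<in> carrier \<Gamma>; y \<in> carrier T; \<beta> \<in> carrier \<Gamma>; z \<in> carrier T; z' \<in> carrier T\<rbrakk>
      \<Longrightarrow> m x \<alpha> y \<beta> (z \<oplus>\<^bsub>T\<^esub> z') = m x \<alpha> y \<beta> z \<oplus>\<^bsub>T\<^esub> m x \<alpha> y \<beta> z'"
  and assoc_left:
    "\<lbrakk>x \<in> carrier T; \<alpha> \<in> carrier \<Gamma>; y \<in> carrier T; \<beta> \<in> carrier \<Gamma>; z \<in> carrier T;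
      \<gamma> \<in> carrier \<Gamma>; u \<in> carrier T; \<delta> \<in> carrier \<Gamma>; v \<in> carrier T\<rbrakk>
      \<Longrightarrow> m (m x \<alpha> y \<beta> z) \<gamma> u \<delta> v = m x \<alpha> (m y \<beta> z \<gamma> u) \<delta> v"
  and assoc_right:
    "\<lbrakk>x \<in> carrier T; \<alpha> \<in> carrier \<Gamma>; y \<in> carrier T; \<beta> \<in> carrier \<Gamma>; z \<in> carrier T;
      \<gamma> \<in> carrier \<Gamma>; u \<in> carrier T; \<delta> \<in> carrier \<Gamma>; v \<in> carrier T\<rbrakk>
      \<Longrightarrow> m x \<alpha> (m y \<beta> z \<gamma> u) \<delta> v = m x \<alpha> y \<beta> (m z \<gamma> u \<delta> v)"


section \<open>The operator rings\<close>

text \<open>The free abelian group on \<open>S\<close> in additive notation. Its multiplicative fields are placeholders: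
  the rings \<open>F\<close> and \<open>O\<close> below have no unit, so their \<open>one\<close> field (the zero element) carries no
  meaning.\<close>

definition free_ab :: "'b set \<Rightarrow> ('b \<Rightarrow>\<^sub>0 int) ring" where
  "free_ab S = \<lparr>carrier = carrier (free_Abelian_group S), monoid.mult = (\<lambda>_ _. 0), monoid.one = 0,
                ring.zero = 0, ring.add = (+)\<rparr>"

type_synonym ('t, 'g) quad = "'t \<times> 'g \<times> 't \<times> 'g"

definition quads :: "('t, 'x) ring_scheme \<Rightarrow> ('g, 'y) ring_scheme \<Rightarrow> ('t, 'g) quad set" where
  "quads T \<Gamma> = carrier T \<times> carrier \<Gamma> \<times> carrier T \<times> carrier \<Gamma>"

text \<open>The relations of the tensor product of \<open>T\<close>, \<open>\<Gamma>\<close>, \<open>T\<close>, \<open>\<Gamma>\<close> over the integers.\<close>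

definition tensor_rels ::
    "('t, 'x) ring_scheme \<Rightarrow> ('g, 'y) ring_scheme \<Rightarrow> (('t, 'g) quad \<Rightarrow>\<^sub>0 int) set" where
  "tensor_rels T \<Gamma> = generate (add_monoid (free_ab (quads T \<Gamma>)))
    ({frag_of (a \<oplus>\<^bsub>T\<^esub> a', \<alpha>, b, \<beta>) - frag_of (a, \<alpha>, b, \<beta>) - frag_of (a', \<alpha>, b, \<beta>) | a a' \<alpha> b \<beta>.
        a \<in> carrier T \<and> a' \<in> carrier T \<and> \<alpha> \<in> carrier \<Gamma> \<and> b \<in> carrier T \<and> \<beta> \<in> carrier \<Gamma>}
   \<union> {frag_of (a, \<alpha> \<oplus>\<^bsub>\<Gamma>\<^esub> \<alpha>', b, \<beta>) - frag_of (a, \<alpha>, b, \<beta>) - frag_of (a, \<alpha>', b, \<beta>) | a \<alpha> \<alpha>' b \<beta>.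
        a \<in> carrier T \<and> \<alpha> \<in> carrier \<Gamma> \<and> \<alpha>' \<in> carrier \<Gamma> \<and> b \<in> carrier T \<and> \<beta> \<in> carrier \<Gamma>}
   \<union> {frag_of (a, \<alpha>, b \<oplus>\<^bsub>T\<^esub> b', \<beta>) - frag_of (a, \<alpha>, b, \<beta>) - frag_of (a, \<alpha>, b', \<beta>) | a \<alpha> b b' \<beta>.
        a \<in> carrier T \<and> \<alpha> \<in> carrier \<Gamma> \<and> b \<in> carrier T \<and> b' \<in> carrier T \<and> \<beta> \<in> carrier \<Gamma>}
   \<union> {frag_of (a, \<alpha>, b, \<beta> \<oplus>\<^bsub>\<Gamma>\<^esub> \<beta>') - frag_of (a, \<alpha>, b, \<beta>) - frag_of (a, \<alpha>, b, \<beta>') | a \<alpha> b \<beta> \<beta>'.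
        a \<in> carrier T \<and> \<alpha> \<in> carrier \<Gamma> \<and> b \<in> carrier T \<and> \<beta> \<in> carrier \<Gamma> \<and> \<beta>' \<in> carrier \<Gamma>})"

fun quad_mult :: "('t \<Rightarrow> 'g \<Rightarrow> 't \<Rightarrow> 'g \<Rightarrow> 't \<Rightarrow> 't) \<Rightarrow> ('t, 'g) quad \<Rightarrow> ('t, 'g) quad \<Rightarrow> ('t, 'g) quad"
  where "quad_mult m (a, \<alpha>, b, \<beta>) (c, \<gamma>, d, \<delta>) = (m a \<alpha> b \<beta> c, \<gamma>, d, \<delta>)"

text \<open>The biadditive extension of \<^const>\<open>quad_mult\<close> to the free abelian group. It respects the
  tensor relations, so \<^const>\<open>FactRing\<close> gives the tensor product with its multiplication.\<close>

definition free_mult ::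
    "('t \<Rightarrow> 'g \<Rightarrow> 't \<Rightarrow> 'g \<Rightarrow> 't \<Rightarrow> 't)
      \<Rightarrow> (('t, 'g) quad \<Rightarrow>\<^sub>0 int) \<Rightarrow> (('t, 'g) quad \<Rightarrow>\<^sub>0 int) \<Rightarrow> (('t, 'g) quad \<Rightarrow>\<^sub>0 int)" where
  "free_mult m f g = frag_extend (\<lambda>p. frag_extend (\<lambda>q. frag_of (quad_mult m p q)) g) f"

definition F_ring ::
    "('t, 'x) ring_scheme \<Rightarrow> ('g, 'y) ring_scheme \<Rightarrow> ('t \<Rightarrow> 'g \<Rightarrow> 't \<Rightarrow> 'g \<Rightarrow> 't \<Rightarrow> 't)
      \<Rightarrow> ((('t, 'g) quad \<Rightarrow>\<^sub>0 int) set) ring" where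
  "F_ring T \<Gamma> m = (free_ab (quads T \<Gamma>)) \<lparr>monoid.mult := free_mult m\<rparr> Quot tensor_rels T \<Gamma>"

definition F_pure ::
    "('t, 'x) ring_scheme \<Rightarrow> ('g, 'y) ring_scheme \<Rightarrow> ('t, 'g) quad \<Rightarrow> (('t, 'g) quad \<Rightarrow>\<^sub>0 int) set" where
  "F_pure T \<Gamma> p = tensor_rels T \<Gamma> +>\<^bsub>free_ab (quads T \<Gamma>)\<^esub> frag_of p"

text \<open>Two-sided ideals of a ring that need not have a unit.\<close>

definition rng_ideal :: "('a, 'b) ring_scheme \<Rightarrow> 'a set \<Rightarrow> bool" where
  "rng_ideal R I \<longleftrightarrow> additive_subgroup I R \<and>
     (\<forall>x\<in>I. \<forall>r\<in>carrier R. r \<otimes>\<^bsub>R\<^esub> x \<in> I \<and> x \<otimes>\<^bsub>R\<^esub> r \<in> I)"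

definition rng_genideal :: "('a, 'b) ring_scheme \<Rightarrow> 'a set \<Rightarrow> 'a set" where
  "rng_genideal R S = \<Inter> {I. rng_ideal R I \<and> S \<subseteq> I}"

definition J_ideal ::
    "('t, 'x) ring_scheme \<Rightarrow> ('g, 'y) ring_scheme \<Rightarrow> ('t \<Rightarrow> 'g \<Rightarrow> 't \<Rightarrow> 'g \<Rightarrow> 't \<Rightarrow> 't)
      \<Rightarrow> (('t, 'g) quad \<Rightarrow>\<^sub>0 int) set set" where
  "J_ideal T \<Gamma> m = rng_genideal (F_ring T \<Gamma> m)
     {F_pure T \<Gamma> (m a \<alpha> b \<beta> c, \<gamma>, d, \<delta>) \<ominus>\<^bsub>F_ring T \<Gamma> m\<^esub> F_pure T \<Gamma> (a, \<alpha>, m b \<beta> c \<gamma> d, \<delta>)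
        | a \<alpha> b \<beta> c \<gamma> d \<delta>.
        a \<in> carrier T \<and> \<alpha> \<in> carrier \<Gamma> \<and> b \<in> carrier T \<and> \<beta> \<in> carrier \<Gamma> \<and>
        c \<in> carrier T \<and> \<gamma> \<in> carrier \<Gamma> \<and> d \<in> carrier T \<and> \<delta> \<in> carrier \<Gamma>}"

definition O_ring ::
    "('t, 'x) ring_scheme \<Rightarrow> ('g, 'y) ring_scheme \<Rightarrow> ('t \<Rightarrow> 'g \<Rightarrow> 't \<Rightarrow> 'g \<Rightarrow> 't \<Rightarrow> 't)
      \<Rightarrow> ((('t, 'g) quad \<Rightarrow>\<^sub>0 int) set set) ring" where
  "O_ring T \<Gamma> m = F_ring T \<Gamma> m Quot J_ideal T \<Gamma> m"

type_synonym ('t, 'g) opr = "int \<times> (('t, 'g) quad \<Rightarrow>\<^sub>0 int) set set"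

definition A_ring ::
    "('t, 'x) ring_scheme \<Rightarrow> ('g, 'y) ring_scheme \<Rightarrow> ('t \<Rightarrow> 'g \<Rightarrow> 't \<Rightarrow> 'g \<Rightarrow> 't \<Rightarrow> 't)
      \<Rightarrow> (('t, 'g) opr) ring" where
  "A_ring T \<Gamma> m = (let Op = O_ring T \<Gamma> m in
     \<lparr>carrier = UNIV \<times> carrier Op,
      monoid.mult = (\<lambda>(k, r) (l, s). (k * l, [k] \<cdot>\<^bsub>Op\<^esub> s \<oplus>\<^bsub>Op\<^esub> [l] \<cdot>\<^bsub>Op\<^esub> r \<oplus>\<^bsub>Op\<^esub> r \<otimes>\<^bsub>Op\<^esub> s)),
      monoid.one = (1, \<zero>\<^bsub>Op\<^esub>),
      ring.zero = (0, \<zero>\<^bsub>Op\<^esub>),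
      ring.add = (\<lambda>(k, r) (l, s). (k + l, r \<oplus>\<^bsub>Op\<^esub> s))\<rparr>)"


section \<open>The regular representation\<close>

text \<open>Endomorphisms are extensional, i.e. \<^term>\<open>undefined\<close> outside the carrier, so that equality of
  functions is equality on the carrier.\<close>

definition End_ring :: "('t, 'x) ring_scheme \<Rightarrow> ('t \<Rightarrow> 't) ring" where
  "End_ring T =
     \<lparr>carrier = hom (add_monoid T) (add_monoid T) \<inter> extensional (carrier T),
      monoid.mult = compose (carrier T),
      monoid.one = (\<lambda>x\<in>carrier T. x),
      ring.zero = (\<lambda>x\<in>carrier T. \<zero>\<^bsub>T\<^esub>),
      ring.add = (\<lambda>f g. \<lambda>x\<in>carrier T. f x \<oplus>\<^bsub>T\<^esub> g x)\<rparr>"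

definition free_rho ::
    "('t, 'x) ring_scheme \<Rightarrow> ('t \<Rightarrow> 'g \<Rightarrow> 't \<Rightarrow> 'g \<Rightarrow> 't \<Rightarrow> 't) \<Rightarrow> (('t, 'g) quad \<Rightarrow>\<^sub>0 int) \<Rightarrow> 't \<Rightarrow> 't" where
  "free_rho T m f = (\<lambda>x\<in>carrier T. \<Oplus>\<^bsub>T\<^esub>p\<in>Poly_Mapping.keys f.
     [Poly_Mapping.lookup f p] \<cdot>\<^bsub>T\<^esub> (case p of (a, \<alpha>, b, \<beta>) \<Rightarrow> m a \<alpha> b \<beta> x))"

text \<open>An element \<open>u\<close> of \<open>O\<close> is a coset of cosets, and \<open>\<Union>u\<close> is the set of all formal combinations of
  quadruples representing it; \<^const>\<open>free_rho\<close> is constant on that set.\<close>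

definition rho ::
    "('t, 'x) ring_scheme \<Rightarrow> ('t \<Rightarrow> 'g \<Rightarrow> 't \<Rightarrow> 'g \<Rightarrow> 't \<Rightarrow> 't)
      \<Rightarrow> (('t, 'g) quad \<Rightarrow>\<^sub>0 int) set set \<Rightarrow> 't \<Rightarrow> 't" where
  "rho T m u = the_elem (free_rho T m ` \<Union> u)"

definition rho_hat ::
    "('t, 'x) ring_scheme \<Rightarrow> ('t \<Rightarrow> 'g \<Rightarrow> 't \<Rightarrow> 'g \<Rightarrow> 't \<Rightarrow> 't) \<Rightarrow> ('t, 'g) opr \<Rightarrow> 't \<Rightarrow> 't" where
  "rho_hat T m = (\<lambda>(k, u). [k] \<cdot>\<^bsub>End_ring T\<^esub> \<one>\<^bsub>End_ring T\<^esub> \<oplus>\<^bsub>End_ring T\<^esub> rho T m u)"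

definition K_defect ::
    "('t, 'x) ring_scheme \<Rightarrow> ('g, 'y) ring_scheme \<Rightarrow> ('t \<Rightarrow> 'g \<Rightarrow> 't \<Rightarrow> 'g \<Rightarrow> 't \<Rightarrow> 't)
      \<Rightarrow> ('t, 'g) opr set" where
  "K_defect T \<Gamma> m = a_kernel (A_ring T \<Gamma> m) (End_ring T) (rho_hat T m)"

definition R_ring ::
    "('t, 'x) ring_scheme \<Rightarrow> ('g, 'y) ring_scheme \<Rightarrow> ('t \<Rightarrow> 'g \<Rightarrow> 't \<Rightarrow> 'g \<Rightarrow> 't \<Rightarrow> 't)
      \<Rightarrow> ('t \<Rightarrow> 't) ring" where
  "R_ring T \<Gamma> m = (End_ring T) \<lparr>carrier := rho_hat T m ` carrier (A_ring T \<Gamma> m)\<rparr>"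


section \<open>Bimodules and tensor powers\<close>

text \<open>As for \<^locale>\<open>module\<close>, the multiplicative fields of a bimodule record are not used.\<close>

record ('r, 'm) bimod = "'m ring" +
  lact :: "'r \<Rightarrow> 'm \<Rightarrow> 'm"
  ract :: "'m \<Rightarrow> 'r \<Rightarrow> 'm"

locale bimodule = R: ring R + M: abelian_group M
  for R :: "('r, 'a) ring_scheme" and M :: "('r, 'm, 'b) bimod_scheme" +
  assumes lact_closed: "\<lbrakk>c \<in> carrier R; x \<in> carrier M\<rbrakk> \<Longrightarrow> lact M c x \<in> carrier M"
  and ract_closed: "\<lbrakk>c \<in> carrier R; x \<in> carrier M\<rbrakk> \<Longrightarrow> ract M x c \<in> carrier M"
  and lact_add: "\<lbrakk>c \<in> carrier R; x \<in> carrier M; y \<in> carrier M\<rbrakk>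
    \<Longrightarrow> lact M c (x \<oplus>\<^bsub>M\<^esub> y) = lact M c x \<oplus>\<^bsub>M\<^esub> lact M c y"
  and ract_add: "\<lbrakk>c \<in> carrier R; x \<in> carrier M; y \<in> carrier M\<rbrakk>
    \<Longrightarrow> ract M (x \<oplus>\<^bsub>M\<^esub> y) c = ract M x c \<oplus>\<^bsub>M\<^esub> ract M y c"
  and add_lact: "\<lbrakk>c \<in> carrier R; d \<in> carrier R; x \<in> carrier M\<rbrakk>
    \<Longrightarrow> lact M (c \<oplus>\<^bsub>R\<^esub> d) x = lact M c x \<oplus>\<^bsub>M\<^esub> lact M d x"
  and add_ract: "\<lbrakk>c \<in> carrier R; d \<in> carrier R; x \<in> carrier M\<rbrakk>
    \<Longrightarrow> ract M x (c \<oplus>\<^bsub>R\<^esub> d) = ract M x c \<oplus>\<^bsub>M\<^esub> ract M x d"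
  and mult_lact: "\<lbrakk>c \<in> carrier R; d \<in> carrier R; x \<in> carrier M\<rbrakk>
    \<Longrightarrow> lact M (c \<otimes>\<^bsub>R\<^esub> d) x = lact M c (lact M d x)"
  and mult_ract: "\<lbrakk>c \<in> carrier R; d \<in> carrier R; x \<in> carrier M\<rbrakk>
    \<Longrightarrow> ract M x (c \<otimes>\<^bsub>R\<^esub> d) = ract M (ract M x c) d"
  and one_lact: "x \<in> carrier M \<Longrightarrow> lact M \<one>\<^bsub>R\<^esub> x = x"
  and one_ract: "x \<in> carrier M \<Longrightarrow> ract M x \<one>\<^bsub>R\<^esub> = x"
  and lact_ract: "\<lbrakk>c \<in> carrier R; d \<in> carrier R; x \<in> carrier M\<rbrakk>
    \<Longrightarrow> ract M (lact M c x) d = lact M c (ract M x d)"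

definition bimodule_hom ::
    "('r, 'a) ring_scheme \<Rightarrow> ('r, 'm, 'b) bimod_scheme \<Rightarrow> ('r, 'n, 'c) bimod_scheme \<Rightarrow> ('m \<Rightarrow> 'n) set" where
  "bimodule_hom R M N = {h \<in> hom (add_monoid M) (add_monoid N). \<forall>c\<in>carrier R. \<forall>x\<in>carrier M.
     h (lact M c x) = lact N c (h x) \<and> h (ract M x c) = ract N (h x) c}"

text \<open>The tensor power of a bimodule over \<open>R\<close> is built in one step, on lists of length \<open>n\<close>: it is the
  free abelian group on them modulo additivity in each position and \<open>R\<close>-balancedness between
  neighbouring positions. Only \<open>n \<ge> 1\<close> is meant; for \<open>n = 0\<close> this would be the integers
  instead of \<open>R\<close>.\<close>

definition tensor_lists :: "('r, 'm, 'b) bimod_scheme \<Rightarrow> nat \<Rightarrow> 'm list set" where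
  "tensor_lists M n = {xs. set xs \<subseteq> carrier M \<and> length xs = n}"

definition tpow_rels ::
    "('r, 'a) ring_scheme \<Rightarrow> ('r, 'm, 'b) bimod_scheme \<Rightarrow> nat \<Rightarrow> ('m list \<Rightarrow>\<^sub>0 int) set" where
  "tpow_rels R M n = generate (add_monoid (free_ab (tensor_lists M n)))
    ({frag_of (us @ (x \<oplus>\<^bsub>M\<^esub> y) # vs) - frag_of (us @ x # vs) - frag_of (us @ y # vs) | us x y vs.
        set us \<subseteq> carrier M \<and> x \<in> carrier M \<and> y \<in> carrier M \<and> set vs \<subseteq> carrier M \<and>
        length us + 1 + length vs = n}
   \<union> {frag_of (us @ ract M x c # y # vs) - frag_of (us @ x # lact M c y # vs) | us x c y vs.
        set us \<subseteq> carrier M \<and> x \<in> carrier M \<and> c \<in> carrier R \<and> y \<in> carrier M \<and> set vs \<subseteq> carrier M \<and>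
        length us + 2 + length vs = n})"

definition tpow_pure ::
    "('r, 'a) ring_scheme \<Rightarrow> ('r, 'm, 'b) bimod_scheme \<Rightarrow> 'm list \<Rightarrow> ('m list \<Rightarrow>\<^sub>0 int) set" where
  "tpow_pure R M xs =
     tpow_rels R M (length xs) +>\<^bsub>free_ab (tensor_lists M (length xs))\<^esub> frag_of xs"

definition tensor_power ::
    "('r, 'a) ring_scheme \<Rightarrow> ('r, 'm, 'b) bimod_scheme \<Rightarrow> nat \<Rightarrow> ('r, ('m list \<Rightarrow>\<^sub>0 int) set) bimod" where
  "tensor_power R M n = ring.extend (free_ab (tensor_lists M n) Quot tpow_rels R M n)
     \<lparr>lact = (\<lambda>c X. \<Union>f\<in>X. tpow_rels R M n +>\<^bsub>free_ab (tensor_lists M n)\<^esub>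
                frag_extend (\<lambda>xs. frag_of (lact M c (hd xs) # tl xs)) f),
      ract = (\<lambda>X c. \<Union>f\<in>X. tpow_rels R M n +>\<^bsub>free_ab (tensor_lists M n)\<^esub>
                frag_extend (\<lambda>xs. frag_of (butlast xs @ [ract M (last xs) c])) f)\<rparr>"


section \<open>The graded defect algebra\<close>

text \<open>For a two-sided ideal \<open>I\<close> of a unital ring, \<open>ideal_pow R I 1 = carrier R \<cdot>\<^bsub>R\<^esub> I = I\<close>.\<close>

primrec ideal_pow :: "('a, 'b) ring_scheme \<Rightarrow> 'a set \<Rightarrow> nat \<Rightarrow> 'a set" where
  "ideal_pow R I 0 = carrier R"
| "ideal_pow R I (Suc n) = ideal_pow R I n \<cdot>\<^bsub>R\<^esub> I"

definition K_pow ::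
    "('t, 'x) ring_scheme \<Rightarrow> ('g, 'y) ring_scheme \<Rightarrow> ('t \<Rightarrow> 'g \<Rightarrow> 't \<Rightarrow> 'g \<Rightarrow> 't \<Rightarrow> 't)
      \<Rightarrow> nat \<Rightarrow> ('t, 'g) opr set" where
  "K_pow T \<Gamma> m n = ideal_pow (A_ring T \<Gamma> m) (K_defect T \<Gamma> m) n"

definition K_class ::
    "('t, 'x) ring_scheme \<Rightarrow> ('g, 'y) ring_scheme \<Rightarrow> ('t \<Rightarrow> 'g \<Rightarrow> 't \<Rightarrow> 'g \<Rightarrow> 't \<Rightarrow> 't)
      \<Rightarrow> nat \<Rightarrow> ('t, 'g) opr \<Rightarrow> ('t, 'g) opr set" where
  "K_class T \<Gamma> m n x = K_pow T \<Gamma> m (Suc n) +>\<^bsub>A_ring T \<Gamma> m\<^esub> x"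

text \<open>\<open>lifts T \<Gamma> m c\<close> is the set of all lifts of \<open>c \<in> \<R>\<^sub>T\<close> to \<open>A\<close>. The actions of \<open>c\<close> multiply with all
  lifts at once, \<^const>\<open>rcoset_mult\<close> being the union of the cosets of all products.\<close>

definition lifts ::
    "('t, 'x) ring_scheme \<Rightarrow> ('g, 'y) ring_scheme \<Rightarrow> ('t \<Rightarrow> 'g \<Rightarrow> 't \<Rightarrow> 'g \<Rightarrow> 't \<Rightarrow> 't)
      \<Rightarrow> ('t \<Rightarrow> 't) \<Rightarrow> ('t, 'g) opr set" where
  "lifts T \<Gamma> m c = {a \<in> carrier (A_ring T \<Gamma> m). rho_hat T m a = c}"

definition C_bimod ::
    "('t, 'x) ring_scheme \<Rightarrow> ('g, 'y) ring_scheme \<Rightarrow> ('t \<Rightarrow> 'g \<Rightarrow> 't \<Rightarrow> 'g \<Rightarrow> 't \<Rightarrow> 't)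
      \<Rightarrow> nat \<Rightarrow> ('t \<Rightarrow> 't, ('t, 'g) opr set) bimod" where
  "C_bimod T \<Gamma> m n =
     ring.extend ((A_ring T \<Gamma> m) \<lparr>carrier := K_pow T \<Gamma> m n\<rparr> Quot K_pow T \<Gamma> m (Suc n))
     \<lparr>lact = (\<lambda>c X. rcoset_mult (A_ring T \<Gamma> m) (K_pow T \<Gamma> m (Suc n)) (lifts T \<Gamma> m c) X),
      ract = (\<lambda>X c. rcoset_mult (A_ring T \<Gamma> m) (K_pow T \<Gamma> m (Suc n)) X (lifts T \<Gamma> m c))\<rparr>"

text \<open>An element \<open>(r, f)\<close> of the graded algebra has degree-zero component \<open>r \<in> \<R>\<^sub>T\<close> and degree-\<open>n\<close>
  component \<open>f n\<close> for \<open>n \<ge> 1\<close>; the value \<open>f 0\<close> is a dummy (\<^term>\<open>undefined\<close>). The product of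
  the components in degrees \<open>i, j \<ge> 1\<close> is induced by the multiplication of \<open>A\<close>.\<close>

definition gr_zero_fun ::
    "('t, 'x) ring_scheme \<Rightarrow> ('g, 'y) ring_scheme \<Rightarrow> ('t \<Rightarrow> 'g \<Rightarrow> 't \<Rightarrow> 'g \<Rightarrow> 't \<Rightarrow> 't)
      \<Rightarrow> nat \<Rightarrow> ('t, 'g) opr set" where
  "gr_zero_fun T \<Gamma> m = (\<lambda>n\<in>{1..}. \<zero>\<^bsub>C_bimod T \<Gamma> m n\<^esub>)"

definition gr_ring ::
    "('t, 'x) ring_scheme \<Rightarrow> ('g, 'y) ring_scheme \<Rightarrow> ('t \<Rightarrow> 'g \<Rightarrow> 't \<Rightarrow> 'g \<Rightarrow> 't \<Rightarrow> 't)
      \<Rightarrow> (('t \<Rightarrow> 't) \<times> (nat \<Rightarrow> ('t, 'g) opr set)) ring" where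
  "gr_ring T \<Gamma> m = (let R = R_ring T \<Gamma> m; C = C_bimod T \<Gamma> m in
     \<lparr>carrier = carrier R \<times>
        {f \<in> (\<Pi>\<^sub>E n\<in>{1..}. carrier (C n)). finite {n \<in> {1..}. f n \<noteq> \<zero>\<^bsub>C n\<^esub>}},
      monoid.mult = (\<lambda>(r, f) (s, g). (r \<otimes>\<^bsub>R\<^esub> s,
        \<lambda>n\<in>{1..}. lact (C n) r (g n) \<oplus>\<^bsub>C n\<^esub> ract (C n) (f n) s \<oplus>\<^bsub>C n\<^esub>
          (\<Oplus>\<^bsub>C n\<^esub>i\<in>{1..<n}. rcoset_mult (A_ring T \<Gamma> m) (K_pow T \<Gamma> m (Suc n)) (f i) (g (n - i))))),
      monoid.one = (\<one>\<^bsub>R\<^esub>, gr_zero_fun T \<Gamma> m),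
      ring.zero = (\<zero>\<^bsub>R\<^esub>, gr_zero_fun T \<Gamma> m),
      ring.add = (\<lambda>(r, f) (s, g). (r \<oplus>\<^bsub>R\<^esub> s, \<lambda>n\<in>{1..}. f n \<oplus>\<^bsub>C n\<^esub> g n))\<rparr>)"

definition gr_comp ::
    "('t, 'x) ring_scheme \<Rightarrow> ('g, 'y) ring_scheme \<Rightarrow> ('t \<Rightarrow> 'g \<Rightarrow> 't \<Rightarrow> 'g \<Rightarrow> 't \<Rightarrow> 't)
      \<Rightarrow> nat \<Rightarrow> (('t \<Rightarrow> 't) \<times> (nat \<Rightarrow> ('t, 'g) opr set)) set" where
  "gr_comp T \<Gamma> m n = {(r, f) \<in> carrier (gr_ring T \<Gamma> m).
     (n \<noteq> 0 \<longrightarrow> r = \<zero>\<^bsub>R_ring T \<Gamma> m\<^esub>) \<and> (\<forall>k\<ge>1. k \<noteq> n \<longrightarrow> f k = \<zero>\<^bsub>C_bimod T \<Gamma> m k\<^esub>)}"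

definition graded_ring :: "('a, 'b) ring_scheme \<Rightarrow> (nat \<Rightarrow> 'a set) \<Rightarrow> bool" where
  "graded_ring G D \<longleftrightarrow> ring G \<and> (\<forall>n. additive_subgroup (D n) G) \<and> \<one>\<^bsub>G\<^esub> \<in> D 0 \<and>
     (\<forall>i j. \<forall>x\<in>D i. \<forall>y\<in>D j. x \<otimes>\<^bsub>G\<^esub> y \<in> D (i + j)) \<and>
     (\<forall>x\<in>carrier G. \<exists>!p. (\<forall>n. p n \<in> D n) \<and> finite {n. p n \<noteq> \<zero>\<^bsub>G\<^esub>} \<and>
        x = (\<Oplus>\<^bsub>G\<^esub>n\<in>{n. p n \<noteq> \<zero>\<^bsub>G\<^esub>}. p n))"

end

theory Submission
  imports Defs "HOL-Algebra.UnivPoly"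
begin

text \<open>
  Apart from the construction of the operator rings, only the surjection from \<open>A\<close> onto \<open>R\<close> with
  kernel \<open>K\<close> matters. An element of \<open>K ^ (n + 1)\<close> is a sum of products of an element of \<open>K ^ n\<close> and
  an element of \<open>K\<close>, so \<open>K ^ n\<close> is additively spanned by products of \<open>n\<close> elements of \<open>K\<close>; modulo
  \<open>K ^ (n + 1)\<close> such a product depends only on the classes of its factors modulo \<open>K ^ 2\<close>, which gives
  the surjections from the tensor powers. The graded ring is the image of the Rees ring, the subring
  of \<open>A[X]\<close> of the polynomials whose coefficient of \<open>X ^ n\<close> lies in \<open>K ^ n\<close>, under taking the class
  of each coefficient; so it inherits the ring laws from \<open>A[X]\<close>, and the homogeneous elements are the
  images of monomials.
\<close>

section \<open>Images and quotients of abelian groups\<close>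

text \<open>The obstacle in building the operator rings is the missing unit: the tensor ring and its
  quotient by \<open>J\<close> are handled as instances of \<open>nonunital_ring\<close>, and a unit
  appears only when the integers are adjoined. Maps out of quotients (the regular representation,
  the multiplication maps) all arise in one way: extend additively from basis elements, show that
  the generators of the relations die, and read the value off a coset with \<open>the_elem\<close>.
  On the filtered side, products of classes are well defined because K ^ (i + 1) K ^ j and K ^ i K ^
  (j + 1) both lie in K ^ (i + j + 1); the actions of \<open>R\<close> are the case where one degree
  is zero. Degree zero is otherwise exceptional: A / K is \<open>R\<close> only up to the
  isomorphism induced by \<open>h\<close>, and \<open>gr_ring\<close> stores \<open>R\<close>
  itself, so its product formula breaks a convolution into two actions and an inner sum. Checking
  associativity on that formula would mean a case split over degrees; polynomials avoid it.\<close>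

text \<open>A surjection that respects the operations carries each group axiom along, so none has to
  be verified on cosets. With \<open>f = id\<close> it moves the axioms to a record with the same
  additive structure.\<close>

lemma (in abelian_group) abelian_group_image:
  assumes car: "carrier H = f ` carrier G"
    and add: "\<And>x y. \<lbrakk>x \<in> carrier G; y \<in> carrier G\<rbrakk> \<Longrightarrow> f (x \<oplus> y) = f x \<oplus>\<^bsub>H\<^esub> f y"
    and zero: "f \<zero> = \<zero>\<^bsub>H\<^esub>"
  shows "abelian_group H"
proof (rule abelian_groupI)
  show "x \<oplus>\<^bsub>H\<^esub> y \<in> carrier H" if "x \<in> carrier H" "y \<in> carrier H" for x y
    using that unfolding car by (auto simp flip: add)
  show "\<zero>\<^bsub>H\<^esub> \<in> carrier H"
    unfolding car by (simp flip: zero)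
  show "x \<oplus>\<^bsub>H\<^esub> y \<oplus>\<^bsub>H\<^esub> z = x \<oplus>\<^bsub>H\<^esub> (y \<oplus>\<^bsub>H\<^esub> z)"
    if "x \<in> carrier H" "y \<in> carrier H" "z \<in> carrier H" for x y z
    using that unfolding car by (auto simp: a_assoc simp flip: add)
  show "x \<oplus>\<^bsub>H\<^esub> y = y \<oplus>\<^bsub>H\<^esub> x" if "x \<in> carrier H" "y \<in> carrier H" for x y
    using that unfolding car by (auto simp: a_comm simp flip: add)
  show "\<zero>\<^bsub>H\<^esub> \<oplus>\<^bsub>H\<^esub> x = x" if "x \<in> carrier H" for x
    using that unfolding car by (auto simp flip: add zero)
  show "\<exists>y\<in>carrier H. y \<oplus>\<^bsub>H\<^esub> x = \<zero>\<^bsub>H\<^esub>" if x: "x \<in> carrier H" for x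
  proof -
    obtain u where u: "u \<in> carrier G" "x = f u"
      using x unfolding car by blast
    then have "f (\<ominus> u) \<oplus>\<^bsub>H\<^esub> x = \<zero>\<^bsub>H\<^esub>"
      by (simp add: l_neg zero flip: add)
    then show ?thesis
      using u unfolding car by blast
  qed
qed

text \<open>The shape that an additivity relation of a tensor product takes once it is evaluated in
  the target group.\<close>

lemma (in abelian_group) add_minus_minus:
  assumes "x \<in> carrier G" "y \<in> carrier G"
  shows "x \<oplus> y \<ominus> x \<ominus> y = \<zero>"
proof -
  have "x \<oplus> y \<ominus> x \<ominus> y = (x \<oplus> y) \<oplus> (\<ominus> (x \<oplus> y))"
    using assms by (simp add: minus_eq minus_add a_assoc)
  then show ?thesis
    using assms by (simp add: r_neg)
qed

context abelian_subgroup
begin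

lemma rcos_eq_iff:
  assumes "x \<in> carrier G" "y \<in> carrier G"
  shows "H +> x = H +> y \<longleftrightarrow> x \<ominus> y \<in> H"
proof -
  have "H +> x = H +> y \<longleftrightarrow> x \<in> H +> y"
    using assms by (metis a_repr_independence' a_rcos_self)
  then show ?thesis
    using assms by (simp add: a_rcos_module minus_eq)
qed

lemma Quot_carrier: "carrier (G Quot H) = (\<lambda>x. H +> x) ` carrier G"
  by (auto simp: FactRing_simps)

lemma Quot_add:
  "\<lbrakk>x \<in> carrier G; y \<in> carrier G\<rbrakk> \<Longrightarrow> (H +> x) \<oplus>\<^bsub>G Quot H\<^esub> (H +> y) = H +> (x \<oplus> y)"
  by (simp add: FactRing_def a_rcos_sum)

lemma Quot_zero: "\<zero>\<^bsub>G Quot H\<^esub> = H +> \<zero>"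
  by (simp add: FactRing_def a_subset)

lemma abelian_group_Quot: "abelian_group (G Quot H)"
  by (rule abelian_group_image[where f = "\<lambda>x. H +> x"])
     (simp_all add: Quot_carrier Quot_add Quot_zero)

text \<open>A function that is constant on a coset has a singleton image there; this is the form in
  which maps descend to a quotient.\<close>

lemma the_elem_image_rcos:
  assumes "x \<in> carrier G" and "\<And>y. \<lbrakk>y \<in> carrier G; y \<ominus> x \<in> H\<rbrakk> \<Longrightarrow> f y = f x"
  shows "the_elem (f ` (H +> x)) = f x"
proof -
  have "f ` (H +> x) = {f x}"
  proof (intro equalityI subsetI)
    fix z assume "z \<in> f ` (H +> x)"
    then obtain y where y: "y \<in> H +> x" "z = f y"
      by blast
    then have "y \<in> carrier G" "y \<ominus> x \<in> H"
      using assms(1) by (auto intro: a_elemrcos_carrier simp: minus_eq a_rcos_module_imp)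
    then show "z \<in> {f x}"
      using y assms(2) by simp
  qed (use assms(1) a_rcos_self in auto)
  then show ?thesis
    by simp
qed

end

lemma (in abelian_group) abelian_subgroupI_additive:
  "additive_subgroup H G \<Longrightarrow> abelian_subgroup H G"
  by (intro abelian_subgroupI3) (auto simp: abelian_group_axioms)


section \<open>Rings that need not have a unit\<close>

locale nonunital_ring = abelian_group R for R (structure) +
  assumes mult_closed: "\<lbrakk>x \<in> carrier R; y \<in> carrier R\<rbrakk> \<Longrightarrow> x \<otimes> y \<in> carrier R"
    and mult_assoc: "\<lbrakk>x \<in> carrier R; y \<in> carrier R; z \<in> carrier R\<rbrakk> \<Longrightarrow> (x \<otimes> y) \<otimes> z = x \<otimes> (y \<otimes> z)"
    and l_distr: "\<lbrakk>x \<in> carrier R; y \<in> carrier R; z \<in> carrier R\<rbrakk> \<Longrightarrow> (x \<oplus> y) \<otimes> z = x \<otimes> z \<oplus> y \<otimes> z"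
    and r_distr: "\<lbrakk>x \<in> carrier R; y \<in> carrier R; z \<in> carrier R\<rbrakk> \<Longrightarrow> z \<otimes> (x \<oplus> y) = z \<otimes> x \<oplus> z \<otimes> y"

context nonunital_ring
begin

text \<open>Multiplication by a fixed element is an additive endomorphism, and these commute with
  integer multiples. The product of the unitization mixes both kinds of multiplication.\<close>

lemma int_pow_mult_left:
  fixes k :: int
  assumes "x \<in> carrier R" "y \<in> carrier R"
  shows "[k] \<cdot> (x \<otimes> y) = ([k] \<cdot> x) \<otimes> y"
proof -
  have "(\<lambda>x. x \<otimes> y) \<in> hom (add_monoid R) (add_monoid R)"
    using assms by (auto intro!: homI simp: mult_closed l_distr)
  from hom_int_pow[OF this] show ?thesis
    using assms by (simp add: add_pow_def a_group)
qed

lemma int_pow_mult_right: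
  fixes k :: int
  assumes "x \<in> carrier R" "y \<in> carrier R"
  shows "[k] \<cdot> (x \<otimes> y) = x \<otimes> ([k] \<cdot> y)"
proof -
  have "(\<lambda>y. x \<otimes> y) \<in> hom (add_monoid R) (add_monoid R)"
    using assms by (auto intro!: homI simp: mult_closed r_distr)
  from hom_int_pow[OF this] show ?thesis
    using assms by (simp add: add_pow_def a_group)
qed

lemma l_zero_mult: "x \<in> carrier R \<Longrightarrow> \<zero> \<otimes> x = \<zero>"
  by (metis l_distr mult_closed add.r_cancel_one' zero_closed l_zero)

lemma r_zero_mult: "x \<in> carrier R \<Longrightarrow> x \<otimes> \<zero> = \<zero>"
  by (metis r_distr mult_closed add.r_cancel_one' zero_closed l_zero)

text \<open>For i and j in the ideal, (i + x)(j + y) differs from x y by i(j + y) + x j, which lies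
  in the ideal. Hence the union over all representatives collapses to a single coset.\<close>

lemma rcoset_mult_rng_ideal:
  assumes I: "rng_ideal R I" and x: "x \<in> carrier R" and y: "y \<in> carrier R"
  shows "rcoset_mult R I (I +> x) (I +> y) = I +> (x \<otimes> y)"
proof -
  interpret abelian_subgroup I R
    using I abelian_subgroupI_additive unfolding rng_ideal_def by blast
  have *: "I +> (a \<otimes> b) = I +> (x \<otimes> y)" if a: "a \<in> I +> x" and b: "b \<in> I +> y" for a b
  proof -
    obtain i where i: "i \<in> I" "a = i \<oplus> x"
      using a by (auto simp: a_r_coset_def')
    obtain j where j: "j \<in> I" "b = j \<oplus> y"
      using b by (auto simp: a_r_coset_def')
    have c: "i \<in> carrier R" "j \<in> carrier R"
      using i j by auto
    have "a \<otimes> b = (i \<otimes> (j \<oplus> y) \<oplus> x \<otimes> j) \<oplus> x \<otimes> y"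
      using c x y i j by (simp add: l_distr r_distr mult_closed a_ac)
    moreover have "i \<otimes> (j \<oplus> y) \<in> I" "x \<otimes> j \<in> I"
      using I i j x y c unfolding rng_ideal_def by auto
    ultimately have "a \<otimes> b \<in> I +> (x \<otimes> y)"
      by (auto simp: a_r_coset_def')
    then show ?thesis
      using x y by (metis a_repr_independence' mult_closed)
  qed
  have "x \<in> I +> x" "y \<in> I +> y"
    using x y by (auto intro: a_rcos_self)
  then show ?thesis
    unfolding rcoset_mult_def using * by blast
qed

lemma nonunital_ring_Quot:
  assumes I: "rng_ideal R I"
  shows "nonunital_ring (R Quot I)"
proof -
  interpret S: abelian_subgroup I R
    using I abelian_subgroupI_additive unfolding rng_ideal_def by blast
  have mult: "(I +> x) \<otimes>\<^bsub>R Quot I\<^esub> (I +> y) = I +> (x \<otimes> y)" if "x \<in> carrier R" "y \<in> carrier R" for x y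
    using that by (simp add: FactRing_def rcoset_mult_rng_ideal I)
  interpret Q: abelian_group "R Quot I"
    by (rule S.abelian_group_Quot)
  show ?thesis
    by unfold_locales
       (auto simp: S.Quot_carrier mult S.Quot_add mult_closed mult_assoc l_distr r_distr)
qed

lemma rng_ideal_carrier: "rng_ideal R (carrier R)"
  unfolding rng_ideal_def
  by (auto intro: additive_subgroupI add.subgroup_self mult_closed)

lemma rng_ideal_genideal: "S \<subseteq> carrier R \<Longrightarrow> rng_ideal R (rng_genideal R S)"
proof -
  assume S: "S \<subseteq> carrier R"
  define F where "F = {I. rng_ideal R I \<and> S \<subseteq> I}"
  \<comment> \<open>The family must be nonempty: an empty intersection would be the whole type and
    not a subset of the carrier.\<close>
  have "carrier R \<in> F"
    using S rng_ideal_carrier by (simp add: F_def)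
  moreover have "\<And>I. I \<in> F \<Longrightarrow> subgroup I (add_monoid R)"
    by (auto simp: F_def rng_ideal_def additive_subgroup_def)
  ultimately have "additive_subgroup (\<Inter>F) R"
    by (intro additive_subgroupI add.subgroups_Inter) auto
  then show ?thesis
    unfolding rng_genideal_def F_def[symmetric] rng_ideal_def by (auto simp: F_def rng_ideal_def)
qed

text \<open>Without a unit there is no ring homomorphism in the library sense, so a homomorphism is required
  to preserve the additive and the multiplicative structure separately.\<close>

lemma hom_Quot:
  assumes I: "rng_ideal R I" and S: "abelian_group S"
    and h: "h \<in> hom (add_monoid R) (add_monoid S)" "h \<in> hom R S"
    and ker: "\<And>x. x \<in> I \<Longrightarrow> h x = \<zero>\<^bsub>S\<^esub>"
  shows "(\<lambda>X. the_elem (h ` X)) \<in> hom (add_monoid (R Quot I)) (add_monoid S)"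
    and "(\<lambda>X. the_elem (h ` X)) \<in> hom (R Quot I) S"
    and "\<And>x. x \<in> carrier R \<Longrightarrow> h ` (I +> x) = {h x}"
proof -
  interpret S: abelian_group S by (rule S)
  interpret I: abelian_subgroup I R
    using I abelian_subgroupI_additive unfolding rng_ideal_def by blast
  have mult: "(I +> x) \<otimes>\<^bsub>R Quot I\<^esub> (I +> y) = I +> (x \<otimes> y)" if "x \<in> carrier R" "y \<in> carrier R" for x y
    using that by (simp add: FactRing_def rcoset_mult_rng_ideal I)
  have clo: "h x \<in> carrier S" if "x \<in> carrier R" for x
    using h(1) that by (auto simp: hom_def)
  show im: "h ` (I +> x) = {h x}" if x: "x \<in> carrier R" for x
  proof -
    have "h (i \<oplus> x) = h x" if "i \<in> I" for i
      using hom_mult[OF h(1), of i x] that x ker[OF that] clo[OF x] by simp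
    then show ?thesis
      using I.a_rcos_self[OF x] by (auto simp: a_r_coset_def')
  qed
  show "(\<lambda>X. the_elem (h ` X)) \<in> hom (add_monoid (R Quot I)) (add_monoid S)"
    using hom_mult[OF h(1)] by (intro homI) (auto simp: I.Quot_carrier I.Quot_add im clo)
  show "(\<lambda>X. the_elem (h ` X)) \<in> hom (R Quot I) S"
    using hom_mult[OF h(2)] by (intro homI) (auto simp: I.Quot_carrier mult im clo mult_closed)
qed

end

section \<open>Adjoining a unit to a ring without one\<close>

definition unitization :: "('a, 'b) ring_scheme \<Rightarrow> (int \<times> 'a) ring" where
  "unitization Op =
     \<lparr>carrier = UNIV \<times> carrier Op,
      monoid.mult = (\<lambda>(k, r) (l, s). (k * l, [k] \<cdot>\<^bsub>Op\<^esub> s \<oplus>\<^bsub>Op\<^esub> [l] \<cdot>\<^bsub>Op\<^esub> r \<oplus>\<^bsub>Op\<^esub> r \<otimes>\<^bsub>Op\<^esub> s)),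
      monoid.one = (1, \<zero>\<^bsub>Op\<^esub>),
      ring.zero = (0, \<zero>\<^bsub>Op\<^esub>),
      ring.add = (\<lambda>(k, r) (l, s). (k + l, r \<oplus>\<^bsub>Op\<^esub> s))\<rparr>"

context nonunital_ring
begin

lemma ring_unitization: "ring (unitization R)"
proof (rule ringI)
  note [simp] = unitization_def
  show "abelian_group (unitization R)"
  proof (rule abelian_groupI)
    show "\<exists>y\<in>carrier (unitization R). y \<oplus>\<^bsub>unitization R\<^esub> x = \<zero>\<^bsub>unitization R\<^esub>"
      if "x \<in> carrier (unitization R)" for x
      using that by (intro bexI[of _ "(- fst x, \<ominus> snd x)"]) (auto simp: l_neg)
  qed (auto simp: a_ac)
  \<comment> \<open>These rules move every integer multiple outside the products, so that both sides
    of a ring law become the same sum of multiples of products up to order.\<close>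
  note pow = add.int_pow_mult add.int_pow_mult_distrib[OF a_comm] add.int_pow_pow
    int_pow_mult_left[symmetric] int_pow_mult_right[symmetric]
  show "Group.monoid (unitization R)"
    by (rule monoidI)
       (auto simp: mult_closed mult_assoc l_distr r_distr pow l_zero_mult r_zero_mult a_ac mult_ac)
  show "(x \<oplus>\<^bsub>unitization R\<^esub> y) \<otimes>\<^bsub>unitization R\<^esub> z
        = x \<otimes>\<^bsub>unitization R\<^esub> z \<oplus>\<^bsub>unitization R\<^esub> y \<otimes>\<^bsub>unitization R\<^esub> z"
    if "x \<in> carrier (unitization R)" "y \<in> carrier (unitization R)" "z \<in> carrier (unitization R)" for x y z
    using that by (auto simp: mult_closed l_distr pow a_ac ring_distribs)
  show "z \<otimes>\<^bsub>unitization R\<^esub> (x \<oplus>\<^bsub>unitization R\<^esub> y)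
        = z \<otimes>\<^bsub>unitization R\<^esub> x \<oplus>\<^bsub>unitization R\<^esub> z \<otimes>\<^bsub>unitization R\<^esub> y"
    if "x \<in> carrier (unitization R)" "y \<in> carrier (unitization R)" "z \<in> carrier (unitization R)" for x y z
    using that by (auto simp: mult_closed r_distr pow a_ac ring_distribs)
qed

text \<open>The universal property of adjoining a unit: since the unit must go to the unit, the
  extension of \<open>h\<close> has to be this map. Its special case for \<open>rho\<close> is
  \<open>rho_hat\<close>.\<close>

lemma unitization_hom:
  assumes S: "ring S"
    and h: "h \<in> hom (add_monoid R) (add_monoid S)" "h \<in> hom R S"
  shows "(\<lambda>(k, u). [k] \<cdot>\<^bsub>S\<^esub> \<one>\<^bsub>S\<^esub> \<oplus>\<^bsub>S\<^esub> h u) \<in> ring_hom (unitization R) S"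
proof -
  interpret S: ring S by (rule S)
  have clo: "h x \<in> carrier S" if "x \<in> carrier R" for x
    using h(1) that by (auto simp: hom_def)
  have add: "h (x \<oplus> y) = h x \<oplus>\<^bsub>S\<^esub> h y" if "x \<in> carrier R" "y \<in> carrier R" for x y
    using hom_mult[OF h(1)] that by simp
  have mult: "h (x \<otimes> y) = h x \<otimes>\<^bsub>S\<^esub> h y" if "x \<in> carrier R" "y \<in> carrier R" for x y
    using hom_mult[OF h(2)] that by simp
  have pow: "h ([k] \<cdot> x) = [k] \<cdot>\<^bsub>S\<^esub> h x" if "x \<in> carrier R" for k :: int and x
    using hom_int_pow[OF h(1)] that by (simp add: add_pow_def a_group S.a_group)
  have zero: "h \<zero> = \<zero>\<^bsub>S\<^esub>"
    using hom_one[OF h(1) a_group S.a_group] by simp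
  show ?thesis
    by (rule ring_hom_memI)
       (auto simp: unitization_def clo add mult pow zero mult_closed S.l_distr S.r_distr S.a_ac
          S.add.int_pow_mult S.add.int_pow_mult_distrib[OF S.a_comm] S.add.int_pow_pow mult_ac
          S.add_pow_ldistr_int S.add_pow_rdistr_int)
qed

end

section \<open>The filtration by powers of the kernel of a surjective homomorphism\<close>

locale ring_surjection = A: ring A + R: ring R for A (structure) and R (structure) +
  fixes h
  assumes hom: "h \<in> ring_hom A R" and surj: "h ` carrier A = carrier R"
begin

definition K where "K = a_kernel A R h"

definition P :: "nat \<Rightarrow> 'a set" where "P n = ideal_pow A K n"

text \<open>The modulus is one power above the degree, so \<open>cls 0\<close> is reduction modulo
  \<open>K\<close>. The degree is an argument because the same element has different classes in
  different degrees.\<close>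

definition cls :: "nat \<Rightarrow> 'a \<Rightarrow> 'a set" where "cls n x = P (Suc n) +> x"

definition lft :: "'c \<Rightarrow> 'a set" where "lft c = {a \<in> carrier A. h a = c}"

definition C :: "nat \<Rightarrow> ('c, 'a set) bimod" where
  "C n = ring.extend (A \<lparr>carrier := P n\<rparr> Quot P (Suc n))
     \<lparr>lact = (\<lambda>c X. rcoset_mult A (P (Suc n)) (lft c) X),
      ract = (\<lambda>X c. rcoset_mult A (P (Suc n)) X (lft c))\<rparr>"

interpretation h: ring_hom_ring A R h
  by (intro ring_hom_ringI2 A.ring_axioms R.ring_axioms hom)

lemma K_iff: "x \<in> K \<longleftrightarrow> x \<in> carrier A \<and> h x = \<zero>\<^bsub>R\<^esub>"
  unfolding K_def a_kernel_def' by simp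

lemma ideal_K: "ideal K A"
  unfolding K_def by (rule h.kernel_is_ideal)

lemma P_0: "P 0 = carrier A"
  by (simp add: P_def)

lemma P_Suc: "P (Suc n) = ideal_prod A (P n) K"
  by (simp add: P_def)

lemma ideal_P: "ideal (P n) A"
  by (induction n) (auto simp: P_0 P_Suc intro: A.oneideal A.ideal_prod_is_ideal ideal_K)

lemma P_carrier: "x \<in> P n \<Longrightarrow> x \<in> carrier A"
  using ideal.Icarr[OF ideal_P] .

lemma P_add: "\<lbrakk>x \<in> P n; y \<in> P n\<rbrakk> \<Longrightarrow> x \<oplus> y \<in> P n"
  using additive_subgroup.a_closed[OF ideal.axioms(1)[OF ideal_P]] .

lemma P_minus: "x \<in> P n \<Longrightarrow> \<ominus> x \<in> P n"
  by (meson ideal_P ideal.axioms(1) additive_subgroup.a_inv_closed A.abelian_group_axioms)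

lemma P_zero: "\<zero> \<in> P n"
  using additive_subgroup.zero_closed[OF ideal.axioms(1)[OF ideal_P]] .

lemma abelian_subgroup_P: "abelian_subgroup (P n) A"
  by (intro A.abelian_subgroupI_additive ideal.axioms(1) ideal_P)

text \<open>Powers grow by a factor from \<open>K\<close> on the right, so the induction runs over
  the second exponent: x(uk) = (xu)k brings that factor to the end.\<close>

lemma P_mult: "\<lbrakk>x \<in> P i; y \<in> P j\<rbrakk> \<Longrightarrow> x \<otimes> y \<in> P (i + j)"
proof (induction j arbitrary: y)
  case 0
  then show ?case
    using ideal.I_r_closed[OF ideal_P] by (simp add: P_0)
next
  case (Suc j)
  from Suc.prems(2)[unfolded P_Suc] Suc.prems(1) show ?case
  proof (induction y rule: ideal_prod.induct)
    case (prod u k)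
    then have "(x \<otimes> u) \<otimes> k \<in> P (Suc (i + j))"
      unfolding P_Suc by (intro ideal_prod.prod Suc.IH)
    then show ?case
      using prod by (simp add: A.m_assoc P_carrier K_iff)
  next
    case (sum s t)
    then have "s \<in> P (Suc j)" "t \<in> P (Suc j)"
      by (simp_all add: P_Suc)
    then show ?case
      using sum by (simp add: A.r_distr P_carrier P_add)
  qed
qed

lemma P_Suc_subset: "P (Suc n) \<subseteq> P n"
  unfolding P_Suc using A.ideal_prod_inter[OF ideal_P ideal_K] by blast

lemma P_1: "P (Suc 0) = K"
proof
  show "P (Suc 0) \<subseteq> K"
    unfolding P_Suc using A.ideal_prod_inter[OF ideal_P ideal_K] by blast
  show "K \<subseteq> P (Suc 0)"
  proof
    fix x assume x: "x \<in> K"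
    \<comment> \<open>The first power is the product of the whole ring with \<open>K\<close>; the
      unit supplies the left factor.\<close>
    then have "\<one> \<otimes> x \<in> P (Suc 0)"
      unfolding P_Suc by (intro ideal_prod.prod) (auto simp: P_0)
    then show "x \<in> P (Suc 0)"
      using x by (simp add: K_iff)
  qed
qed

lemma cls_eq_iff:
  "\<lbrakk>x \<in> carrier A; y \<in> carrier A\<rbrakk> \<Longrightarrow> cls n x = cls n y \<longleftrightarrow> x \<ominus> y \<in> P (Suc n)"
  unfolding cls_def by (rule abelian_subgroup.rcos_eq_iff[OF abelian_subgroup_P])

lemma cls_self: "x \<in> carrier A \<Longrightarrow> x \<in> cls n x"
  unfolding cls_def by (rule abelian_subgroup.a_rcos_self[OF abelian_subgroup_P])

lemma cls_eqI: "\<lbrakk>x \<in> carrier A; y \<in> cls n x\<rbrakk> \<Longrightarrow> cls n y = cls n x"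
  unfolding cls_def by (metis abelian_subgroup.a_repr_independence'[OF abelian_subgroup_P])

lemma mem_cls_carrier: "\<lbrakk>x \<in> carrier A; y \<in> cls n x\<rbrakk> \<Longrightarrow> y \<in> carrier A"
  unfolding cls_def by (metis abelian_subgroup.a_elemrcos_carrier[OF abelian_subgroup_P])

lemma mem_cls_diff: "\<lbrakk>x \<in> carrier A; y \<in> cls n x\<rbrakk> \<Longrightarrow> y \<ominus> x \<in> P (Suc n)"
  using cls_eq_iff[of y x n] cls_eqI[of x y n] mem_cls_carrier[of x y n] by simp

lemma mem_cls_P:
  assumes "x \<in> P n" "y \<in> cls n x"
  shows "y \<in> P n"
proof -
  have "y \<ominus> x \<in> P n" and y: "y \<in> carrier A"
    using mem_cls_diff[of x y n] mem_cls_carrier[of x y n] assms P_carrier P_Suc_subset by blast+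
  then have "y \<ominus> x \<oplus> x \<in> P n"
    using assms P_add by blast
  then show ?thesis
    using y P_carrier[OF assms(1)] by (simp add: A.minus_eq A.a_assoc A.l_neg)
qed

text \<open>The difference x'y' - xy equals (x' - x)y' + x(y' - y), and in each summand one factor
  lies one power deeper than its degree requires.\<close>

lemma cls_mult_cong:
  assumes "x \<in> P i" "y \<in> P j" "x' \<in> cls i x" "y' \<in> cls j y"
  shows "cls (i + j) (x' \<otimes> y') = cls (i + j) (x \<otimes> y)"
proof -
  have c: "x \<in> carrier A" "y \<in> carrier A" "x' \<in> carrier A" "y' \<in> carrier A"
    using assms P_carrier mem_cls_carrier by blast+
  have "(x' \<ominus> x) \<otimes> y' \<in> P (Suc (i + j))"
    using P_mult[of "x' \<ominus> x" "Suc i" y' j] assms c mem_cls_diff mem_cls_P by simp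
  moreover have "x \<otimes> (y' \<ominus> y) \<in> P (Suc (i + j))"
    using P_mult[of x i "y' \<ominus> y" "Suc j"] assms c mem_cls_diff by simp
  moreover have "x' \<otimes> y' \<ominus> x \<otimes> y = (x' \<ominus> x) \<otimes> y' \<oplus> x \<otimes> (y' \<ominus> y)"
    using c by algebra
  ultimately show ?thesis
    using c by (simp add: cls_eq_iff P_add)
qed

text \<open>The total degree is a variable of its own because the graded product pairs
  \<open>i\<close> with \<open>n - i\<close>, whose sum is not syntactically
  \<open>n\<close>.\<close>

lemma rcoset_mult_cls:
  assumes "x \<in> P i" "y \<in> P j" "n = i + j"
  shows "rcoset_mult A (P (Suc n)) (cls i x) (cls j y) = cls n (x \<otimes> y)"
proof -
  have "P (Suc n) +> (x' \<otimes> y') = cls n (x \<otimes> y)" if "x' \<in> cls i x" "y' \<in> cls j y" for x' y'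
    using cls_mult_cong[OF assms(1,2) that] assms(3) by (simp add: cls_def)
  moreover have "x \<in> cls i x" "y \<in> cls j y"
    using assms P_carrier cls_self by blast+
  ultimately show ?thesis
    unfolding rcoset_mult_def by blast
qed

text \<open>A fibre of \<open>h\<close> is a coset of the kernel. This turns the actions of
  \<open>R\<close> into multiplication by classes of degree zero.\<close>

lemma lft_eq: "a \<in> carrier A \<Longrightarrow> lft (h a) = cls 0 a"
proof (intro equalityI subsetI)
  fix b assume a: "a \<in> carrier A" and "b \<in> lft (h a)"
  then have b: "b \<in> carrier A" "h b = h a"
    by (simp_all add: lft_def)
  then have "b \<ominus> a \<in> K"
    using a by (simp add: K_iff A.minus_eq R.r_neg)
  then have "cls 0 b = cls 0 a"
    using a b by (simp add: cls_eq_iff P_1)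
  then show "b \<in> cls 0 a"
    using b cls_self by blast
next
  fix b assume a: "a \<in> carrier A" and b: "b \<in> cls 0 a"
  then have "b \<in> carrier A" "b \<ominus> a \<in> K"
    using mem_cls_carrier mem_cls_diff P_1 by blast+
  moreover from this have "h b = h (b \<ominus> a \<oplus> a)"
    using a by (simp add: A.minus_eq A.a_assoc A.l_neg)
  ultimately show "b \<in> lft (h a)"
    using a by (simp add: lft_def K_iff del: h.hom_a_inv)
qed

lemma C_carrier: "carrier (C n) = cls n ` P n"
  by (auto simp: C_def ring.defs FactRing_def A_RCOSETS_def' cls_def a_r_coset_def')

lemma C_add: "\<lbrakk>x \<in> carrier A; y \<in> carrier A\<rbrakk> \<Longrightarrow> cls n x \<oplus>\<^bsub>C n\<^esub> cls n y = cls n (x \<oplus> y)"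
  using abelian_subgroup.a_rcos_sum[OF abelian_subgroup_P]
  by (simp add: C_def ring.defs FactRing_def cls_def set_add_def')

lemma C_zero: "\<zero>\<^bsub>C n\<^esub> = cls n \<zero>"
  using abelian_subgroup.Quot_zero[OF abelian_subgroup_P, of "Suc n"]
  by (simp add: C_def ring.defs FactRing_def cls_def)

lemma abelian_group_P: "abelian_group (A \<lparr>carrier := P n\<rparr>)"
proof (rule abelian_groupI)
  fix x assume "x \<in> carrier (A \<lparr>carrier := P n\<rparr>)"
  then show "\<exists>y\<in>carrier (A \<lparr>carrier := P n\<rparr>). y \<oplus>\<^bsub>A \<lparr>carrier := P n\<rparr>\<^esub> x = \<zero>\<^bsub>A \<lparr>carrier := P n\<rparr>\<^esub>"
    by (intro bexI[of _ "\<ominus> x"]) (auto simp: P_carrier P_minus A.l_neg)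
qed (auto simp: P_carrier P_add P_zero A.a_ac)

lemma abelian_group_C: "abelian_group (C n)"
proof -
  interpret P: abelian_group "A \<lparr>carrier := P n\<rparr>"
    by (rule abelian_group_P)
  show ?thesis
    by (rule P.abelian_group_image[where f = "cls n"]) (auto simp: C_carrier C_add C_zero P_carrier)
qed

lemma lact_C: "\<lbrakk>a \<in> carrier A; x \<in> P n\<rbrakk> \<Longrightarrow> lact (C n) (h a) (cls n x) = cls n (a \<otimes> x)"
  by (simp add: C_def ring.defs lft_eq rcoset_mult_cls P_0)

lemma ract_C: "\<lbrakk>a \<in> carrier A; x \<in> P n\<rbrakk> \<Longrightarrow> ract (C n) (cls n x) (h a) = cls n (x \<otimes> a)"
  by (simp add: C_def ring.defs lft_eq rcoset_mult_cls P_0)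

lemma bimodule_C: "bimodule R (C n)"
proof -
  interpret M: abelian_group "C n"
    by (rule abelian_group_C)
  note ideal = ideal.I_l_closed[OF ideal_P] ideal.I_r_closed[OF ideal_P]
  note [simp] = lact_C ract_C C_add P_add ideal A.l_distr A.r_distr A.m_assoc P_carrier
  \<comment> \<open>Scalars are written as values of \<open>h\<close>, and the homomorphism rules
    are used backwards: sums and products of such values must be gathered under one \<open>h\<close>
    before \<open>lact_C\<close> and \<open>ract_C\<close> apply.\<close>
  note [simp del] = h.hom_add h.hom_mult h.hom_one
  show ?thesis
  proof (intro bimodule.intro R.ring_axioms M.abelian_group_axioms bimodule_axioms.intro)
    fix x assume "x \<in> carrier (C n)"
    then show "lact (C n) \<one>\<^bsub>R\<^esub> x = x" "ract (C n) x \<one>\<^bsub>R\<^esub> = x"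
      by (auto simp: C_carrier simp flip: h.hom_one)
  qed (auto simp: C_carrier simp flip: surj h.hom_add h.hom_mult)
qed

lemma carrier_C_1: "carrier (C (Suc 0)) = cls (Suc 0) ` K"
  by (simp add: C_carrier P_1)

end

section \<open>Free abelian groups and additive extension\<close>

lemma mem_free_ab: "f \<in> carrier (free_ab S) \<longleftrightarrow> Poly_Mapping.keys f \<subseteq> S"
  by (simp add: free_ab_def)

lemma free_ab_simps [simp]:
  "f \<oplus>\<^bsub>free_ab S\<^esub> g = f + g"
  "\<zero>\<^bsub>free_ab S\<^esub> = 0"
  "0 \<in> carrier (free_ab S)"
  "frag_of x \<in> carrier (free_ab S) \<longleftrightarrow> x \<in> S"
  by (simp_all add: free_ab_def)

lemma free_ab_closed:
  assumes "f \<in> carrier (free_ab S)" "g \<in> carrier (free_ab S)"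
  shows "f + g \<in> carrier (free_ab S)" "f - g \<in> carrier (free_ab S)"
  using assms Poly_Mapping.keys_add[of f g] keys_diff[of f g] by (auto simp: mem_free_ab)

lemma abelian_group_free_ab: "abelian_group (free_ab S)"
proof (rule abelian_groupI)
  show "\<exists>g\<in>carrier (free_ab S). g \<oplus>\<^bsub>free_ab S\<^esub> f = \<zero>\<^bsub>free_ab S\<^esub>" if "f \<in> carrier (free_ab S)" for f
    using that by (intro bexI[of _ "- f"]) (auto simp: mem_free_ab)
qed (auto simp: free_ab_closed add_ac)

lemma free_ab_minus [simp]:
  assumes "f \<in> carrier (free_ab S)"
  shows "\<ominus>\<^bsub>free_ab S\<^esub> f = - f"
  by (rule abelian_group.minus_equality[OF abelian_group_free_ab])
     (use assms in \<open>auto simp: mem_free_ab\<close>)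

lemma free_ab_diff [simp]: "g \<in> carrier (free_ab S) \<Longrightarrow> f \<ominus>\<^bsub>free_ab S\<^esub> g = f - g"
  by (simp add: a_minus_def)

lemma free_ab_subgroup_closed:
  assumes "additive_subgroup H (free_ab S)"
  shows "0 \<in> H" and "\<lbrakk>f \<in> H; g \<in> H\<rbrakk> \<Longrightarrow> f + g \<in> H" and "\<lbrakk>f \<in> H; g \<in> H\<rbrakk> \<Longrightarrow> f - g \<in> H"
proof -
  interpret additive_subgroup H "free_ab S" by (rule assms)
  show "0 \<in> H"
    using zero_closed by simp
  show *: "f + g \<in> H" if "f \<in> H" "g \<in> H" for f g
    using a_closed that by simp
  show "f - g \<in> H" if "f \<in> H" "g \<in> H"
    using *[of f "\<ominus>\<^bsub>free_ab S\<^esub> g"] that a_inv_closed[OF that(2)] by simp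
qed

lemma additive_subgroup_generate:
  "G \<subseteq> carrier (free_ab S) \<Longrightarrow> additive_subgroup (generate (add_monoid (free_ab S)) G) (free_ab S)"
  by (intro additive_subgroupI group.generate_is_subgroup abelian_group.a_group abelian_group_free_ab) simp

lemma free_ab_induct [consumes 1, case_names zero of diff]:
  assumes "f \<in> carrier (free_ab S)"
    and "Q 0"
    and "\<And>x. x \<in> S \<Longrightarrow> Q (frag_of x)"
    and "\<And>f g. \<lbrakk>f \<in> carrier (free_ab S); g \<in> carrier (free_ab S); Q f; Q g\<rbrakk> \<Longrightarrow> Q (f - g)"
  shows "Q f"
  using free_Abelian_group_induct[of f S Q] assms by (simp add: mem_free_ab)

text \<open>Compatibility with differences already forces D 0 = 0, so an induction over basis
  elements and differences suffices.\<close>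

lemma free_ab_map_mem:
  assumes "f \<in> carrier (free_ab S)" and "additive_subgroup H (free_ab S')"
    and "\<And>f g. D (f - g) = D f - D g"
    and "\<And>x. x \<in> S \<Longrightarrow> D (frag_of x) \<in> H"
  shows "D f \<in> H"
  using assms(1)
proof (induction f rule: free_ab_induct)
  case zero
  then show ?case
    using assms(3)[of 0 0] free_ab_subgroup_closed(1)[OF assms(2)] by simp
qed (use assms free_ab_subgroup_closed(3)[OF assms(2)] in auto)

text \<open>The means to show that an operation on formal combinations preserves a subgroup of
  relations, and therefore acts on the quotient: only the generating relations are
  inspected.\<close>

lemma generate_map_mem:
  assumes "r \<in> generate (add_monoid (free_ab S)) G" and "G \<subseteq> carrier (free_ab S)"
    and H: "additive_subgroup H (free_ab S')"
    and D: "\<And>f g. D (f - g) = D f - D g"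
    and mem: "\<And>g. g \<in> G \<Longrightarrow> D g \<in> H"
  shows "D r \<in> H"
proof -
  have "D 0 = 0"
    using D[of 0 0] by simp
  note * = this free_ab_subgroup_closed[OF H]
  from assms(1) show ?thesis
  proof (induction r rule: generate.induct)
    case one
    then show ?case
      using * by simp
  next
    case (incl g)
    then show ?case
      by (rule mem)
  next
    case (inv g)
    then have "inv\<^bsub>add_monoid (free_ab S)\<^esub> g = 0 - g"
      using assms(2) free_ab_minus[of g S] by (auto simp: a_inv_def)
    then show ?case
      using inv * D[of 0 g] mem free_ab_subgroup_closed(3)[OF H, of 0 "D g"] by simp
  next
    case (eng f g)
    have "D (f + g) = D f + D g"
      using D[of "f + g" g] by (simp add: algebra_simps)
    then show ?case
      using eng free_ab_subgroup_closed(2)[OF H] by simp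
  qed
qed

text \<open>The homomorphism that \<phi> induces on the free abelian group, with values in a group
  given as a record. \<open>free_rho\<close> is an instance of it, and so is the multiplication map
  before passing to the tensor power.\<close>

definition frag_sum :: "('b, 'n) ring_scheme \<Rightarrow> ('a \<Rightarrow> 'b) \<Rightarrow> ('a \<Rightarrow>\<^sub>0 int) \<Rightarrow> 'b" where
  "frag_sum G \<phi> f = (\<Oplus>\<^bsub>G\<^esub>p\<in>Poly_Mapping.keys f. [Poly_Mapping.lookup f p] \<cdot>\<^bsub>G\<^esub> \<phi> p)"

context abelian_group
begin

text \<open>Indices outside the support contribute zero multiples. Combinations with different
  supports can thus be summed over one common index set.\<close>

lemma frag_sum_superset:
  assumes "\<And>p. p \<in> S \<Longrightarrow> \<phi> p \<in> carrier G" "Poly_Mapping.keys f \<subseteq> B" "B \<subseteq> S" "finite B"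
  shows "frag_sum G \<phi> f = (\<Oplus>p\<in>B. [Poly_Mapping.lookup f p] \<cdot> \<phi> p)"
proof -
  have "[(0 :: int)] \<cdot> x = \<zero>" for x
    by (simp add: add_pow_def)
  then show ?thesis
    unfolding frag_sum_def
    by (intro add.finprod_mono_neutral_cong_left) (use assms in \<open>auto simp: in_keys_iff\<close>)
qed

lemma frag_sum_closed:
  assumes "\<And>p. p \<in> S \<Longrightarrow> \<phi> p \<in> carrier G" "f \<in> carrier (free_ab S)"
  shows "frag_sum G \<phi> f \<in> carrier G"
  unfolding frag_sum_def by (rule finsum_closed) (use assms in \<open>auto simp: mem_free_ab\<close>)

lemma frag_sum_add:
  assumes "\<And>p. p \<in> S \<Longrightarrow> \<phi> p \<in> carrier G" "f \<in> carrier (free_ab S)" "g \<in> carrier (free_ab S)"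
  shows "frag_sum G \<phi> (f + g) = frag_sum G \<phi> f \<oplus> frag_sum G \<phi> g"
proof -
  define B where "B = Poly_Mapping.keys f \<union> Poly_Mapping.keys g"
  have B: "finite B" "B \<subseteq> S" "Poly_Mapping.keys (f + g) \<subseteq> B" "Poly_Mapping.keys f \<subseteq> B" "Poly_Mapping.keys g \<subseteq> B"
    using assms Poly_Mapping.keys_add[of f g] by (auto simp: B_def mem_free_ab)
  have clo: "\<phi> p \<in> carrier G" if "p \<in> B" for p
    using that B assms by auto
  have "(\<Oplus>p\<in>B. [Poly_Mapping.lookup (f + g) p] \<cdot> \<phi> p)
      = (\<Oplus>p\<in>B. [Poly_Mapping.lookup f p] \<cdot> \<phi> p \<oplus> [Poly_Mapping.lookup g p] \<cdot> \<phi> p)"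
    using clo by (intro finsum_cong') (auto simp: lookup_add add.int_pow_mult)
  also have "\<dots> = (\<Oplus>p\<in>B. [Poly_Mapping.lookup f p] \<cdot> \<phi> p) \<oplus> (\<Oplus>p\<in>B. [Poly_Mapping.lookup g p] \<cdot> \<phi> p)"
    using clo by (intro finsum_addf) auto
  finally show ?thesis
    using B assms(1) by (simp add: frag_sum_superset[where S = S and B = B])
qed

lemma frag_sum_of:
  "\<phi> p \<in> carrier G \<Longrightarrow> frag_sum G \<phi> (frag_of p) = \<phi> p"
  by (simp add: frag_sum_def finsum_insert[of "{}", simplified] finsum_empty del: lookup_frag_of)

lemma frag_sum_zero: "frag_sum G \<phi> 0 = \<zero>"
  by (simp add: frag_sum_def)

lemma frag_sum_diff:
  assumes "\<And>p. p \<in> S \<Longrightarrow> \<phi> p \<in> carrier G" "f \<in> carrier (free_ab S)" "g \<in> carrier (free_ab S)"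
  shows "frag_sum G \<phi> (f - g) = frag_sum G \<phi> f \<ominus> frag_sum G \<phi> g"
proof -
  have "frag_sum G \<phi> f = frag_sum G \<phi> (f - g) \<oplus> frag_sum G \<phi> g"
    using frag_sum_add[where \<phi> = \<phi> and S = S and f = "f - g" and g = g] assms(1) assms(2,3) by (simp add: free_ab_closed)
  moreover have "frag_sum G \<phi> (f - g) \<in> carrier G" "frag_sum G \<phi> g \<in> carrier G"
    using frag_sum_closed[where \<phi> = \<phi> and S = S] assms(1) assms(2,3) by (simp_all add: free_ab_closed)
  ultimately show ?thesis
    by (simp add: minus_eq a_assoc r_neg)
qed

text \<open>This is what lets a multiadditive map descend to a tensor product: its extension has to
  vanish on the generating relations only.\<close>

lemma frag_sum_generate:
  assumes "\<And>p. p \<in> S \<Longrightarrow> \<phi> p \<in> carrier G" "B \<subseteq> carrier (free_ab S)"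
    and "\<And>g. g \<in> B \<Longrightarrow> frag_sum G \<phi> g = \<zero>"
    and "r \<in> generate (add_monoid (free_ab S)) B"
  shows "frag_sum G \<phi> r = \<zero>"
  using assms(4)
proof (induction r rule: generate.induct)
  case (inv g)
  then have "g \<in> carrier (free_ab S)"
    using assms(2) by auto
  moreover from this have "inv\<^bsub>add_monoid (free_ab S)\<^esub> g = 0 - g"
    using free_ab_minus[of g S] by (auto simp: a_inv_def)
  ultimately show ?case
    using inv frag_sum_diff[where \<phi> = \<phi> and S = S and f = 0 and g = g] assms(1) assms(3) by (simp add: frag_sum_zero minus_eq)
next
  case (eng f g)
  have "generate (add_monoid (free_ab S)) B \<subseteq> carrier (free_ab S)"
    by (rule additive_subgroup.a_subset[OF additive_subgroup_generate]) (rule assms)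
  then show ?case
    using eng frag_sum_add[where \<phi> = \<phi> and S = S and f = f and g = g] assms(1) by auto
qed (use assms frag_sum_zero in auto)

end


section \<open>Tensor powers of a bimodule\<close>

context bimodule
begin

definition tpow_gens :: "nat \<Rightarrow> ('m list \<Rightarrow>\<^sub>0 int) set" where
  "tpow_gens n =
    {frag_of (us @ (x \<oplus>\<^bsub>M\<^esub> y) # vs) - frag_of (us @ x # vs) - frag_of (us @ y # vs) | us x y vs.
        set us \<subseteq> carrier M \<and> x \<in> carrier M \<and> y \<in> carrier M \<and> set vs \<subseteq> carrier M \<and>
        length us + 1 + length vs = n}
   \<union> {frag_of (us @ ract M x c # y # vs) - frag_of (us @ x # lact M c y # vs) | us x c y vs.
        set us \<subseteq> carrier M \<and> x \<in> carrier M \<and> c \<in> carrier R \<and> y \<in> carrier M \<and> set vs \<subseteq> carrier M \<and>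
        length us + 2 + length vs = n}"

lemma tpow_rels_eq:
  "tpow_rels R M n = generate (add_monoid (free_ab (tensor_lists M n))) (tpow_gens n)"
  by (simp add: tpow_rels_def tpow_gens_def)

lemma tpow_gens_cases [consumes 1, case_names add bal]:
  assumes "g \<in> tpow_gens n"
  obtains us x y vs where
      "g = frag_of (us @ (x \<oplus>\<^bsub>M\<^esub> y) # vs) - frag_of (us @ x # vs) - frag_of (us @ y # vs)"
      "set us \<subseteq> carrier M" "x \<in> carrier M" "y \<in> carrier M" "set vs \<subseteq> carrier M"
      "length us + 1 + length vs = n"
  | us x d y vs where
      "g = frag_of (us @ ract M x d # y # vs) - frag_of (us @ x # lact M d y # vs)"
      "set us \<subseteq> carrier M" "x \<in> carrier M" "d \<in> carrier R" "y \<in> carrier M" "set vs \<subseteq> carrier M"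
      "length us + 2 + length vs = n"
  using assms unfolding tpow_gens_def Un_iff mem_Collect_eq
  by (elim disjE exE conjE) (rule that, assumption, assumption+)+

lemma tpow_gens_carrier: "tpow_gens n \<subseteq> carrier (free_ab (tensor_lists M n))"
  unfolding tpow_gens_def
  by (auto simp: tensor_lists_def lact_closed ract_closed intro!: free_ab_closed)

lemma additive_subgroup_tpow_rels: "additive_subgroup (tpow_rels R M n) (free_ab (tensor_lists M n))"
  unfolding tpow_rels_eq by (rule additive_subgroup_generate[OF tpow_gens_carrier])

lemma tpow_rels_add:
  assumes "set us \<subseteq> carrier M" "x \<in> carrier M" "y \<in> carrier M" "set vs \<subseteq> carrier M"
    "length us + 1 + length vs = n"
  shows "frag_of (us @ (x \<oplus>\<^bsub>M\<^esub> y) # vs) - frag_of (us @ x # vs) - frag_of (us @ y # vs) \<in> tpow_rels R M n"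
  unfolding tpow_rels_eq tpow_gens_def using assms by (intro generate.incl) blast

lemma tpow_rels_balanced:
  assumes "set us \<subseteq> carrier M" "x \<in> carrier M" "c \<in> carrier R" "y \<in> carrier M" "set vs \<subseteq> carrier M"
    "length us + 2 + length vs = n"
  shows "frag_of (us @ ract M x c # y # vs) - frag_of (us @ x # lact M c y # vs) \<in> tpow_rels R M n"
  unfolding tpow_rels_eq tpow_gens_def using assms by (intro generate.incl) blast

abbreviation lact_list :: "'r \<Rightarrow> 'm list \<Rightarrow> 'm list" where
  "lact_list c xs \<equiv> lact M c (hd xs) # tl xs"

abbreviation ract_list :: "'r \<Rightarrow> 'm list \<Rightarrow> 'm list" where
  "ract_list c xs \<equiv> butlast xs @ [ract M (last xs) c]"

abbreviation lact_free :: "'r \<Rightarrow> ('m list \<Rightarrow>\<^sub>0 int) \<Rightarrow> ('m list \<Rightarrow>\<^sub>0 int)" where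
  "lact_free c \<equiv> frag_extend (\<lambda>xs. frag_of (lact_list c xs))"

abbreviation ract_free :: "'r \<Rightarrow> ('m list \<Rightarrow>\<^sub>0 int) \<Rightarrow> ('m list \<Rightarrow>\<^sub>0 int)" where
  "ract_free c \<equiv> frag_extend (\<lambda>xs. frag_of (ract_list c xs))"

abbreviation tcls :: "nat \<Rightarrow> ('m list \<Rightarrow>\<^sub>0 int) \<Rightarrow> ('m list \<Rightarrow>\<^sub>0 int) set" where
  "tcls n f \<equiv> tpow_rels R M n +>\<^bsub>free_ab (tensor_lists M n)\<^esub> f"

lemma act_list_closed:
  assumes "xs \<in> tensor_lists M n" "c \<in> carrier R" "n \<ge> 1"
  shows "lact_list c xs \<in> tensor_lists M n" "ract_list c xs \<in> tensor_lists M n"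
proof -
  show "lact_list c xs \<in> tensor_lists M n"
    using assms by (cases xs) (auto simp: tensor_lists_def lact_closed)
  show "ract_list c xs \<in> tensor_lists M n"
    using assms by (cases xs rule: rev_cases) (auto simp: tensor_lists_def ract_closed)
qed

lemma act_free_closed:
  assumes "f \<in> carrier (free_ab (tensor_lists M n))" "c \<in> carrier R" "n \<ge> 1"
  shows "lact_free c f \<in> carrier (free_ab (tensor_lists M n))"
    and "ract_free c f \<in> carrier (free_ab (tensor_lists M n))"
proof -
  have "additive_subgroup (carrier (free_ab (tensor_lists M n))) (free_ab (tensor_lists M n))"
    using group.subgroup_self[OF abelian_group.a_group[OF abelian_group_free_ab]]
    by (intro additive_subgroupI) simp
  note * = free_ab_map_mem[OF assms(1) this]
  show "lact_free c f \<in> carrier (free_ab (tensor_lists M n))"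
    by (rule *) (use act_list_closed[OF _ assms(2,3)] in \<open>simp_all add: frag_extend_diff\<close>)
  show "ract_free c f \<in> carrier (free_ab (tensor_lists M n))"
    by (rule *) (use act_list_closed[OF _ assms(2,3)] in \<open>simp_all add: frag_extend_diff\<close>)
qed

text \<open>The left action touches the head of a list only. A relation located further right stays
  a relation with a changed prefix; one located at the head needs additivity of the action or, for a
  balancing relation, the commutation law \<open>lact_ract\<close>.\<close>

lemma lact_free_rels:
  assumes r: "r \<in> tpow_rels R M n" and c: "c \<in> carrier R"
  shows "lact_free c r \<in> tpow_rels R M n"
  using r unfolding tpow_rels_eq
proof (rule generate_map_mem[OF _ tpow_gens_carrier])
  show "additive_subgroup (generate (add_monoid (free_ab (tensor_lists M n))) (tpow_gens n))
      (free_ab (tensor_lists M n))"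
    using additive_subgroup_tpow_rels unfolding tpow_rels_eq .
  fix g assume g: "g \<in> tpow_gens n"
  from g have "lact_free c g \<in> tpow_rels R M n"
  proof (cases rule: tpow_gens_cases)
    case (add us x y vs)
    show ?thesis
    proof (cases us)
      case Nil
      then show ?thesis
        using add c tpow_rels_add[of "[]" "lact M c x" "lact M c y" vs n]
        by (simp add: frag_extend_diff lact_add lact_closed)
    next
      case (Cons u us')
      then show ?thesis
        using add c tpow_rels_add[of "lact M c u # us'" x y vs n]
        by (simp add: frag_extend_diff lact_closed)
    qed
  next
    case (bal us x d y vs)
    show ?thesis
    proof (cases us)
      case Nil
      then show ?thesis
        using bal c tpow_rels_balanced[of "[]" "lact M c x" d y vs n]
        by (simp add: frag_extend_diff lact_ract lact_closed)
    next
      case (Cons u us')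
      then show ?thesis
        using bal c tpow_rels_balanced[of "lact M c u # us'" x d y vs n]
        by (simp add: frag_extend_diff lact_closed)
    qed
  qed
  then show "lact_free c g \<in> generate (add_monoid (free_ab (tensor_lists M n))) (tpow_gens n)"
    unfolding tpow_rels_eq .
qed (simp add: frag_extend_diff)

text \<open>The mirror image at the last position. The commutation law is now needed for a balancing
  relation between the last two factors.\<close>

lemma ract_free_rels:
  assumes r: "r \<in> tpow_rels R M n" and c: "c \<in> carrier R"
  shows "ract_free c r \<in> tpow_rels R M n"
  using r unfolding tpow_rels_eq
proof (rule generate_map_mem[OF _ tpow_gens_carrier])
  show "additive_subgroup (generate (add_monoid (free_ab (tensor_lists M n))) (tpow_gens n))
      (free_ab (tensor_lists M n))"
    using additive_subgroup_tpow_rels unfolding tpow_rels_eq .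
  fix g assume g: "g \<in> tpow_gens n"
  from g have "ract_free c g \<in> tpow_rels R M n"
  proof (cases rule: tpow_gens_cases)
    case (add us x y vs)
    show ?thesis
    proof (cases vs rule: rev_cases)
      case Nil
      then show ?thesis
        using add c tpow_rels_add[of us "ract M x c" "ract M y c" "[]" n]
        by (simp add: frag_extend_diff ract_add ract_closed)
    next
      case (snoc vs' v)
      then show ?thesis
        using add c tpow_rels_add[of us x y "vs' @ [ract M v c]" n]
        by (simp add: frag_extend_diff ract_closed butlast_append)
    qed
  next
    case (bal us x d y vs)
    show ?thesis
    proof (cases vs rule: rev_cases)
      case Nil
      then show ?thesis
        using bal c tpow_rels_balanced[of us x d "ract M y c" "[]" n]
        by (simp add: frag_extend_diff lact_ract ract_closed butlast_append)
    next
      case (snoc vs' v)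
      then show ?thesis
        using bal c tpow_rels_balanced[of us x d y "vs' @ [ract M v c]" n]
        by (simp add: frag_extend_diff ract_closed butlast_append)
    qed
  qed
  then show "ract_free c g \<in> generate (add_monoid (free_ab (tensor_lists M n))) (tpow_gens n)"
    unfolding tpow_rels_eq .
qed (simp add: frag_extend_diff)

lemma abelian_subgroup_tpow_rels: "abelian_subgroup (tpow_rels R M n) (free_ab (tensor_lists M n))"
  by (intro abelian_group.abelian_subgroupI_additive abelian_group_free_ab additive_subgroup_tpow_rels)

lemma tcls_eq_iff:
  assumes "f \<in> carrier (free_ab (tensor_lists M n))" "g \<in> carrier (free_ab (tensor_lists M n))"
  shows "tcls n f = tcls n g \<longleftrightarrow> f - g \<in> tpow_rels R M n"
  using abelian_subgroup.rcos_eq_iff[OF abelian_subgroup_tpow_rels assms] assms by simp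

lemma carrier_tensor_power:
  "carrier (tensor_power R M n) = tcls n ` carrier (free_ab (tensor_lists M n))"
  using abelian_subgroup.Quot_carrier[OF abelian_subgroup_tpow_rels]
  by (simp add: tensor_power_def ring.defs)

lemma add_tensor_power:
  assumes "f \<in> carrier (free_ab (tensor_lists M n))" "g \<in> carrier (free_ab (tensor_lists M n))"
  shows "tcls n f \<oplus>\<^bsub>tensor_power R M n\<^esub> tcls n g = tcls n (f + g)"
  using abelian_subgroup.Quot_add[OF abelian_subgroup_tpow_rels assms]
  by (simp add: tensor_power_def ring.defs)

lemma abelian_group_tensor_power: "abelian_group (tensor_power R M n)"
  using abelian_subgroup.abelian_group_Quot[OF abelian_subgroup_tpow_rels]
  by (rule abelian_group.abelian_group_image[where f = id])
     (simp_all add: tensor_power_def ring.defs)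

text \<open>The actions are unions over all representatives of a coset. Representatives differ by a
  relation and relations are preserved, so the united cosets all coincide.\<close>

lemma act_tensor_power:
  assumes f: "f \<in> carrier (free_ab (tensor_lists M n))" and c: "c \<in> carrier R" and n: "n \<ge> 1"
  shows "lact (tensor_power R M n) c (tcls n f) = tcls n (lact_free c f)"
    and "ract (tensor_power R M n) (tcls n f) c = tcls n (ract_free c f)"
proof -
  interpret S: abelian_subgroup "tpow_rels R M n" "free_ab (tensor_lists M n)"
    by (rule abelian_subgroup_tpow_rels)
  have self: "f \<in> tcls n f"
    using f by (rule S.a_rcos_self)
  have mem: "g \<in> carrier (free_ab (tensor_lists M n))" "g - f \<in> tpow_rels R M n" if "g \<in> tcls n f" for g
    using S.a_elemrcos_carrier[OF f that] S.a_rcos_module_imp[OF f that] f by auto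
  have eq: "tcls n (lact_free c g) = tcls n (lact_free c f)" "tcls n (ract_free c g) = tcls n (ract_free c f)"
    if "g \<in> tcls n f" for g
    using lact_free_rels[OF mem(2)[OF that] c] ract_free_rels[OF mem(2)[OF that] c] mem(1)[OF that] f c n
    by (simp_all add: tcls_eq_iff act_free_closed frag_extend_diff)
  have UN: "(\<Union>g\<in>tcls n f. F g) = Y" if "\<And>g. g \<in> tcls n f \<Longrightarrow> F g = Y" for F :: "('m list \<Rightarrow>\<^sub>0 int) \<Rightarrow> ('m list \<Rightarrow>\<^sub>0 int) set" and Y
    using self that by auto
  have act: "lact (tensor_power R M n) c X = (\<Union>g\<in>X. tcls n (lact_free c g))"
    "ract (tensor_power R M n) X c = (\<Union>g\<in>X. tcls n (ract_free c g))" for X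
    by (simp_all add: tensor_power_def ring.defs)
  show "lact (tensor_power R M n) c (tcls n f) = tcls n (lact_free c f)"
    unfolding act by (intro UN eq)
  show "ract (tensor_power R M n) (tcls n f) c = tcls n (ract_free c f)"
    unfolding act by (intro UN eq)
qed

end

section \<open>Bimodule laws and the universal property of tensor powers\<close>

context bimodule
begin

text \<open>Each bimodule law equates two additive maps, so it can be tested on single lists, and
  there modulo the relations.\<close>

lemma tcls_eq_extend:
  assumes f: "f \<in> carrier (free_ab (tensor_lists M n))"
    and D: "\<And>f g. D (f - g) = D f - D g" and E: "\<And>f g. E (f - g) = E f - E g"
    and clo: "D f \<in> carrier (free_ab (tensor_lists M n))" "E f \<in> carrier (free_ab (tensor_lists M n))"
    and eq: "\<And>xs. xs \<in> tensor_lists M n \<Longrightarrow> D (frag_of xs) - E (frag_of xs) \<in> tpow_rels R M n"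
  shows "tcls n (D f) = tcls n (E f)"
proof -
  have "D f - E f \<in> tpow_rels R M n"
    by (rule free_ab_map_mem[OF f additive_subgroup_tpow_rels, where D = "\<lambda>f. D f - E f"])
       (simp_all add: D E eq)
  then show ?thesis
    using clo by (simp add: tcls_eq_iff)
qed

lemma tensor_list_Cons:
  assumes "xs \<in> tensor_lists M n" "n \<ge> 1"
  obtains x vs where "xs = x # vs" "x \<in> carrier M" "set vs \<subseteq> carrier M" "Suc (length vs) = n"
  using assms by (cases xs) (auto simp: tensor_lists_def)

lemma tensor_list_snoc:
  assumes "xs \<in> tensor_lists M n" "n \<ge> 1"
  obtains us x where "xs = us @ [x]" "x \<in> carrier M" "set us \<subseteq> carrier M" "Suc (length us) = n"
  using assms by (cases xs rule: rev_cases) (auto simp: tensor_lists_def)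

text \<open>The two actions meet in the same factor only for a list of length one, where
  \<open>lact_ract\<close> applies; otherwise they change different entries.\<close>

lemma ract_lact_list:
  assumes "xs \<in> tensor_lists M n" "n \<ge> 1" "c \<in> carrier R" "d \<in> carrier R"
  shows "ract_list d (lact_list c xs) = lact_list c (ract_list d xs)"
proof -
  obtain x vs where xs: "xs = x # vs" "x \<in> carrier M" "set vs \<subseteq> carrier M"
    using tensor_list_Cons[OF assms(1,2)] by metis
  then show ?thesis
    using assms by (cases vs rule: rev_cases) (auto simp: lact_ract)
qed

lemma bimodule_tensor_power:
  assumes n: "n \<ge> 1"
  shows "bimodule R (tensor_power R M n)"
proof -
  let ?F = "free_ab (tensor_lists M n)"
  let ?T = "tensor_power R M n"
  interpret T: abelian_group ?T
    by (rule abelian_group_tensor_power)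
  note clo = act_free_closed[OF _ _ n] free_ab_closed
  note [simp] = act_tensor_power[OF _ _ n] add_tensor_power clo
  note [simp] = frag_extend_add frag_extend_diff
  have zero: "0 \<in> tpow_rels R M n"
    using free_ab_subgroup_closed(1)[OF additive_subgroup_tpow_rels] .
  \<comment> \<open>Additivity in the scalar fails for formal combinations of lists; it is the
    additivity relation at the first position.\<close>
  have add_l: "tcls n (lact_free (c \<oplus>\<^bsub>R\<^esub> d) f) = tcls n (lact_free c f + lact_free d f)"
    if "c \<in> carrier R" "d \<in> carrier R" "f \<in> carrier ?F" for c d f
  proof (rule tcls_eq_extend[where D = "lact_free (c \<oplus>\<^bsub>R\<^esub> d)" and E = "\<lambda>f. lact_free c f + lact_free d f"])
    fix xs assume "xs \<in> tensor_lists M n"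
    then obtain x vs where "xs = x # vs" "x \<in> carrier M" "set vs \<subseteq> carrier M" "Suc (length vs) = n"
      using tensor_list_Cons n by metis
    then show "lact_free (c \<oplus>\<^bsub>R\<^esub> d) (frag_of xs) - (lact_free c (frag_of xs) + lact_free d (frag_of xs)) \<in> tpow_rels R M n"
      using that tpow_rels_add[of "[]" "lact M c x" "lact M d x" vs n]
      by (simp add: lact_closed add_lact diff_diff_eq)
  qed (use that in simp_all)
  have add_r: "tcls n (ract_free (c \<oplus>\<^bsub>R\<^esub> d) f) = tcls n (ract_free c f + ract_free d f)"
    if "c \<in> carrier R" "d \<in> carrier R" "f \<in> carrier ?F" for c d f
  proof (rule tcls_eq_extend[where D = "ract_free (c \<oplus>\<^bsub>R\<^esub> d)" and E = "\<lambda>f. ract_free c f + ract_free d f"])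
    fix xs assume "xs \<in> tensor_lists M n"
    then obtain us x where "xs = us @ [x]" "x \<in> carrier M" "set us \<subseteq> carrier M" "Suc (length us) = n"
      using tensor_list_snoc n by metis
    then show "ract_free (c \<oplus>\<^bsub>R\<^esub> d) (frag_of xs) - (ract_free c (frag_of xs) + ract_free d (frag_of xs)) \<in> tpow_rels R M n"
      using that tpow_rels_add[of us "ract M x c" "ract M x d" "[]" n]
      by (simp add: ract_closed add_ract diff_diff_eq)
  qed (use that in simp_all)
  \<comment> \<open>From here on, apart from additivity, the laws hold for the lists themselves, so
    the difference to be found among the relations is \<open>0\<close>.\<close>
  have mult_l: "tcls n (lact_free (c \<otimes>\<^bsub>R\<^esub> d) f) = tcls n (lact_free c (lact_free d f))"
    if "c \<in> carrier R" "d \<in> carrier R" "f \<in> carrier ?F" for c d f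
  proof (rule tcls_eq_extend[where D = "lact_free (c \<otimes>\<^bsub>R\<^esub> d)" and E = "\<lambda>f. lact_free c (lact_free d f)"])
    fix xs assume "xs \<in> tensor_lists M n"
    then obtain x vs where "xs = x # vs" "x \<in> carrier M"
      using tensor_list_Cons n by metis
    then show "lact_free (c \<otimes>\<^bsub>R\<^esub> d) (frag_of xs) - lact_free c (lact_free d (frag_of xs)) \<in> tpow_rels R M n"
      using that zero by (simp add: mult_lact)
  qed (use that in simp_all)
  have mult_r: "tcls n (ract_free (c \<otimes>\<^bsub>R\<^esub> d) f) = tcls n (ract_free d (ract_free c f))"
    if "c \<in> carrier R" "d \<in> carrier R" "f \<in> carrier ?F" for c d f
  proof (rule tcls_eq_extend[where D = "ract_free (c \<otimes>\<^bsub>R\<^esub> d)" and E = "\<lambda>f. ract_free d (ract_free c f)"])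
    fix xs assume "xs \<in> tensor_lists M n"
    then obtain us x where "xs = us @ [x]" "x \<in> carrier M"
      using tensor_list_snoc n by metis
    then show "ract_free (c \<otimes>\<^bsub>R\<^esub> d) (frag_of xs) - ract_free d (ract_free c (frag_of xs)) \<in> tpow_rels R M n"
      using that zero by (simp add: mult_ract)
  qed (use that in simp_all)
  have one_l: "tcls n (lact_free \<one>\<^bsub>R\<^esub> f) = tcls n f" if "f \<in> carrier ?F" for f
  proof (rule tcls_eq_extend[where D = "lact_free \<one>\<^bsub>R\<^esub>" and E = "\<lambda>f. f"])
    fix xs assume "xs \<in> tensor_lists M n"
    then obtain x vs where "xs = x # vs" "x \<in> carrier M"
      using tensor_list_Cons n by metis
    then show "lact_free \<one>\<^bsub>R\<^esub> (frag_of xs) - frag_of xs \<in> tpow_rels R M n"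
      using zero by (simp add: one_lact)
  qed (use that in simp_all)
  have one_r: "tcls n (ract_free \<one>\<^bsub>R\<^esub> f) = tcls n f" if "f \<in> carrier ?F" for f
  proof (rule tcls_eq_extend[where D = "ract_free \<one>\<^bsub>R\<^esub>" and E = "\<lambda>f. f"])
    fix xs assume "xs \<in> tensor_lists M n"
    then obtain us x where "xs = us @ [x]" "x \<in> carrier M"
      using tensor_list_snoc n by metis
    then show "ract_free \<one>\<^bsub>R\<^esub> (frag_of xs) - frag_of xs \<in> tpow_rels R M n"
      using zero by (simp add: one_ract)
  qed (use that in simp_all)
  have l_r: "tcls n (ract_free d (lact_free c f)) = tcls n (lact_free c (ract_free d f))"
    if "c \<in> carrier R" "d \<in> carrier R" "f \<in> carrier ?F" for c d f
  proof (rule tcls_eq_extend[where D = "\<lambda>f. ract_free d (lact_free c f)" and E = "\<lambda>f. lact_free c (ract_free d f)"])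
    fix xs assume "xs \<in> tensor_lists M n"
    then show "ract_free d (lact_free c (frag_of xs)) - lact_free c (ract_free d (frag_of xs)) \<in> tpow_rels R M n"
      using ract_lact_list[OF _ n that(1,2), of xs] zero by simp
  qed (use that in simp_all)
  note [simp] = add_l add_r mult_l mult_r one_l one_r l_r
  show ?thesis
    by (intro bimodule.intro R.ring_axioms T.abelian_group_axioms bimodule_axioms.intro)
       (auto simp: carrier_tensor_power)
qed

text \<open>The universal property of the tensor power: \<Phi> is extended additively by
  \<open>frag_sum\<close>, the hypotheses \<open>add\<close> and \<open>bal\<close> kill the two
  kinds of relations, and the result descends to cosets. Equivariance is required on lists only and
  spreads by additivity.\<close>

lemma tensor_power_lift:
  assumes n: "n \<ge> 1" and N: "bimodule R N"
    and clo: "\<And>xs. xs \<in> tensor_lists M n \<Longrightarrow> \<Phi> xs \<in> carrier N"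
    and add: "\<And>us x y vs. \<lbrakk>set us \<subseteq> carrier M; x \<in> carrier M; y \<in> carrier M; set vs \<subseteq> carrier M;
        length us + 1 + length vs = n\<rbrakk> \<Longrightarrow> \<Phi> (us @ (x \<oplus>\<^bsub>M\<^esub> y) # vs) = \<Phi> (us @ x # vs) \<oplus>\<^bsub>N\<^esub> \<Phi> (us @ y # vs)"
    and bal: "\<And>us x c y vs. \<lbrakk>set us \<subseteq> carrier M; x \<in> carrier M; c \<in> carrier R; y \<in> carrier M;
        set vs \<subseteq> carrier M; length us + 2 + length vs = n\<rbrakk>
        \<Longrightarrow> \<Phi> (us @ ract M x c # y # vs) = \<Phi> (us @ x # lact M c y # vs)"
    and lact: "\<And>c xs. \<lbrakk>c \<in> carrier R; xs \<in> tensor_lists M n\<rbrakk> \<Longrightarrow> \<Phi> (lact_list c xs) = lact N c (\<Phi> xs)"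
    and ract: "\<And>c xs. \<lbrakk>c \<in> carrier R; xs \<in> tensor_lists M n\<rbrakk> \<Longrightarrow> \<Phi> (ract_list c xs) = ract N (\<Phi> xs) c"
  obtains \<phi> where "\<phi> \<in> bimodule_hom R (tensor_power R M n) N"
    and "\<And>xs. xs \<in> tensor_lists M n \<Longrightarrow> \<phi> (tpow_pure R M xs) = \<Phi> xs"
proof -
  interpret N: bimodule R N by (rule N)
  let ?F = "free_ab (tensor_lists M n)"
  define \<psi> where "\<psi> = frag_sum N \<Phi>"
  define \<phi> where "\<phi> = (\<lambda>X. the_elem (\<psi> ` X))"
  have psi_closed: "\<psi> f \<in> carrier N" if "f \<in> carrier ?F" for f
    unfolding \<psi>_def by (rule N.M.frag_sum_closed[OF clo that])
  have psi_add: "\<psi> (f + g) = \<psi> f \<oplus>\<^bsub>N\<^esub> \<psi> g" if "f \<in> carrier ?F" "g \<in> carrier ?F" for f g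
    unfolding \<psi>_def by (rule N.M.frag_sum_add[OF clo that])
  have psi_diff: "\<psi> (f - g) = \<psi> f \<ominus>\<^bsub>N\<^esub> \<psi> g" if "f \<in> carrier ?F" "g \<in> carrier ?F" for f g
    unfolding \<psi>_def by (rule N.M.frag_sum_diff[OF clo that])
  have psi_of: "\<psi> (frag_of xs) = \<Phi> xs" if "xs \<in> tensor_lists M n" for xs
    unfolding \<psi>_def by (rule N.M.frag_sum_of) (rule clo[OF that])
  have psi_zero: "\<psi> 0 = \<zero>\<^bsub>N\<^esub>"
    unfolding \<psi>_def by (rule N.M.frag_sum_zero)
  have rels: "\<psi> r = \<zero>\<^bsub>N\<^esub>" if "r \<in> tpow_rels R M n" for r
    using that unfolding tpow_rels_eq \<psi>_def
  proof (rule N.M.frag_sum_generate[OF clo tpow_gens_carrier, rotated 2], fold \<psi>_def)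
    fix g assume "g \<in> tpow_gens n"
    then show "\<psi> g = \<zero>\<^bsub>N\<^esub>"
    proof (cases rule: tpow_gens_cases)
      case (add us x y vs)
      then have mem: "us @ (x \<oplus>\<^bsub>M\<^esub> y) # vs \<in> tensor_lists M n" "us @ x # vs \<in> tensor_lists M n"
          "us @ y # vs \<in> tensor_lists M n"
        by (auto simp: tensor_lists_def)
      show ?thesis
        unfolding add(1) using mem assms(4)[OF add(2-6)] clo[OF mem(2)] clo[OF mem(3)]
        by (simp add: psi_diff psi_of free_ab_closed N.M.add_minus_minus)
    next
      case (bal us x c y vs)
      then have mem: "us @ ract M x c # y # vs \<in> tensor_lists M n" "us @ x # lact M c y # vs \<in> tensor_lists M n"
        by (auto simp: tensor_lists_def lact_closed ract_closed)
      show ?thesis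
        unfolding bal(1) using mem assms(5)[OF bal(2-7)] clo[OF mem(2)]
        by (simp add: psi_diff psi_of N.M.minus_eq N.M.r_neg)
    qed
  qed
  interpret S: abelian_subgroup "tpow_rels R M n" ?F
    by (rule abelian_subgroup_tpow_rels)
  have phi: "\<phi> (tcls n f) = \<psi> f" if f: "f \<in> carrier ?F" for f
    unfolding \<phi>_def using f
  proof (rule S.the_elem_image_rcos)
    fix g assume g: "g \<in> carrier ?F" "g \<ominus>\<^bsub>?F\<^esub> f \<in> tpow_rels R M n"
    then have "\<psi> g = \<psi> (g - f) \<oplus>\<^bsub>N\<^esub> \<psi> f"
      using f psi_add[of "g - f" f] by (simp add: free_ab_closed)
    then show "\<psi> g = \<psi> f"
      using g f psi_closed[OF f] by (simp add: rels)
  qed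
  have equivariant: "\<psi> (lact_free c f) = lact N c (\<psi> f) \<and> \<psi> (ract_free c f) = ract N (\<psi> f) c"
    if f: "f \<in> carrier ?F" and c: "c \<in> carrier R" for f c
    using f
  proof (induction f rule: free_ab_induct)
    case zero
    have "lact N c \<zero>\<^bsub>N\<^esub> = \<zero>\<^bsub>N\<^esub>" "ract N \<zero>\<^bsub>N\<^esub> c = \<zero>\<^bsub>N\<^esub>"
      using N.lact_add[of c "\<zero>\<^bsub>N\<^esub>" "\<zero>\<^bsub>N\<^esub>"] N.ract_add[of c "\<zero>\<^bsub>N\<^esub>" "\<zero>\<^bsub>N\<^esub>"] c
        N.lact_closed[of c "\<zero>\<^bsub>N\<^esub>"] N.ract_closed[of c "\<zero>\<^bsub>N\<^esub>"] N.M.add.r_cancel_one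
      by force+
    then show ?case
      by (simp add: psi_zero)
  next
    case (of xs)
    then show ?case
      using lact[OF c of] ract[OF c of] act_list_closed[OF of c n] by (simp add: psi_of)
  next
    case (diff f g)
    \<comment> \<open>The induction produces differences, while the bimodule axioms speak of sums.
      So the claim for f - g is obtained from f = (f - g) + g by cancelling the contribution of
      g.\<close>
    have *: "\<psi> (lact_free c f) = \<psi> (lact_free c (f - g)) \<oplus>\<^bsub>N\<^esub> \<psi> (lact_free c g)"
      "\<psi> (ract_free c f) = \<psi> (ract_free c (f - g)) \<oplus>\<^bsub>N\<^esub> \<psi> (ract_free c g)"
      "\<psi> f = \<psi> (f - g) \<oplus>\<^bsub>N\<^esub> \<psi> g"
      using diff(1,2) c n by (simp_all add: act_free_closed free_ab_closed flip: psi_add frag_extend_add)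
    have "lact N c (\<psi> (f - g)) \<oplus>\<^bsub>N\<^esub> lact N c (\<psi> g) = \<psi> (lact_free c (f - g)) \<oplus>\<^bsub>N\<^esub> \<psi> (lact_free c g)"
      "ract N (\<psi> (f - g)) c \<oplus>\<^bsub>N\<^esub> ract N (\<psi> g) c = \<psi> (ract_free c (f - g)) \<oplus>\<^bsub>N\<^esub> \<psi> (ract_free c g)"
      using diff c *(1)[symmetric] *(2)[symmetric] *(3)
      by (simp_all add: psi_closed free_ab_closed flip: N.lact_add N.ract_add)
    moreover have "lact N c (\<psi> g) = \<psi> (lact_free c g)" "ract N (\<psi> g) c = \<psi> (ract_free c g)"
      using diff by auto
    moreover have "\<psi> (lact_free c g) \<in> carrier N" "\<psi> (ract_free c g) \<in> carrier N"
      "\<psi> (lact_free c (f - g)) \<in> carrier N" "\<psi> (ract_free c (f - g)) \<in> carrier N"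
      "lact N c (\<psi> (f - g)) \<in> carrier N" "ract N (\<psi> (f - g)) c \<in> carrier N"
      using diff c n by (simp_all add: psi_closed act_free_closed free_ab_closed N.lact_closed N.ract_closed)
    ultimately show ?case
      using N.M.add.right_cancel by simp
  qed
  show thesis
  proof
    show "\<phi> \<in> bimodule_hom R (tensor_power R M n) N"
      unfolding bimodule_hom_def
    proof (intro CollectI conjI ballI)
      show "\<phi> \<in> hom (add_monoid (tensor_power R M n)) (add_monoid N)"
        by (intro homI) (auto simp: carrier_tensor_power phi psi_closed add_tensor_power free_ab_closed psi_add)
    qed (use n in \<open>auto simp: carrier_tensor_power phi act_tensor_power act_free_closed equivariant\<close>)
    show "\<phi> (tpow_pure R M xs) = \<Phi> xs" if "xs \<in> tensor_lists M n" for xs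
    proof -
      have "length xs = n"
        using that by (simp add: tensor_lists_def)
      then have "tpow_pure R M xs = tcls n (frag_of xs)"
        by (simp add: tpow_pure_def)
      then show ?thesis
        using that by (simp add: phi psi_of)
    qed
  qed
qed

end

section \<open>The multiplication maps\<close>

context ring_surjection
begin

interpretation h: ring_hom_ring A R h
  by (intro ring_hom_ringI2 A.ring_axioms R.ring_axioms hom)

definition lprod :: "'a list \<Rightarrow> 'a" where "lprod xs = foldr (\<otimes>) xs \<one>"

lemma lprod_simps [simp]: "lprod [] = \<one>" "lprod (x # xs) = x \<otimes> lprod xs"
  by (simp_all add: lprod_def)

lemma lprod_closed: "set xs \<subseteq> carrier A \<Longrightarrow> lprod xs \<in> carrier A"
  by (induction xs) auto

lemma lprod_append:
  "\<lbrakk>set xs \<subseteq> carrier A; set ys \<subseteq> carrier A\<rbrakk> \<Longrightarrow> lprod (xs @ ys) = lprod xs \<otimes> lprod ys"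
  by (induction xs) (auto simp: lprod_closed A.m_assoc)

lemma K_carrier: "K \<subseteq> carrier A"
  using K_iff by blast

lemma lprod_P: "set xs \<subseteq> K \<Longrightarrow> lprod xs \<in> P (length xs)"
proof (induction xs)
  case (Cons x xs)
  then show ?case
    using P_mult[of x "Suc 0" "lprod xs" "length xs"] by (simp add: P_1)
qed (simp add: P_0)

text \<open>Iterates \<open>cls_mult_cong\<close> with one factor of degree one at a time: changing
  factors by elements of K ^ 2 changes a product of n factors by an element of K ^ (n + 1).\<close>

lemma cls_lprod_cong:
  "list_all2 (\<lambda>x y. x \<in> K \<and> y \<in> cls (Suc 0) x) xs ys
    \<Longrightarrow> cls (length xs) (lprod ys) = cls (length xs) (lprod xs)"
proof (induction rule: list_all2_induct)
  case (Cons x xs y ys)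
  have K: "set xs \<subseteq> K" "set ys \<subseteq> K"
    using Cons.hyps(2) mem_cls_P[of _ "Suc 0"]
    by (auto simp: list_all2_conv_all_nth in_set_conv_nth P_1 subset_iff)
  then have "lprod xs \<in> P (length xs)" "lprod ys \<in> carrier A"
    using lprod_P K_carrier lprod_closed by auto
  moreover from this have "lprod ys \<in> cls (length xs) (lprod xs)"
    using Cons.IH cls_self by blast
  ultimately show ?case
    using cls_mult_cong[of x "Suc 0" "lprod xs" "length xs" y "lprod ys"] Cons.hyps(1) by (simp add: P_1)
qed simp

text \<open>Representatives are picked by choice so that this is a total function on lists of
  classes, as \<open>tensor_power_lift\<close> requires; \<open>cls_lprod_cong\<close> makes the
  choice immaterial.\<close>

definition mprod :: "'a set list \<Rightarrow> 'a set" where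
  "mprod Xs = cls (length Xs) (lprod (map (\<lambda>X. SOME x. x \<in> X) Xs))"

lemma mprod_cls:
  assumes "set xs \<subseteq> K"
  shows "mprod (map (cls (Suc 0)) xs) = cls (length xs) (lprod xs)"
proof -
  have "(SOME y. y \<in> cls (Suc 0) x) \<in> cls (Suc 0) x" if "x \<in> carrier A" for x
    using cls_self[OF that] by (rule someI)
  then show ?thesis
    using assms K_carrier unfolding mprod_def length_map map_map
    by (intro cls_lprod_cong) (auto simp: list_all2_conv_all_nth subset_iff)
qed

lemma cls_listE:
  assumes "set Xs \<subseteq> carrier (C (Suc 0))"
  obtains xs where "Xs = map (cls (Suc 0)) xs" "set xs \<subseteq> K"
proof -
  have "Xs \<in> lists (cls (Suc 0) ` K)"
    using assms by (simp add: lists_eq_set carrier_C_1)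
  then obtain xs where "Xs = map (cls (Suc 0)) xs" "xs \<in> lists K"
    unfolding lists_image by blast
  then show ?thesis
    using that by (simp add: lists_eq_set)
qed

text \<open>The exponent starts at one because \<open>P 0\<close> is all of \<open>A\<close>, which
  the empty product need not span additively.\<close>

lemma P_subset_generate:
  "P (Suc n) \<subseteq> generate (add_monoid A) {lprod xs | xs. set xs \<subseteq> K \<and> length xs = Suc n}"
proof (induction n)
  case 0
  show ?case
  proof
    fix x assume "x \<in> P (Suc 0)"
    then have "x = lprod [x]" "set [x] \<subseteq> K"
      using K_iff by (auto simp: P_1)
    then have "x \<in> {lprod xs | xs. set xs \<subseteq> K \<and> length xs = Suc 0}"
      by (metis (mono_tags, lifting) length_Cons list.size(3) mem_Collect_eq)
    then show "x \<in> generate (add_monoid A) {lprod xs | xs. set xs \<subseteq> K \<and> length xs = Suc 0}"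
      by (rule generate.incl)
  qed
next
  case (Suc n)
  let ?B = "\<lambda>n. {lprod xs | xs. set xs \<subseteq> K \<and> length xs = Suc n}"
  have sub: "?B n \<subseteq> carrier A" for n
    using K_carrier by (auto intro!: lprod_closed)
  have gen: "generate (add_monoid A) (?B n) \<subseteq> carrier A" for n
    using A.add.generate_incl[OF sub] by simp
  \<comment> \<open>An element of the next power is a sum of products whose left factor is itself
    only a combination of products. Right multiplication by \<open>k\<close> is additive, so it
    suffices that it appends \<open>k\<close> to each spanning product.\<close>
  have mult: "i \<otimes> k \<in> generate (add_monoid A) (?B (Suc n))"
    if "i \<in> generate (add_monoid A) (?B n)" "k \<in> K" for i k
    using that(1)
  proof (induction i rule: generate.induct)
    case one
    then show ?case
      using that(2) K_carrier generate.one[of "add_monoid A"] by auto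
  next
    case (incl i)
    then obtain xs where "i = lprod xs" "set xs \<subseteq> K" "length xs = Suc n"
      by blast
    then have "i \<otimes> k = lprod (xs @ [k])" "set (xs @ [k]) \<subseteq> K" "length (xs @ [k]) = Suc (Suc n)"
      using that(2) K_carrier by (auto simp: lprod_append subset_iff)
    then have "i \<otimes> k \<in> ?B (Suc n)"
      by blast
    then show ?case
      by (rule generate.incl)
  next
    case (inv i)
    then obtain xs where "i = lprod xs" "set xs \<subseteq> K" "length xs = Suc n"
      by blast
    then have "i \<otimes> k = lprod (xs @ [k])" "set (xs @ [k]) \<subseteq> K" "length (xs @ [k]) = Suc (Suc n)"
      using that(2) K_carrier by (auto simp: lprod_append subset_iff)
    then have "i \<otimes> k \<in> ?B (Suc n)"
      by blast
    then have "inv\<^bsub>add_monoid A\<^esub> (i \<otimes> k) \<in> generate (add_monoid A) (?B (Suc n))"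
      by (rule generate.inv)
    moreover have "i \<in> carrier A" "k \<in> carrier A"
      using inv sub that(2) K_carrier by blast+
    then have "inv\<^bsub>add_monoid A\<^esub> i \<otimes> k = inv\<^bsub>add_monoid A\<^esub> (i \<otimes> k)"
      using A.l_minus[of i k] by (simp add: a_inv_def)
    ultimately show ?case
      by simp
  next
    case (eng i j)
    then have "i \<in> carrier A" "j \<in> carrier A" "k \<in> carrier A"
      using gen that(2) K_carrier by blast+
    then have "(i \<oplus> j) \<otimes> k = i \<otimes> k \<oplus> j \<otimes> k"
      by (rule A.l_distr)
    then show ?case
      using generate.eng[OF eng.IH] by simp
  qed
  show ?case
  proof
    fix x assume "x \<in> P (Suc (Suc n))"
    then show "x \<in> generate (add_monoid A) (?B (Suc n))"
      unfolding P_Suc[of "Suc n"]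
    proof (induction x rule: ideal_prod.induct)
      case (prod i k)
      then show ?case
        using Suc.IH mult by blast
    next
      case (sum s t)
      then show ?case
        using generate.eng[OF sum.IH] by simp
    qed
  qed
qed

text \<open>Applied to the range of a homomorphism into \<open>C (Suc n)\<close>, this reduces
  surjectivity to hitting the classes of products of elements of \<open>K\<close>.\<close>

lemma cls_mem_subgroup:
  assumes S: "subgroup S (add_monoid (C (Suc n)))"
    and mem: "\<And>xs. \<lbrakk>set xs \<subseteq> K; length xs = Suc n\<rbrakk> \<Longrightarrow> cls (Suc n) (lprod xs) \<in> S"
    and x: "x \<in> P (Suc n)"
  shows "cls (Suc n) x \<in> S"
proof -
  let ?B = "{lprod xs | xs. set xs \<subseteq> K \<and> length xs = Suc n}"
  interpret M: abelian_group "C (Suc n)"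
    by (rule abelian_group_C)
  interpret S: additive_subgroup S "C (Suc n)"
    by (rule additive_subgroupI[OF S])
  have sub: "?B \<subseteq> carrier A"
    using K_carrier by (auto intro!: lprod_closed)
  have gen: "generate (add_monoid A) ?B \<subseteq> carrier A"
    using A.add.generate_incl[OF sub] by simp
  have "x \<in> generate (add_monoid A) ?B"
    using x P_subset_generate by blast
  then show ?thesis
  proof (induction x rule: generate.induct)
    case one
    then show ?case
      using S.zero_closed by (simp add: C_zero)
  next
    case (incl i)
    then show ?case
      using mem by blast
  next
    case (inv i)
    then obtain xs where "i = lprod xs" "set xs \<subseteq> K" "length xs = Suc n"
      by blast
    then have i: "i \<in> P (Suc n)" "i \<in> carrier A" "cls (Suc n) i \<in> S"
      using lprod_P[of xs] P_carrier[of i] mem by auto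
    then have "cls (Suc n) (\<ominus> i) \<oplus>\<^bsub>C (Suc n)\<^esub> cls (Suc n) i = \<zero>\<^bsub>C (Suc n)\<^esub>"
      by (simp add: C_add C_zero A.l_neg)
    then have "cls (Suc n) (\<ominus> i) = \<ominus>\<^bsub>C (Suc n)\<^esub> cls (Suc n) i"
      using i P_minus by (intro M.minus_equality[symmetric]) (auto simp: C_carrier)
    then show ?case
      using i S.a_inv_closed by (simp add: a_inv_def)
  next
    case (eng i j)
    then have "i \<in> carrier A" "j \<in> carrier A"
      using gen by blast+
    then show ?case
      using S.a_closed[OF eng.IH] by (simp add: C_add)
  qed
qed

theorem multiplication_map:
  assumes n: "n \<ge> 1"
  obtains \<phi> where "\<phi> \<in> bimodule_hom R (tensor_power R (C (Suc 0)) n) (C n)"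
    and "\<And>xs. \<lbrakk>set xs \<subseteq> K; length xs = n\<rbrakk>
      \<Longrightarrow> \<phi> (tpow_pure R (C (Suc 0)) (map (cls (Suc 0)) xs)) = cls n (lprod xs)"
    and "\<phi> ` carrier (tensor_power R (C (Suc 0)) n) = carrier (C n)"
proof -
  let ?M = "C (Suc 0)"
  interpret M: bimodule R ?M
    by (rule bimodule_C)
  interpret N: bimodule R "C n"
    by (rule bimodule_C)
  note [simp] = lact_C ract_C C_add lprod_closed lprod_append A.m_assoc
  note [simp del] = h.hom_add h.hom_mult h.hom_one
  have car: "set xs \<subseteq> carrier A" "set xs \<subseteq> P (Suc 0)" if "set xs \<subseteq> K" for xs
    using that K_carrier P_1 by auto
  have KE: thesis if "X \<in> carrier ?M" "\<And>x. \<lbrakk>X = cls (Suc 0) x; x \<in> K; x \<in> carrier A; x \<in> P (Suc 0)\<rbrakk> \<Longrightarrow> thesis" for X thesis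
    using that carrier_C_1 K_carrier P_1 by auto
  have RE: thesis if "c \<in> carrier R" "\<And>a. \<lbrakk>c = h a; a \<in> carrier A\<rbrakk> \<Longrightarrow> thesis" for c thesis
    using that surj by auto
  have KM: "x \<otimes> a \<in> K" "a \<otimes> x \<in> K" if "x \<in> K" "a \<in> carrier A" for a x
    using that ideal.I_r_closed[OF ideal_K] ideal.I_l_closed[OF ideal_K] by auto
  \<comment> \<open>Isolates one factor at an arbitrary position, the one in which additivity or an
    action is tested.\<close>
  have mp: "mprod (map (cls (Suc 0)) us @ cls (Suc 0) x # map (cls (Suc 0)) vs)
      = cls n (lprod us \<otimes> (x \<otimes> lprod vs))"
    if "set us \<subseteq> K" "x \<in> K" "set vs \<subseteq> K" "length us + 1 + length vs = n" for us x vs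
  proof -
    have "set (us @ x # vs) \<subseteq> K" "x \<in> carrier A"
      using that K_carrier by auto
    from mprod_cls[OF this(1)] this(2) show ?thesis
      using that(4) car(1)[OF that(1)] car(1)[OF that(3)] by simp
  qed
  have mp2: "mprod (map (cls (Suc 0)) us @ cls (Suc 0) x # cls (Suc 0) y # map (cls (Suc 0)) vs)
      = cls n (lprod us \<otimes> (x \<otimes> (y \<otimes> lprod vs)))"
    if "set us \<subseteq> K" "x \<in> K" "y \<in> K" "set vs \<subseteq> K" "length us + 2 + length vs = n" for us x y vs
    using mp[of us x "y # vs"] that by simp
  obtain \<phi> where \<phi>: "\<phi> \<in> bimodule_hom R (tensor_power R ?M n) (C n)"
    "\<And>Xs. Xs \<in> tensor_lists ?M n \<Longrightarrow> \<phi> (tpow_pure R ?M Xs) = mprod Xs"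
  proof (rule M.tensor_power_lift[OF n bimodule_C])
    show "mprod Xs \<in> carrier (C n)" if "Xs \<in> tensor_lists ?M n" for Xs
    proof -
      have "set Xs \<subseteq> carrier ?M" "length Xs = n"
        using that by (simp_all add: tensor_lists_def)
      from this(1) obtain xs where "Xs = map (cls (Suc 0)) xs" "set xs \<subseteq> K"
        by (rule cls_listE)
      then show ?thesis
        using lprod_P[of xs] \<open>length Xs = n\<close> by (simp add: mprod_cls C_carrier)
    qed
  next
    fix us x y vs
    assume "set us \<subseteq> carrier ?M" "x \<in> carrier ?M" "y \<in> carrier ?M" "set vs \<subseteq> carrier ?M"
      and len: "length us + 1 + length vs = n"
    then obtain us' x' y' vs' where eqs: "us = map (cls (Suc 0)) us'" "set us' \<subseteq> K"
      "x = cls (Suc 0) x'" "x' \<in> K" "x' \<in> carrier A" "y = cls (Suc 0) y'" "y' \<in> K" "y' \<in> carrier A"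
      "vs = map (cls (Suc 0)) vs'" "set vs' \<subseteq> K"
      by (elim cls_listE KE) blast
    moreover have "x' \<oplus> y' \<in> K"
      using eqs P_add[of _ "Suc 0"] by (simp add: P_1)
    ultimately show "mprod (us @ (x \<oplus>\<^bsub>?M\<^esub> y) # vs) = mprod (us @ x # vs) \<oplus>\<^bsub>C n\<^esub> mprod (us @ y # vs)"
      using len car[of us'] car[of vs'] by (simp add: mp A.l_distr A.r_distr)
  next
    fix us x c y vs
    assume "set us \<subseteq> carrier ?M" "x \<in> carrier ?M" "c \<in> carrier R" "y \<in> carrier ?M" "set vs \<subseteq> carrier ?M"
      and len: "length us + 2 + length vs = n"
    then obtain us' x' a y' vs' where eqs: "us = map (cls (Suc 0)) us'" "set us' \<subseteq> K"
      "x = cls (Suc 0) x'" "x' \<in> K" "x' \<in> carrier A" "x' \<in> P (Suc 0)" "c = h a" "a \<in> carrier A"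
      "y = cls (Suc 0) y'" "y' \<in> K" "y' \<in> carrier A" "y' \<in> P (Suc 0)"
      "vs = map (cls (Suc 0)) vs'" "set vs' \<subseteq> K"
      by (elim cls_listE KE RE) blast
    \<comment> \<open>Both sides are classes of a product containing x' a y', bracketed differently:
      balancedness is associativity in \<open>A\<close>.\<close>
    then show "mprod (us @ ract ?M x c # y # vs) = mprod (us @ x # lact ?M c y # vs)"
      using len car[of us'] car[of vs'] KM by (simp add: mp2)
  next
    fix c Xs assume "c \<in> carrier R" "Xs \<in> tensor_lists ?M n"
    moreover from this obtain X Vs where "Xs = X # Vs" "X \<in> carrier ?M" "set Vs \<subseteq> carrier ?M" "Suc (length Vs) = n"
      using M.tensor_list_Cons n by metis
    ultimately obtain a x vs where eqs: "c = h a" "a \<in> carrier A" "Xs = cls (Suc 0) x # map (cls (Suc 0)) vs"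
      "x \<in> K" "x \<in> carrier A" "x \<in> P (Suc 0)" "set vs \<subseteq> K" "Suc (length vs) = n"
      by (elim cls_listE KE RE) auto
    moreover have "x \<otimes> lprod vs \<in> P n"
      using lprod_P[of "x # vs"] eqs by simp
    ultimately show "mprod (lact ?M c (hd Xs) # tl Xs) = lact (C n) c (mprod Xs)"
      using mp[of "[]" _ vs] car[of vs] KM[of x a] by simp
  next
    fix c Xs assume "c \<in> carrier R" "Xs \<in> tensor_lists ?M n"
    moreover from this obtain X Us where "Xs = Us @ [X]" "X \<in> carrier ?M" "set Us \<subseteq> carrier ?M" "Suc (length Us) = n"
      using M.tensor_list_snoc n by metis
    ultimately obtain a x us where eqs: "c = h a" "a \<in> carrier A" "Xs = map (cls (Suc 0)) us @ [cls (Suc 0) x]"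
      "x \<in> K" "x \<in> carrier A" "x \<in> P (Suc 0)" "set us \<subseteq> K" "Suc (length us) = n"
      by (elim cls_listE KE RE) auto
    moreover have "lprod us \<otimes> x \<in> P n"
      using lprod_P[of "us @ [x]"] eqs car[of us] by simp
    ultimately show "mprod (butlast Xs @ [ract ?M (last Xs) c]) = ract (C n) (mprod Xs) c"
      using mp[of us _ "[]"] car[of us] KM[of x a] by simp
  qed (use that in blast)
  interpret T: bimodule R "tensor_power R ?M n"
    by (rule M.bimodule_tensor_power[OF n])
  have pure: "\<phi> (tpow_pure R ?M (map (cls (Suc 0)) xs)) = cls n (lprod xs)"
    "tpow_pure R ?M (map (cls (Suc 0)) xs) \<in> carrier (tensor_power R ?M n)"
    if "set xs \<subseteq> K" "length xs = n" for xs
  proof -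
    have mem: "map (cls (Suc 0)) xs \<in> tensor_lists ?M n"
      using that by (auto simp: tensor_lists_def carrier_C_1)
    then show "\<phi> (tpow_pure R ?M (map (cls (Suc 0)) xs)) = cls n (lprod xs)"
      using that \<phi>(2) by (simp add: mprod_cls)
    show "tpow_pure R ?M (map (cls (Suc 0)) xs) \<in> carrier (tensor_power R ?M n)"
      using mem that by (auto simp: M.carrier_tensor_power tpow_pure_def)
  qed
  have hom: "\<phi> \<in> hom (add_monoid (tensor_power R ?M n)) (add_monoid (C n))"
    using \<phi>(1) by (simp add: bimodule_hom_def)
  have "\<phi> ` carrier (tensor_power R ?M n) = carrier (C n)"
  proof
    show "\<phi> ` carrier (tensor_power R ?M n) \<subseteq> carrier (C n)"
      using hom by (auto simp: hom_def)
    \<comment> \<open>The range is a subgroup, and the values on pure tensors are exactly the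
      classes that span \<open>C n\<close>.\<close>
    have "group_hom (add_monoid (tensor_power R ?M n)) (add_monoid (C n)) \<phi>"
      using hom by (simp add: group_hom_def group_hom_axioms_def T.M.a_group N.M.a_group)
    then have "subgroup (\<phi> ` carrier (tensor_power R ?M n)) (add_monoid (C n))"
      using group_hom.img_is_subgroup T.M.add.subgroup_self by fastforce
    moreover obtain k where "n = Suc k"
      using n by (cases n) auto
    ultimately show "carrier (C n) \<subseteq> \<phi> ` carrier (tensor_power R ?M n)"
      using cls_mem_subgroup pure unfolding C_carrier by (metis (no_types, lifting) image_eqI image_subsetI)
  qed
  then show thesis
    using that \<phi>(1) pure(1) by blast
qed

end

section \<open>The associated graded ring\<close>

text \<open>Used with a component projection for \<open>D\<close>, to read one component off a sum
  of homogeneous elements. The index \<open>k\<close> may lie outside \<open>I\<close>, because the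
  sums in \<open>graded_ring\<close> range over nonzero terms only.\<close>

lemma hom_finsum_single:
  assumes "abelian_group G" "abelian_group H" and D: "D \<in> hom (add_monoid G) (add_monoid H)"
    and I: "finite I" "p \<in> I \<rightarrow> carrier G"
    and other: "\<And>i. \<lbrakk>i \<in> I; i \<noteq> k\<rbrakk> \<Longrightarrow> D (p i) = \<zero>\<^bsub>H\<^esub>"
    and k: "k \<notin> I \<Longrightarrow> D (p k) = \<zero>\<^bsub>H\<^esub>"
  shows "D (finsum G p I) = D (p k)"
proof -
  interpret G: abelian_group G by fact
  interpret H: abelian_group H by fact
  have zero: "D \<zero>\<^bsub>G\<^esub> = \<zero>\<^bsub>H\<^esub>"
    using hom_one[OF D G.a_group H.a_group] by simp
  have clo: "D x \<in> carrier H" if "x \<in> carrier G" for x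
    using D that by (auto simp: hom_def)
  have rest: "D (finsum G p J) = \<zero>\<^bsub>H\<^esub>" if "finite J" "J \<subseteq> I - {k}" for J
    using that
  proof (induction J rule: finite_induct)
    case (insert j J)
    then have "p j \<in> carrier G" "finsum G p J \<in> carrier G"
      using I by (auto intro!: G.finsum_closed)
    moreover have "finsum G p (insert j J) = p j \<oplus>\<^bsub>G\<^esub> finsum G p J"
      using insert I by (intro G.finsum_insert) auto
    ultimately show ?case
      using insert other hom_mult[OF D, of "p j" "finsum G p J"] by simp
  qed (simp add: zero)
  show ?thesis
  proof (cases "k \<in> I")
    case True
    have "finsum G p (insert k (I - {k})) = p k \<oplus>\<^bsub>G\<^esub> finsum G p (I - {k})"
      using I True by (intro G.finsum_insert) auto
    moreover have "p k \<in> carrier G" "finsum G p (I - {k}) \<in> carrier G"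
      using I True by (auto intro!: G.finsum_closed)
    ultimately show ?thesis
      using hom_mult[OF D, of "p k" "finsum G p (I - {k})"] rest[of "I - {k}"] I True clo
      by (simp add: insert_absorb)
  next
    case False
    then show ?thesis
      using rest[of I] I k by auto
  qed
qed

context ring_surjection
begin

interpretation h: ring_hom_ring A R h
  by (intro ring_hom_ringI2 A.ring_axioms R.ring_axioms hom)

interpretation M: abelian_group "C n" for n
  by (rule abelian_group_C)

interpretation U: UP_ring A "UP A"
  by unfold_locales simp

definition gr_zero :: "nat \<Rightarrow> 'a set" where "gr_zero = (\<lambda>n\<in>{1..}. \<zero>\<^bsub>C n\<^esub>)"

definition gr :: "('c \<times> (nat \<Rightarrow> 'a set)) ring" where
  "gr =
     \<lparr>carrier = carrier R \<times>
        {f \<in> (\<Pi>\<^sub>E n\<in>{1..}. carrier (C n)). finite {n \<in> {1..}. f n \<noteq> \<zero>\<^bsub>C n\<^esub>}},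
      monoid.mult = (\<lambda>(r, f) (s, g). (r \<otimes>\<^bsub>R\<^esub> s,
        \<lambda>n\<in>{1..}. lact (C n) r (g n) \<oplus>\<^bsub>C n\<^esub> ract (C n) (f n) s \<oplus>\<^bsub>C n\<^esub>
          (\<Oplus>\<^bsub>C n\<^esub>i\<in>{1..<n}. rcoset_mult A (P (Suc n)) (f i) (g (n - i))))),
      monoid.one = (\<one>\<^bsub>R\<^esub>, gr_zero),
      ring.zero = (\<zero>\<^bsub>R\<^esub>, gr_zero),
      ring.add = (\<lambda>(r, f) (s, g). (r \<oplus>\<^bsub>R\<^esub> s, \<lambda>n\<in>{1..}. f n \<oplus>\<^bsub>C n\<^esub> g n))\<rparr>"

definition gr_part :: "nat \<Rightarrow> ('c \<times> (nat \<Rightarrow> 'a set)) set" where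
  "gr_part n = {(r, f) \<in> carrier gr. (n \<noteq> 0 \<longrightarrow> r = \<zero>\<^bsub>R\<^esub>) \<and> (\<forall>k\<ge>1. k \<noteq> n \<longrightarrow> f k = \<zero>\<^bsub>C k\<^esub>)}"

abbreviation co :: "(nat \<Rightarrow> 'a) \<Rightarrow> nat \<Rightarrow> 'a" where "co \<equiv> coeff (UP A)"

definition rees :: "(nat \<Rightarrow> 'a) set" where
  "rees = {p \<in> carrier (UP A). \<forall>n. co p n \<in> P n}"

text \<open>The class of the constant coefficient modulo \<open>K\<close> is recorded through its
  value under \<open>h\<close>, matching the degree-zero component of the graded ring.\<close>

definition symb :: "(nat \<Rightarrow> 'a) \<Rightarrow> 'c \<times> (nat \<Rightarrow> 'a set)" where
  "symb p = (h (co p 0), \<lambda>n\<in>{1..}. cls n (co p n))"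

lemma rees_carrier: "rees \<subseteq> carrier (UP A)"
  by (auto simp: rees_def)

lemma P_finsum: "f \<in> I \<rightarrow> P n \<Longrightarrow> finsum A f I \<in> P n"
proof (induction I rule: infinite_finite_induct)
  case (insert i I)
  then have "f i \<in> carrier A" "f \<in> I \<rightarrow> carrier A"
    using P_carrier by auto
  then show ?case
    using insert by (simp add: A.finsum_insert P_add)
qed (auto simp: P_zero A.finsum_infinite)

lemma cls_finsum:
  "f \<in> I \<rightarrow> P n \<Longrightarrow> cls n (finsum A f I) = (\<Oplus>\<^bsub>C n\<^esub>i\<in>I. cls n (f i))"
proof (induction I rule: infinite_finite_induct)
  case (insert i I)
  then have "f i \<in> carrier A" "f \<in> I \<rightarrow> carrier A" "finsum A f I \<in> carrier A"
    using P_carrier by (auto intro!: A.finsum_closed)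
  moreover have "cls n (f i) \<in> carrier (C n)" "(\<lambda>i. cls n (f i)) \<in> I \<rightarrow> carrier (C n)"
    using insert by (auto simp: C_carrier)
  ultimately show ?case
    using insert by (simp add: A.finsum_insert M.finsum_insert C_add[symmetric])
qed (auto simp: C_zero M.finsum_infinite A.finsum_infinite)

text \<open>A coefficient of a product is a sum of terms from P i P (n - i), and
  \<open>P_mult\<close> puts these into P n.\<close>

lemma subring_rees: "subring rees (UP A)"
proof (rule U.P.subringI)
  show "p \<otimes>\<^bsub>UP A\<^esub> q \<in> rees" if "p \<in> rees" "q \<in> rees" for p q
  proof -
    have "co p i \<otimes> co q (n - i) \<in> P n" if "i \<le> n" for i n
      using P_mult[of "co p i" i "co q (n - i)" "n - i"] \<open>p \<in> rees\<close> \<open>q \<in> rees\<close> that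
      by (simp add: rees_def)
    then show ?thesis
      using that by (auto simp: rees_def intro!: P_finsum)
  qed
qed (auto simp: rees_def P_minus P_add P_zero P_0)

lemma symb_hom: "symb \<in> ring_hom (UP A \<lparr>carrier := rees\<rparr>) gr"
proof (rule ring_hom_memI; simp)
  fix p assume p: "p \<in> rees"
  then have pc: "p \<in> carrier (UP A)" "co p n \<in> P n" for n
    by (simp_all add: rees_def)
  obtain b where b: "bound \<zero> b (co p)"
    using pc(1) by (auto simp: UP_def up_def)
  have "{n. 1 \<le> n \<and> cls n (co p n) \<noteq> \<zero>\<^bsub>C n\<^esub>} \<subseteq> {..b}"
    using bound.bound[OF b] by (auto simp: C_zero not_le)
  then have "finite {n. 1 \<le> n \<and> cls n (co p n) \<noteq> \<zero>\<^bsub>C n\<^esub>}"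
    by (rule finite_subset) simp
  then show "symb p \<in> carrier gr"
    using pc P_carrier by (auto simp: gr_def symb_def C_carrier cong: conj_cong)
next
  fix p q assume pq: "p \<in> rees" "q \<in> rees"
  then have c: "p \<in> carrier (UP A)" "q \<in> carrier (UP A)" and
      P: "co p n \<in> P n" "co q n \<in> P n" for n
    by (simp_all add: rees_def)
  have car: "co p n \<in> carrier A" "co q n \<in> carrier A" for n
    using P P_carrier by blast+
  show "symb (p \<oplus>\<^bsub>UP A\<^esub> q) = symb p \<oplus>\<^bsub>gr\<^esub> symb q"
    using c car by (auto simp: symb_def gr_def C_add fun_eq_iff)
  have "cls n (co (p \<otimes>\<^bsub>UP A\<^esub> q) n) = lact (C n) (h (co p 0)) (cls n (co q n))
      \<oplus>\<^bsub>C n\<^esub> ract (C n) (cls n (co p n)) (h (co q 0)) \<oplus>\<^bsub>C n\<^esub>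
      (\<Oplus>\<^bsub>C n\<^esub>i\<in>{1..<n}. rcoset_mult A (P (Suc n)) ((\<lambda>k\<in>{1..}. cls k (co p k)) i)
        ((\<lambda>k\<in>{1..}. cls k (co q k)) (n - i)))"
    if n: "n \<ge> 1" for n
  proof -
    have mem: "co p i \<otimes> co q (n - i) \<in> P n" if "i \<le> n" for i
      using P_mult[OF P(1)[of i] P(2)[of "n - i"]] that by simp
    \<comment> \<open>The outer terms of the convolution, with a factor of degree zero, become the
      left and right action; the inner terms become the sum of products of classes. That n is
      positive keeps the two outer terms distinct.\<close>
    have split: "{..n} = insert 0 (insert n {1..<n})"
      using n by auto
    have "(\<Oplus>\<^bsub>C n\<^esub>i\<in>{1..<n}. rcoset_mult A (P (Suc n)) ((\<lambda>k\<in>{1..}. cls k (co p k)) i)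
        ((\<lambda>k\<in>{1..}. cls k (co q k)) (n - i)))
        = (\<Oplus>\<^bsub>C n\<^esub>i\<in>{1..<n}. cls n (co p i \<otimes> co q (n - i)))"
      using mem by (intro M.finsum_cong') (auto simp: rcoset_mult_cls P C_carrier)
    also have "\<dots> = cls n (\<Oplus>i\<in>{1..<n}. co p i \<otimes> co q (n - i))"
      using mem by (intro cls_finsum[symmetric]) auto
    moreover have "(\<Oplus>i\<in>{..n}. co p i \<otimes> co q (n - i))
        = co p 0 \<otimes> co q n \<oplus> (co p n \<otimes> co q 0 \<oplus> (\<Oplus>i\<in>{1..<n}. co p i \<otimes> co q (n - i)))"
      unfolding split using n car by (simp add: A.finsum_insert Pi_iff)
    moreover have "(\<Oplus>i\<in>{1..<n}. co p i \<otimes> co q (n - i)) \<in> carrier A"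
      using car by (intro A.finsum_closed) auto
    ultimately show ?thesis
      using c car P by (simp add: lact_C ract_C C_add A.a_assoc)
  qed
  then show "symb (p \<otimes>\<^bsub>UP A\<^esub> q) = symb p \<otimes>\<^bsub>gr\<^esub> symb q"
    using c car by (auto simp: symb_def gr_def fun_eq_iff)
next
  show "symb \<one>\<^bsub>UP A\<^esub> = \<one>\<^bsub>gr\<^esub>"
    by (auto simp: symb_def gr_def gr_zero_def C_zero fun_eq_iff)
qed

lemma symb_zero: "symb \<zero>\<^bsub>UP A\<^esub> = \<zero>\<^bsub>gr\<^esub>"
  by (auto simp: symb_def gr_def gr_zero_def C_zero fun_eq_iff)

lemma symb_image: "symb ` rees = carrier gr"
proof
  show "symb ` rees \<subseteq> carrier gr"
    using ring_hom_closed[OF symb_hom] by auto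
  show "carrier gr \<subseteq> symb ` rees"
  proof
    fix x assume "x \<in> carrier gr"
    then obtain r f where x: "x = (r, f)" and r: "r \<in> carrier R" and f: "f \<in> (\<Pi>\<^sub>E n\<in>{1..}. carrier (C n))"
      and fin: "finite {n \<in> {1..}. f n \<noteq> \<zero>\<^bsub>C n\<^esub>}"
      by (auto simp: gr_def)
    \<comment> \<open>The last clause forces the representative \<open>\<zero>\<close> for a zero
      class; without it the chosen coefficients need not have finite support and would not form a
      polynomial.\<close>
    have "\<exists>a \<in> P n. (n = 0 \<longrightarrow> h a = r) \<and> (n \<ge> 1 \<longrightarrow> cls n a = f n)
        \<and> (n \<ge> 1 \<and> f n = \<zero>\<^bsub>C n\<^esub> \<longrightarrow> a = \<zero>)" for n
    proof (cases "n = 0")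
      case True
      obtain a where "a \<in> carrier A" "h a = r"
        using r unfolding surj[symmetric] by (metis imageE)
      then show ?thesis
        using True by (auto simp: P_0)
    next
      case False
      then have "f n \<in> carrier (C n)"
        using f by (auto simp: PiE_iff)
      then obtain a where a: "a \<in> P n" "f n = cls n a"
        by (auto simp: C_carrier)
      show ?thesis
      proof (cases "f n = \<zero>\<^bsub>C n\<^esub>")
        case True
        then show ?thesis
          using \<open>n \<noteq> 0\<close> P_zero[of n] C_zero[of n] by (intro bexI[of _ \<zero>]) simp_all
      next
        case False
        then show ?thesis
          using \<open>n \<noteq> 0\<close> a by (intro bexI[of _ a]) simp_all
      qed
    qed
    then obtain p where p: "\<And>n. p n \<in> P n" "h (p 0) = r" "\<And>n. n \<ge> 1 \<Longrightarrow> cls n (p n) = f n"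
      "\<And>n. \<lbrakk>n \<ge> 1; f n = \<zero>\<^bsub>C n\<^esub>\<rbrakk> \<Longrightarrow> p n = \<zero>"
      by metis
    obtain b where b: "\<And>n. n \<in> {n \<in> {1..}. f n \<noteq> \<zero>\<^bsub>C n\<^esub>} \<Longrightarrow> n \<le> b"
      using fin finite_nat_set_iff_bounded_le by meson
    have "bound \<zero> b p"
    proof
      fix n assume "b < n"
      then show "p n = \<zero>"
        using b[of n] p(4)[of n] by force
    qed
    then have "p \<in> up A"
      using p(1) P_carrier by (intro mem_upI) auto
    then have "p \<in> carrier (UP A)" "co p = p"
      by (simp_all add: UP_def)
    then have "p \<in> rees" "symb p = x"
      using p f by (auto simp: rees_def symb_def x fun_eq_iff PiE_def extensional_def)
    then show "x \<in> symb ` rees"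
      by blast
  qed
qed

text \<open>Membership in \<open>ring_hom\<close> does not presuppose that the target is a ring, so
  the ring laws can be transported along the surjection \<open>symb\<close>. It says nothing about
  zero, hence the separate \<open>symb_zero\<close>.\<close>

lemma ring_gr: "ring gr"
proof -
  have "ring (UP A \<lparr>carrier := rees\<rparr>)"
    by (rule U.P.subring_is_ring[OF subring_rees])
  from ring.ring_hom_imp_img_ring[OF this symb_hom] show ?thesis
    by (simp add: symb_image symb_zero)
qed

section \<open>Homogeneous elements, the grading, and generation in degrees zero and one\<close>

interpretation G: ring gr
  by (rule ring_gr)

definition homog :: "nat \<Rightarrow> 'a \<Rightarrow> 'c \<times> (nat \<Rightarrow> 'a set)" where
  "homog n a = symb (monom (UP A) a n)"

lemma monom_rees: "a \<in> P n \<Longrightarrow> monom (UP A) a n \<in> rees"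
  using P_carrier[of a n] P_zero by (simp add: rees_def)

lemma homog_closed: "a \<in> P n \<Longrightarrow> homog n a \<in> carrier gr"
  using monom_rees symb_image unfolding homog_def by blast

lemma homog_add: "\<lbrakk>a \<in> P n; b \<in> P n\<rbrakk> \<Longrightarrow> homog n (a \<oplus> b) = homog n a \<oplus>\<^bsub>gr\<^esub> homog n b"
  using ring_hom_add[OF symb_hom, of "monom (UP A) a n" "monom (UP A) b n"]
  by (simp add: homog_def monom_rees P_carrier U.monom_add)

lemma homog_mult: "\<lbrakk>a \<in> P i; b \<in> P j\<rbrakk> \<Longrightarrow> homog (i + j) (a \<otimes> b) = homog i a \<otimes>\<^bsub>gr\<^esub> homog j b"
  using ring_hom_mult[OF symb_hom, of "monom (UP A) a i" "monom (UP A) b j"]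
  by (simp add: homog_def monom_rees P_carrier U.monom_mult)

lemma homog_zero: "homog n \<zero> = \<zero>\<^bsub>gr\<^esub>"
  by (simp add: homog_def symb_zero)

lemma homog_minus: "a \<in> P n \<Longrightarrow> homog n (\<ominus> a) = \<ominus>\<^bsub>gr\<^esub> homog n a"
  using homog_add[of "\<ominus> a" n a]
  by (intro G.minus_equality[symmetric]) (auto simp: homog_closed P_minus A.l_neg P_carrier homog_zero)

lemma homog_one: "homog 0 \<one> = \<one>\<^bsub>gr\<^esub>"
  using ring_hom_one[OF symb_hom] by (simp add: homog_def U.monom_one)

lemma homog_0: "a \<in> carrier A \<Longrightarrow> homog 0 a = (h a, gr_zero)"
  by (auto simp: homog_def symb_def gr_zero_def C_zero fun_eq_iff)

lemma gr_part_carrier: "x \<in> gr_part n \<Longrightarrow> x \<in> carrier gr"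
  by (auto simp: gr_part_def)

lemma gr_part_eq: "gr_part n = homog n ` P n"
proof
  show "homog n ` P n \<subseteq> gr_part n"
  proof (rule image_subsetI)
    fix a assume a: "a \<in> P n"
    then show "homog n a \<in> gr_part n"
      using homog_closed[OF a] P_carrier[OF a] by (auto simp: gr_part_def homog_def symb_def C_zero)
  qed
  show "gr_part n \<subseteq> homog n ` P n"
  proof
    fix x assume x: "x \<in> gr_part n"
    then have "x \<in> symb ` rees"
      unfolding symb_image by (auto simp: gr_part_def)
    then obtain p where p: "p \<in> rees" "x = symb p"
      by blast
    have c: "co p k \<in> P k" "co p k \<in> carrier A" for k
      using p P_carrier by (auto simp: rees_def)
    \<comment> \<open>The other coefficients of p may be nonzero in \<open>A\<close>, but their
      classes vanish, so the single monomial has the same image as p.\<close>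
    have "x = homog n (co p n)"
      using x c unfolding p(2)
      by (auto simp: gr_part_def homog_def symb_def fun_eq_iff C_zero)
    then show "x \<in> homog n ` P n"
      using c by blast
  qed
qed

text \<open>The image under \<open>symb\<close> of the expansion of a polynomial into its
  monomials.\<close>

lemma finsum_homogE:
  assumes "x \<in> carrier gr"
  obtains d a where "\<And>n. a n \<in> P n" "x = (\<Oplus>\<^bsub>gr\<^esub>n\<in>{..d}. homog n (a n))" "\<And>n. n > d \<Longrightarrow> a n = \<zero>"
proof -
  obtain p where p: "p \<in> rees" "x = symb p"
    using assms symb_image by auto
  then have pc: "p \<in> carrier (UP A)" "co p n \<in> P n" for n
    by (auto simp: rees_def)
  \<comment> \<open>The map \<open>symb\<close> is known to be additive only on \<open>rees\<close>,
    so membership of the partial sums is carried through the induction.\<close>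
  have fin: "symb (\<Oplus>\<^bsub>UP A\<^esub>i\<in>{..d}. monom (UP A) (co p i) i) = (\<Oplus>\<^bsub>gr\<^esub>i\<in>{..d}. homog i (co p i))
      \<and> (\<Oplus>\<^bsub>UP A\<^esub>i\<in>{..d}. monom (UP A) (co p i) i) \<in> rees" for d
  proof (induction d)
    case 0
    then show ?case
      using pc monom_rees[of "co p 0" 0] P_carrier homog_closed[of "co p 0" 0] by (simp add: homog_def)
  next
    case (Suc d)
    have mon: "monom (UP A) (co p i) i \<in> rees" for i
      using pc by (intro monom_rees)
    have "(\<Oplus>\<^bsub>UP A\<^esub>i\<in>{..Suc d}. monom (UP A) (co p i) i)
        = monom (UP A) (co p (Suc d)) (Suc d) \<oplus>\<^bsub>UP A\<^esub> (\<Oplus>\<^bsub>UP A\<^esub>i\<in>{..d}. monom (UP A) (co p i) i)"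
      using mon rees_carrier by (intro U.P.finsum_Suc) auto
    moreover have "(\<Oplus>\<^bsub>gr\<^esub>i\<in>{..Suc d}. homog i (co p i)) = homog (Suc d) (co p (Suc d)) \<oplus>\<^bsub>gr\<^esub> (\<Oplus>\<^bsub>gr\<^esub>i\<in>{..d}. homog i (co p i))"
      using pc homog_closed by (intro G.finsum_Suc) auto
    ultimately show ?case
      using Suc mon[of "Suc d"] ring_hom_add[OF symb_hom, of "monom (UP A) (co p (Suc d)) (Suc d)"]
        subringE(7)[OF subring_rees] by (simp add: homog_def)
  qed
  show ?thesis
  proof (rule that[of "co p" "deg A p"])
    show "x = (\<Oplus>\<^bsub>gr\<^esub>n\<in>{..deg A p}. homog n (co p n))"
      using fin[of "deg A p"] U.up_repr[OF pc(1)] p by simp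
    show "co p n = \<zero>" if "n > deg A p" for n
      using that pc by (simp add: U.deg_aboveD)
  qed (rule pc)
qed

lemma additive_subgroup_gr_part: "additive_subgroup (gr_part n) gr"
proof (rule additive_subgroupI, rule G.add.subgroupI)
  show "gr_part n \<subseteq> carrier gr"
    by (auto simp: gr_part_def)
  show "gr_part n \<noteq> {}"
    using P_zero by (auto simp: gr_part_eq)
  show "\<ominus>\<^bsub>gr\<^esub> x \<in> gr_part n" if "x \<in> gr_part n" for x
    using that P_minus by (auto simp: gr_part_eq simp flip: homog_minus)
  show "x \<oplus>\<^bsub>gr\<^esub> y \<in> gr_part n" if "x \<in> gr_part n" "y \<in> gr_part n" for x y
    using that P_add by (auto simp: gr_part_eq simp flip: homog_add)
qed

lemma gr_part_eqI:
  assumes "x \<in> gr_part n" "y \<in> gr_part n" "n = 0 \<Longrightarrow> fst x = fst y" "n \<ge> 1 \<Longrightarrow> snd x n = snd y n"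
  shows "x = y"
proof -
  obtain a b where ab: "a \<in> carrier A" "b \<in> carrier A" "x = homog n a" "y = homog n b"
    using assms(1,2) P_carrier by (auto simp: gr_part_eq)
  then show ?thesis
    using assms(3,4) by (auto simp: homog_def symb_def fun_eq_iff)
qed

lemma fst_hom: "fst \<in> hom (add_monoid gr) (add_monoid R)"
  by (auto simp: hom_def gr_def)

lemma snd_hom: "n \<ge> 1 \<Longrightarrow> (\<lambda>x. snd x n) \<in> hom (add_monoid gr) (add_monoid (C n))"
  by (auto simp: hom_def gr_def PiE_iff)

theorem graded_ring_gr: "graded_ring gr gr_part"
  unfolding graded_ring_def
proof (intro conjI allI ballI)
  show "ring gr"
    by (rule ring_gr)
  show "additive_subgroup (gr_part n) gr" for n
    by (rule additive_subgroup_gr_part)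
  show "\<one>\<^bsub>gr\<^esub> \<in> gr_part 0"
    unfolding gr_part_eq by (auto simp: P_0 simp flip: homog_one)
  show "x \<otimes>\<^bsub>gr\<^esub> y \<in> gr_part (i + j)" if "x \<in> gr_part i" "y \<in> gr_part j" for i j x y
    using that P_mult by (auto simp: gr_part_eq simp flip: homog_mult)
  fix x assume x: "x \<in> carrier gr"
  show "\<exists>!p. (\<forall>n. p n \<in> gr_part n) \<and> finite {n. p n \<noteq> \<zero>\<^bsub>gr\<^esub>} \<and> x = (\<Oplus>\<^bsub>gr\<^esub>n\<in>{n. p n \<noteq> \<zero>\<^bsub>gr\<^esub>}. p n)"
  proof (rule ex_ex1I)
    obtain d a where a: "\<And>n. a n \<in> P n" "x = (\<Oplus>\<^bsub>gr\<^esub>n\<in>{..d}. homog n (a n))" "\<And>n. n > d \<Longrightarrow> a n = \<zero>"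
      using finsum_homogE[OF x] by blast
    have sub: "{n. homog n (a n) \<noteq> \<zero>\<^bsub>gr\<^esub>} \<subseteq> {..d}"
      using a(3) homog_zero by (auto simp: not_le) (metis not_le)
    have "(\<Oplus>\<^bsub>gr\<^esub>n\<in>{n. homog n (a n) \<noteq> \<zero>\<^bsub>gr\<^esub>}. homog n (a n)) = (\<Oplus>\<^bsub>gr\<^esub>n\<in>{..d}. homog n (a n))"
      using sub a(1) homog_closed by (intro G.add.finprod_mono_neutral_cong_left) auto
    moreover have "finite {n. homog n (a n) \<noteq> \<zero>\<^bsub>gr\<^esub>}"
      by (rule finite_subset[OF sub]) simp
    ultimately show "\<exists>p. (\<forall>n. p n \<in> gr_part n) \<and> finite {n. p n \<noteq> \<zero>\<^bsub>gr\<^esub>} \<and> x = (\<Oplus>\<^bsub>gr\<^esub>n\<in>{n. p n \<noteq> \<zero>\<^bsub>gr\<^esub>}. p n)"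
      using a by (intro exI[of _ "\<lambda>n. homog n (a n)"]) (auto simp: gr_part_eq)
  next
    \<comment> \<open>Uniqueness: the projections to the components are additive and kill all
      summands of the wrong degree, so x determines every p n.\<close>
    have fst: "fst x = fst (p 0)" and snd: "k \<ge> 1 \<Longrightarrow> snd x k = snd (p k) k"
      if p: "\<forall>n. p n \<in> gr_part n" and fin: "finite {n. p n \<noteq> \<zero>\<^bsub>gr\<^esub>}"
        and xp: "x = (\<Oplus>\<^bsub>gr\<^esub>n\<in>{n. p n \<noteq> \<zero>\<^bsub>gr\<^esub>}. p n)" for p k
    proof -
      have car: "p \<in> {n. p n \<noteq> \<zero>\<^bsub>gr\<^esub>} \<rightarrow> carrier gr"
        using p gr_part_carrier by blast
      have mem: "p n \<in> gr_part n" for n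
        using p by blast
      show "fst x = fst (p 0)"
      proof (subst xp, rule hom_finsum_single[OF G.abelian_group_axioms R.abelian_group_axioms fst_hom fin car])
        show "fst (p n) = \<zero>\<^bsub>R\<^esub>" if "n \<noteq> 0" for n
          using mem[of n] that by (auto simp: gr_part_def)
        show "fst (p 0) = \<zero>\<^bsub>R\<^esub>" if "0 \<notin> {n. p n \<noteq> \<zero>\<^bsub>gr\<^esub>}"
          using that by (simp add: gr_def)
      qed
      show "snd x k = snd (p k) k" if k: "k \<ge> 1"
      proof (subst xp, rule hom_finsum_single[OF G.abelian_group_axioms M.abelian_group_axioms snd_hom[OF k] fin car])
        show "snd (p n) k = \<zero>\<^bsub>C k\<^esub>" if "n \<noteq> k" for n
          using mem[of n] that k by (auto simp: gr_part_def)
        show "snd (p k) k = \<zero>\<^bsub>C k\<^esub>" if "k \<notin> {n. p n \<noteq> \<zero>\<^bsub>gr\<^esub>}"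
          using that k by (simp add: gr_def gr_zero_def)
      qed
    qed
    fix p q
    assume p: "(\<forall>n. p n \<in> gr_part n) \<and> finite {n. p n \<noteq> \<zero>\<^bsub>gr\<^esub>} \<and> x = (\<Oplus>\<^bsub>gr\<^esub>n\<in>{n. p n \<noteq> \<zero>\<^bsub>gr\<^esub>}. p n)"
      and q: "(\<forall>n. q n \<in> gr_part n) \<and> finite {n. q n \<noteq> \<zero>\<^bsub>gr\<^esub>} \<and> x = (\<Oplus>\<^bsub>gr\<^esub>n\<in>{n. q n \<noteq> \<zero>\<^bsub>gr\<^esub>}. q n)"
    show "p = q"
    proof
      fix n
      show "p n = q n"
        using p q fst[of p] fst[of q] snd[of p n] snd[of q n] by (intro gr_part_eqI[of _ n]) auto
    qed
  qed
qed

text \<open>Every pair in question is \<open>homog 0 a\<close> for a lift \<open>a\<close> of the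
  scalar, so its laws are those of \<open>homog\<close> and not a computation with the product
  formula.\<close>

theorem degree_zero_iso: "(\<lambda>r. (r, gr_zero)) \<in> ring_iso R (gr \<lparr>carrier := gr_part 0\<rparr>)"
proof -
  have im: "(\<lambda>r. (r, gr_zero)) ` carrier R = gr_part 0"
    by (force simp: gr_part_eq P_0 homog_0 simp flip: surj)
  have RE: thesis if "c \<in> carrier R" "\<And>a. \<lbrakk>c = h a; a \<in> carrier A\<rbrakk> \<Longrightarrow> thesis" for c thesis
    using that surj by auto
  have "(\<lambda>r. (r, gr_zero)) \<in> ring_hom R (gr \<lparr>carrier := gr_part 0\<rparr>)"
  proof (rule ring_hom_memI; simp)
    show "(r, gr_zero) \<in> gr_part 0" if "r \<in> carrier R" for r
      using im that by blast
    show "(r \<otimes>\<^bsub>R\<^esub> s, gr_zero) = (r, gr_zero) \<otimes>\<^bsub>gr\<^esub> (s, gr_zero)" if rs: "r \<in> carrier R" "s \<in> carrier R" for r s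
    proof -
      obtain a b where ab: "r = h a" "a \<in> carrier A" "s = h b" "b \<in> carrier A"
        using rs by (elim RE) blast
      then show ?thesis
        using homog_mult[of a 0 b 0] by (simp add: P_0 homog_0)
    qed
    show "(r \<oplus>\<^bsub>R\<^esub> s, gr_zero) = (r, gr_zero) \<oplus>\<^bsub>gr\<^esub> (s, gr_zero)" if rs: "r \<in> carrier R" "s \<in> carrier R" for r s
    proof -
      obtain a b where ab: "r = h a" "a \<in> carrier A" "s = h b" "b \<in> carrier A"
        using rs by (elim RE) blast
      then show ?thesis
        using homog_add[of a 0 b] by (simp add: P_0 homog_0)
    qed
    show "(\<one>\<^bsub>R\<^esub>, gr_zero) = \<one>\<^bsub>gr\<^esub>"
      using homog_one by (simp add: homog_0)
  qed
  then show ?thesis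
    using im by (auto simp: ring_iso_def bij_betw_def inj_on_def)
qed

text \<open>By construction K ^ (n + 1) consists of sums of products ik with i in K ^ n and k in K,
  and \<open>homog\<close> sends such a product to an element of degree n times one of degree one.
  Induction on n reaches all homogeneous elements, and these add up to everything.\<close>

theorem generate_gr: "generate_ring gr (gr_part 0 \<union> gr_part 1) = carrier gr"
proof
  let ?S = "generate_ring gr (gr_part 0 \<union> gr_part 1)"
  have sub: "gr_part 0 \<union> gr_part 1 \<subseteq> carrier gr"
    by (auto simp: gr_part_def)
  then show "?S \<subseteq> carrier gr"
    by (rule G.generate_ring_incl)
  have homog: "homog n a \<in> ?S" if "a \<in> P n" for n a
    using that
  proof (induction n arbitrary: a)
    case 0
    then show ?case
      by (intro generate_ring.incl) (simp add: gr_part_eq)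
  next
    case (Suc n)
    from Suc.prems[unfolded P_Suc] show ?case
    proof (induction a rule: ideal_prod.induct)
      case (prod i k)
      have k: "k \<in> P 1"
        using prod by (simp add: P_1)
      then have "homog 1 k \<in> ?S"
        by (intro generate_ring.incl) (simp add: gr_part_eq)
      then have "homog n i \<otimes>\<^bsub>gr\<^esub> homog 1 k \<in> ?S"
        using prod Suc.IH by (intro generate_ring.eng_mult)
      then show ?case
        using homog_mult[OF prod(1) k] by simp
    next
      case (sum s t)
      then show ?case
        using generate_ring.eng_add[OF sum.IH] by (simp add: homog_add P_Suc)
    qed
  qed
  show "carrier gr \<subseteq> ?S"
  proof
    fix x assume "x \<in> carrier gr"
    then obtain d a where a: "\<And>n. a n \<in> P n" "x = (\<Oplus>\<^bsub>gr\<^esub>n\<in>{..d}. homog n (a n))"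
      using finsum_homogE by blast
    have "(\<Oplus>\<^bsub>gr\<^esub>n\<in>{..d}. homog n (a n)) \<in> ?S"
    proof (induction d)
      case 0
      then show ?case
        using homog[OF a(1)] homog_closed[OF a(1)] by simp
    next
      case (Suc d)
      then show ?case
        using homog[OF a(1)] homog_closed[OF a(1)] by (simp add: G.finsum_Suc generate_ring.eng_add)
    qed
    then show "x \<in> ?S"
      using a by simp
  qed
qed

end

section \<open>The operator rings of a ternary Gamma-ring\<close>

text \<open>The extension is additive also in the function that is extended; this yields additivity
  of \<open>free_mult\<close> in its second argument, which sits inside that function.\<close>

lemma frag_extend_fun_diff:
  "frag_extend (\<lambda>p. a p - b p) f = frag_extend a f - frag_extend b f"
proof (induction f rule: frag_induction[OF subset_UNIV])
  case (3 f g)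
  then show ?case
    by (simp add: frag_extend_diff)
qed simp_all

lemma free_mult_diff:
  "free_mult m (f - g) k = free_mult m f k - free_mult m g k"
  "free_mult m f (g - k) = free_mult m f g - free_mult m f k"
  by (simp_all add: free_mult_def frag_extend_diff frag_extend_fun_diff)

lemma free_mult_add:
  "free_mult m (f + g) k = free_mult m f k + free_mult m g k"
  "free_mult m f (g + k) = free_mult m f g + free_mult m f k"
  using free_mult_diff(1)[of m "f + g" g k] free_mult_diff(2)[of m f "g + k" k] by simp_all

lemma free_mult_zero [simp]: "free_mult m 0 g = 0" "free_mult m f 0 = 0"
  using free_mult_diff(1)[of m 0 0 g] free_mult_diff(2)[of m f 0 0] by simp_all

lemma free_mult_of [simp]: "free_mult m (frag_of p) (frag_of q) = frag_of (quad_mult m p q)"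
  by (simp add: free_mult_def)

lemma (in abelian_group) ring_End_ring: "ring (End_ring G)"
proof -
  have homE: "f x \<in> carrier G" "f (x \<oplus> y) = f x \<oplus> f y"
    if "f \<in> hom (add_monoid G) (add_monoid G)" "x \<in> carrier G" "y \<in> carrier G" for f x y
    using that by (auto simp: hom_def)
  have zero: "f \<zero> = \<zero>" if "f \<in> hom (add_monoid G) (add_monoid G)" for f
    using hom_one[OF that a_group a_group] by simp
  note [simp] = homE zero a_ac
  note [intro!] = homI extensionalityI
  show ?thesis
  proof (rule ringI)
    show "abelian_group (End_ring G)"
    proof (rule abelian_groupI)
      show "\<exists>g\<in>carrier (End_ring G). g \<oplus>\<^bsub>End_ring G\<^esub> f = \<zero>\<^bsub>End_ring G\<^esub>"
        if "f \<in> carrier (End_ring G)" for f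
        using that
        by (intro bexI[of _ "\<lambda>x\<in>carrier G. \<ominus> f x"])
           (auto simp: End_ring_def l_neg minus_add simp del: a_ac del: extensionalityI intro!: restrict_ext)
    qed (auto simp: End_ring_def cong: restrict_cong)
    show "Group.monoid (End_ring G)"
      by (rule monoidI)
         (auto simp: End_ring_def compose_def cong: restrict_cong)
  qed (auto simp: End_ring_def compose_def cong: restrict_cong)
qed

context ternary_gamma_ring
begin

section \<open>The free ring on quadruples and the tensor relations\<close>

abbreviation Q where "Q \<equiv> quads T \<Gamma>"

abbreviation TR where "TR \<equiv> tensor_rels T \<Gamma>"

text \<open>The integral semigroup ring of \<open>Q\<close> under \<open>quad_mult\<close>. The
  ternary laws make \<open>quad_mult\<close> associative on quadruples already, so associativity is
  settled before any quotient is taken.\<close>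

definition B where "B = (free_ab Q) \<lparr>monoid.mult := free_mult m\<rparr>"

lemma B_simps [simp]:
  "carrier B = carrier (free_ab Q)" "f \<otimes>\<^bsub>B\<^esub> g = free_mult m f g" "f \<oplus>\<^bsub>B\<^esub> g = f + g" "\<zero>\<^bsub>B\<^esub> = 0"
  by (simp_all add: B_def)

lemma add_monoid_B: "add_monoid B = add_monoid (free_ab Q)"
  by (simp add: B_def)

lemma quad_mult_closed: "\<lbrakk>p \<in> Q; q \<in> Q\<rbrakk> \<Longrightarrow> quad_mult m p q \<in> Q"
  by (auto simp: quads_def closed)

lemma quad_mult_assoc:
  "\<lbrakk>p \<in> Q; q \<in> Q; r \<in> Q\<rbrakk> \<Longrightarrow> quad_mult m (quad_mult m p q) r = quad_mult m p (quad_mult m q r)"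
  by (auto simp: quads_def assoc_left assoc_right)

lemma free_mult_closed:
  assumes f: "f \<in> carrier (free_ab Q)" and g: "g \<in> carrier (free_ab Q)"
  shows "free_mult m f g \<in> carrier (free_ab Q)"
  using f
proof (induction f rule: free_ab_induct)
  case (of p)
  show ?case
    using g
  proof (induction g rule: free_ab_induct)
    case (of q)
    then show ?case
      using \<open>p \<in> Q\<close> by (simp add: quad_mult_closed)
  qed (simp_all add: free_mult_diff free_ab_closed)
qed (simp_all add: free_mult_diff free_ab_closed)

lemma free_mult_assoc:
  assumes f: "f \<in> carrier (free_ab Q)" and g: "g \<in> carrier (free_ab Q)" and k: "k \<in> carrier (free_ab Q)"
  shows "free_mult m (free_mult m f g) k = free_mult m f (free_mult m g k)"
  using f
proof (induction f rule: free_ab_induct)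
  case (of p)
  show ?case
    using g
  proof (induction g rule: free_ab_induct)
    case (of q)
    show ?case
      using k
    proof (induction k rule: free_ab_induct)
      case (of r)
      then show ?case
        using \<open>p \<in> Q\<close> \<open>q \<in> Q\<close> by (simp add: quad_mult_assoc)
    qed (simp_all add: free_mult_diff)
  qed (simp_all add: free_mult_diff)
qed (simp_all add: free_mult_diff)

lemma nonunital_ring_B: "nonunital_ring B"
proof -
  interpret F: abelian_group "free_ab Q"
    by (rule abelian_group_free_ab)
  interpret B: abelian_group B
    by (rule F.abelian_group_image[where f = id]) simp_all
  show ?thesis
    by unfold_locales (simp_all add: free_mult_closed free_mult_assoc free_mult_add)
qed

sublocale B: nonunital_ring B
  by (rule nonunital_ring_B)

definition tens_gens where
  "tens_gens =
    {frag_of (a \<oplus>\<^bsub>T\<^esub> a', \<alpha>, b, \<beta>) - frag_of (a, \<alpha>, b, \<beta>) - frag_of (a', \<alpha>, b, \<beta>) | a a' \<alpha> b \<beta>.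
        a \<in> carrier T \<and> a' \<in> carrier T \<and> \<alpha> \<in> carrier \<Gamma> \<and> b \<in> carrier T \<and> \<beta> \<in> carrier \<Gamma>}
   \<union> {frag_of (a, \<alpha> \<oplus>\<^bsub>\<Gamma>\<^esub> \<alpha>', b, \<beta>) - frag_of (a, \<alpha>, b, \<beta>) - frag_of (a, \<alpha>', b, \<beta>) | a \<alpha> \<alpha>' b \<beta>.
        a \<in> carrier T \<and> \<alpha> \<in> carrier \<Gamma> \<and> \<alpha>' \<in> carrier \<Gamma> \<and> b \<in> carrier T \<and> \<beta> \<in> carrier \<Gamma>}
   \<union> {frag_of (a, \<alpha>, b \<oplus>\<^bsub>T\<^esub> b', \<beta>) - frag_of (a, \<alpha>, b, \<beta>) - frag_of (a, \<alpha>, b', \<beta>) | a \<alpha> b b' \<beta>.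
        a \<in> carrier T \<and> \<alpha> \<in> carrier \<Gamma> \<and> b \<in> carrier T \<and> b' \<in> carrier T \<and> \<beta> \<in> carrier \<Gamma>}
   \<union> {frag_of (a, \<alpha>, b, \<beta> \<oplus>\<^bsub>\<Gamma>\<^esub> \<beta>') - frag_of (a, \<alpha>, b, \<beta>) - frag_of (a, \<alpha>, b, \<beta>') | a \<alpha> b \<beta> \<beta>'.
        a \<in> carrier T \<and> \<alpha> \<in> carrier \<Gamma> \<and> b \<in> carrier T \<and> \<beta> \<in> carrier \<Gamma> \<and> \<beta>' \<in> carrier \<Gamma>}"

lemma TR_eq: "TR = generate (add_monoid (free_ab Q)) tens_gens"
  by (simp add: tensor_rels_def tens_gens_def)

lemma tens_gens_carrier: "tens_gens \<subseteq> carrier (free_ab Q)"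
  unfolding tens_gens_def by (auto simp: quads_def intro!: free_ab_closed)

lemma additive_subgroup_TR: "additive_subgroup TR (free_ab Q)"
  unfolding TR_eq by (rule additive_subgroup_generate[OF tens_gens_carrier])

lemma tens_gens_cases [consumes 1, case_names 1 2 3 4]:
  assumes "g \<in> tens_gens"
  obtains a a' \<alpha> b \<beta> where
      "g = frag_of (a \<oplus>\<^bsub>T\<^esub> a', \<alpha>, b, \<beta>) - frag_of (a, \<alpha>, b, \<beta>) - frag_of (a', \<alpha>, b, \<beta>)"
      "a \<in> carrier T" "a' \<in> carrier T" "\<alpha> \<in> carrier \<Gamma>" "b \<in> carrier T" "\<beta> \<in> carrier \<Gamma>"
  | a \<alpha> \<alpha>' b \<beta> where
      "g = frag_of (a, \<alpha> \<oplus>\<^bsub>\<Gamma>\<^esub> \<alpha>', b, \<beta>) - frag_of (a, \<alpha>, b, \<beta>) - frag_of (a, \<alpha>', b, \<beta>)"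
      "a \<in> carrier T" "\<alpha> \<in> carrier \<Gamma>" "\<alpha>' \<in> carrier \<Gamma>" "b \<in> carrier T" "\<beta> \<in> carrier \<Gamma>"
  | a \<alpha> b b' \<beta> where
      "g = frag_of (a, \<alpha>, b \<oplus>\<^bsub>T\<^esub> b', \<beta>) - frag_of (a, \<alpha>, b, \<beta>) - frag_of (a, \<alpha>, b', \<beta>)"
      "a \<in> carrier T" "\<alpha> \<in> carrier \<Gamma>" "b \<in> carrier T" "b' \<in> carrier T" "\<beta> \<in> carrier \<Gamma>"
  | a \<alpha> b \<beta> \<beta>' where
      "g = frag_of (a, \<alpha>, b, \<beta> \<oplus>\<^bsub>\<Gamma>\<^esub> \<beta>') - frag_of (a, \<alpha>, b, \<beta>) - frag_of (a, \<alpha>, b, \<beta>')"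
      "a \<in> carrier T" "\<alpha> \<in> carrier \<Gamma>" "b \<in> carrier T" "\<beta> \<in> carrier \<Gamma>" "\<beta>' \<in> carrier \<Gamma>"
  using assms unfolding tens_gens_def Un_iff mem_Collect_eq 
  by (elim disjE exE conjE) (rule that, assumption, assumption, assumption, assumption, assumption, assumption)+

lemma TR_intros:
  "\<lbrakk>a \<in> carrier T; a' \<in> carrier T; \<alpha> \<in> carrier \<Gamma>; b \<in> carrier T; \<beta> \<in> carrier \<Gamma>\<rbrakk>
    \<Longrightarrow> frag_of (a \<oplus>\<^bsub>T\<^esub> a', \<alpha>, b, \<beta>) - frag_of (a, \<alpha>, b, \<beta>) - frag_of (a', \<alpha>, b, \<beta>) \<in> TR"
  "\<lbrakk>a \<in> carrier T; \<alpha> \<in> carrier \<Gamma>; \<alpha>' \<in> carrier \<Gamma>; b \<in> carrier T; \<beta> \<in> carrier \<Gamma>\<rbrakk>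
    \<Longrightarrow> frag_of (a, \<alpha> \<oplus>\<^bsub>\<Gamma>\<^esub> \<alpha>', b, \<beta>) - frag_of (a, \<alpha>, b, \<beta>) - frag_of (a, \<alpha>', b, \<beta>) \<in> TR"
  "\<lbrakk>a \<in> carrier T; \<alpha> \<in> carrier \<Gamma>; b \<in> carrier T; b' \<in> carrier T; \<beta> \<in> carrier \<Gamma>\<rbrakk>
    \<Longrightarrow> frag_of (a, \<alpha>, b \<oplus>\<^bsub>T\<^esub> b', \<beta>) - frag_of (a, \<alpha>, b, \<beta>) - frag_of (a, \<alpha>, b', \<beta>) \<in> TR"
  "\<lbrakk>a \<in> carrier T; \<alpha> \<in> carrier \<Gamma>; b \<in> carrier T; \<beta> \<in> carrier \<Gamma>; \<beta>' \<in> carrier \<Gamma>\<rbrakk>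
    \<Longrightarrow> frag_of (a, \<alpha>, b, \<beta> \<oplus>\<^bsub>\<Gamma>\<^esub> \<beta>') - frag_of (a, \<alpha>, b, \<beta>) - frag_of (a, \<alpha>, b, \<beta>') \<in> TR"
  unfolding TR_eq tens_gens_def by (intro generate.incl; blast)+

text \<open>A left factor absorbs only the first entry of the relation, as the fifth argument of
  \<open>m\<close>. A relation in that entry survives by \<open>add5\<close>; relations in the other
  three entries keep their shape.\<close>

lemma TR_mult_left:
  assumes r: "r \<in> TR" and f: "f \<in> carrier (free_ab Q)"
  shows "free_mult m f r \<in> TR"
  using r unfolding TR_eq
proof (rule generate_map_mem[OF _ tens_gens_carrier, where D = "\<lambda>r. free_mult m f r" and S' = Q], fold TR_eq)
  fix g assume g: "g \<in> tens_gens"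
  show "free_mult m f g \<in> TR"
  proof (rule free_ab_map_mem[OF f additive_subgroup_TR, where D = "\<lambda>f. free_mult m f g"])
    fix p assume "p \<in> Q"
    then obtain c \<gamma> d \<delta> where p: "p = (c, \<gamma>, d, \<delta>)" "c \<in> carrier T" "\<gamma> \<in> carrier \<Gamma>" "d \<in> carrier T" "\<delta> \<in> carrier \<Gamma>"
      by (auto simp: quads_def)
    from g show "free_mult m (frag_of p) g \<in> TR"
      by (cases rule: tens_gens_cases)
         (simp_all add: p free_mult_diff TR_intros closed add5)
  qed (simp add: free_mult_diff)
qed (simp_all add: free_mult_diff additive_subgroup_TR)

text \<open>Here all four entries of the relation are absorbed into the product. By
  \<open>add1\<close> to \<open>add4\<close> each kind of relation becomes one in the first
  entry.\<close>

lemma TR_mult_right: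
  assumes r: "r \<in> TR" and f: "f \<in> carrier (free_ab Q)"
  shows "free_mult m r f \<in> TR"
  using r unfolding TR_eq
proof (rule generate_map_mem[OF _ tens_gens_carrier, where D = "\<lambda>r. free_mult m r f" and S' = Q], fold TR_eq)
  fix g assume g: "g \<in> tens_gens"
  show "free_mult m g f \<in> TR"
  proof (rule free_ab_map_mem[OF f additive_subgroup_TR, where D = "\<lambda>f. free_mult m g f"])
    fix p assume "p \<in> Q"
    then obtain c \<gamma> d \<delta> where p: "p = (c, \<gamma>, d, \<delta>)" "c \<in> carrier T" "\<gamma> \<in> carrier \<Gamma>" "d \<in> carrier T" "\<delta> \<in> carrier \<Gamma>"
      by (auto simp: quads_def)
    from g show "free_mult m g (frag_of p) \<in> TR"
      by (cases rule: tens_gens_cases)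
         (simp_all add: p free_mult_diff TR_intros closed add1 add2 add3 add4)
  qed (simp add: free_mult_diff)
qed (simp_all add: free_mult_diff additive_subgroup_TR)

lemma rng_ideal_TR: "rng_ideal B TR"
proof -
  have "additive_subgroup TR B"
    using additive_subgroup_TR unfolding additive_subgroup_def add_monoid_B .
  then show ?thesis
    by (simp add: rng_ideal_def TR_mult_left TR_mult_right)
qed

section \<open>The tensor ring, the ideal \<open>J\<close> and their quotient\<close>

lemma F_ring_eq: "F_ring T \<Gamma> m = B Quot TR"
  by (simp add: F_ring_def B_def)

sublocale F: nonunital_ring "F_ring T \<Gamma> m"
  unfolding F_ring_eq by (rule B.nonunital_ring_Quot[OF rng_ideal_TR])

lemma F_pure_eq: "F_pure T \<Gamma> p = TR +>\<^bsub>B\<^esub> frag_of p"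
  by (simp add: F_pure_def a_r_coset_def')

lemma carrier_F: "carrier (F_ring T \<Gamma> m) = (\<lambda>f. TR +>\<^bsub>B\<^esub> f) ` carrier (free_ab Q)"
  using abelian_subgroup.Quot_carrier[OF B.abelian_subgroupI_additive, of TR] rng_ideal_TR
  by (simp add: F_ring_eq rng_ideal_def)

definition J_gens where
  "J_gens = {F_pure T \<Gamma> (m a \<alpha> b \<beta> c, \<gamma>, d, \<delta>) \<ominus>\<^bsub>F_ring T \<Gamma> m\<^esub> F_pure T \<Gamma> (a, \<alpha>, m b \<beta> c \<gamma> d, \<delta>)
        | a \<alpha> b \<beta> c \<gamma> d \<delta>.
        a \<in> carrier T \<and> \<alpha> \<in> carrier \<Gamma> \<and> b \<in> carrier T \<and> \<beta> \<in> carrier \<Gamma> \<and>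
        c \<in> carrier T \<and> \<gamma> \<in> carrier \<Gamma> \<and> d \<in> carrier T \<and> \<delta> \<in> carrier \<Gamma>}"

lemma J_ideal_eq: "J_ideal T \<Gamma> m = rng_genideal (F_ring T \<Gamma> m) J_gens"
  by (simp add: J_ideal_def J_gens_def)

lemma F_pure_closed: "p \<in> Q \<Longrightarrow> F_pure T \<Gamma> p \<in> carrier (F_ring T \<Gamma> m)"
  by (simp add: F_pure_eq carrier_F)

lemma J_gens_carrier: "J_gens \<subseteq> carrier (F_ring T \<Gamma> m)"
  unfolding J_gens_def by (auto intro!: F.minus_closed F_pure_closed simp: quads_def closed)

lemma rng_ideal_J: "rng_ideal (F_ring T \<Gamma> m) (J_ideal T \<Gamma> m)"
  unfolding J_ideal_eq by (rule F.rng_ideal_genideal[OF J_gens_carrier])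

sublocale O: nonunital_ring "O_ring T \<Gamma> m"
  unfolding O_ring_def by (rule F.nonunital_ring_Quot[OF rng_ideal_J])

lemma A_ring_eq: "A_ring T \<Gamma> m = unitization (O_ring T \<Gamma> m)"
  by (simp add: A_ring_def unitization_def Let_def)

lemma ring_A: "ring (A_ring T \<Gamma> m)"
  unfolding A_ring_eq by (rule O.ring_unitization)

sublocale E: ring "End_ring T"
  by (rule T.ring_End_ring)

section \<open>The regular representation and its descent through both quotients\<close>

definition act :: "'t \<Rightarrow> ('t, 'g) quad \<Rightarrow> 't" where
  "act x p = (case p of (a, \<alpha>, b, \<beta>) \<Rightarrow> m a \<alpha> b \<beta> x)"

lemma act_closed: "\<lbrakk>x \<in> carrier T; p \<in> Q\<rbrakk> \<Longrightarrow> act x p \<in> carrier T"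
  by (auto simp: act_def quads_def closed)

lemma act_add:
  "\<lbrakk>x \<in> carrier T; y \<in> carrier T; p \<in> Q\<rbrakk> \<Longrightarrow> act (x \<oplus>\<^bsub>T\<^esub> y) p = act x p \<oplus>\<^bsub>T\<^esub> act y p"
  by (auto simp: act_def quads_def add5)

lemma act_quad_mult:
  "\<lbrakk>x \<in> carrier T; p \<in> Q; q \<in> Q\<rbrakk> \<Longrightarrow> act x (quad_mult m p q) = act (act x q) p"
  by (auto simp: act_def quads_def assoc_left assoc_right)

definition ev :: "(('t, 'g) quad \<Rightarrow>\<^sub>0 int) \<Rightarrow> 't \<Rightarrow> 't" where
  "ev f x = frag_sum T (act x) f"

lemma free_rho_eq: "free_rho T m f = (\<lambda>x\<in>carrier T. ev f x)"
  by (simp add: free_rho_def ev_def frag_sum_def act_def)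

context
  fixes x assumes x: "x \<in> carrier T"
begin

lemma ev_closed: "f \<in> carrier (free_ab Q) \<Longrightarrow> ev f x \<in> carrier T"
  unfolding ev_def by (rule T.frag_sum_closed[OF act_closed[OF x]])

lemma ev_plus:
  "\<lbrakk>f \<in> carrier (free_ab Q); g \<in> carrier (free_ab Q)\<rbrakk> \<Longrightarrow> ev (f + g) x = ev f x \<oplus>\<^bsub>T\<^esub> ev g x"
  unfolding ev_def by (rule T.frag_sum_add[OF act_closed[OF x]])

lemma ev_diff:
  "\<lbrakk>f \<in> carrier (free_ab Q); g \<in> carrier (free_ab Q)\<rbrakk> \<Longrightarrow> ev (f - g) x = ev f x \<ominus>\<^bsub>T\<^esub> ev g x"
  unfolding ev_def by (rule T.frag_sum_diff[OF act_closed[OF x]])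

lemma ev_of: "p \<in> Q \<Longrightarrow> ev (frag_of p) x = act x p"
  unfolding ev_def by (rule T.frag_sum_of) (rule act_closed[OF x])

lemma ev_zero: "ev 0 x = \<zero>\<^bsub>T\<^esub>"
  unfolding ev_def by (rule T.frag_sum_zero)

end

lemma ev_add_arg:
  assumes f: "f \<in> carrier (free_ab Q)" and xy: "x \<in> carrier T" "y \<in> carrier T"
  shows "ev f (x \<oplus>\<^bsub>T\<^esub> y) = ev f x \<oplus>\<^bsub>T\<^esub> ev f y"
  using f
proof (induction f rule: free_ab_induct)
  case (diff f g)
  then show ?case
    using xy by (simp add: ev_diff ev_closed T.minus_eq T.minus_add T.a_ac)
qed (use xy in \<open>simp_all add: ev_zero ev_of act_add\<close>)

lemma ev_diff_arg:
  assumes f: "f \<in> carrier (free_ab Q)" and xy: "x \<in> carrier T" "y \<in> carrier T"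
  shows "ev f (x \<ominus>\<^bsub>T\<^esub> y) = ev f x \<ominus>\<^bsub>T\<^esub> ev f y"
proof -
  have "ev f (x \<ominus>\<^bsub>T\<^esub> y \<oplus>\<^bsub>T\<^esub> y) = ev f (x \<ominus>\<^bsub>T\<^esub> y) \<oplus>\<^bsub>T\<^esub> ev f y"
    using f xy by (intro ev_add_arg) auto
  moreover have "x \<ominus>\<^bsub>T\<^esub> y \<oplus>\<^bsub>T\<^esub> y = x"
    using xy by (simp add: T.minus_eq T.a_assoc T.l_neg)
  ultimately show ?thesis
    using f xy by (simp add: ev_closed T.minus_eq T.a_assoc T.r_neg)
qed

lemma ev_zero_arg: "f \<in> carrier (free_ab Q) \<Longrightarrow> ev f \<zero>\<^bsub>T\<^esub> = \<zero>\<^bsub>T\<^esub>"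
  using ev_diff_arg[of f "\<zero>\<^bsub>T\<^esub>" "\<zero>\<^bsub>T\<^esub>"] ev_closed[of "\<zero>\<^bsub>T\<^esub>" f] by (simp add: T.minus_eq T.r_neg)

text \<open>Induction in both arguments leads to \<open>act_quad_mult\<close>. The step in
  \<open>g\<close> relies on \<open>ev f\<close> being additive in its vector argument.\<close>

lemma ev_free_mult:
  assumes f: "f \<in> carrier (free_ab Q)" and g: "g \<in> carrier (free_ab Q)" and x: "x \<in> carrier T"
  shows "ev (free_mult m f g) x = ev f (ev g x)"
  using f
proof (induction f rule: free_ab_induct)
  case (of p)
  then have p: "frag_of p \<in> carrier (free_ab Q)"
    by simp
  show ?case
    using g
  proof (induction g rule: free_ab_induct)
    case (of q)
    then show ?case
      using \<open>p \<in> Q\<close> x by (simp add: ev_of act_quad_mult quad_mult_closed act_closed)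
  next
    case (diff g k)
    then show ?case
      using p x by (simp add: free_mult_diff ev_diff ev_diff_arg ev_closed free_mult_closed)
  qed (use p x in \<open>simp add: ev_zero ev_zero_arg\<close>)
next
  case (diff f k)
  then show ?case
    using g x by (simp add: free_mult_diff ev_diff ev_closed free_mult_closed)
qed (use g x in \<open>simp add: ev_zero ev_closed\<close>)

lemma ev_TR:
  assumes "f \<in> TR" and x: "x \<in> carrier T"
  shows "ev f x = \<zero>\<^bsub>T\<^esub>"
  unfolding ev_def
proof (rule T.frag_sum_generate[OF act_closed[OF x] tens_gens_carrier _ assms(1)[unfolded TR_eq]])
  fix g assume "g \<in> tens_gens"
  then have "ev g x = \<zero>\<^bsub>T\<^esub>"
    by (cases rule: tens_gens_cases)
       (simp_all add: x ev_diff ev_of free_ab_closed quads_def act_def closed add1 add2 add3 add4 T.add_minus_minus)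
  then show "frag_sum T (act x) g = \<zero>\<^bsub>T\<^esub>"
    by (simp add: ev_def)
qed

lemma free_rho_hom:
  "free_rho T m \<in> hom (add_monoid B) (add_monoid (End_ring T))"
  "free_rho T m \<in> hom B (End_ring T)"
  unfolding free_rho_eq
  by (auto intro!: homI simp: End_ring_def ev_closed ev_add_arg ev_plus ev_free_mult compose_def
        cong: restrict_cong)

lemma free_rho_TR: "f \<in> TR \<Longrightarrow> free_rho T m f = \<zero>\<^bsub>End_ring T\<^esub>"
  by (auto simp: free_rho_eq End_ring_def ev_TR)

text \<open>The representation on the intermediate quotient. Since \<open>rho\<close> flattens both
  quotients at once, this map is what allows the two descents to be treated separately;
  \<open>rho_eq\<close> reconnects them.\<close>

definition rho_F :: "(('t, 'g) quad \<Rightarrow>\<^sub>0 int) set \<Rightarrow> 't \<Rightarrow> 't" where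
  "rho_F X = the_elem (free_rho T m ` X)"

lemma rho_F_hom:
  "rho_F \<in> hom (add_monoid (F_ring T \<Gamma> m)) (add_monoid (End_ring T))"
  "rho_F \<in> hom (F_ring T \<Gamma> m) (End_ring T)"
  unfolding rho_F_def[abs_def] F_ring_eq
  using B.hom_Quot(1,2)[OF rng_ideal_TR E.abelian_group_axioms free_rho_hom free_rho_TR] by simp_all

lemma free_rho_image:
  "f \<in> carrier (free_ab Q) \<Longrightarrow> free_rho T m ` (TR +>\<^bsub>B\<^esub> f) = {free_rho T m f}"
  using B.hom_Quot(3)[OF rng_ideal_TR E.abelian_group_axioms free_rho_hom free_rho_TR] by simp

lemma rho_F_pure:
  assumes "p \<in> Q"
  shows "rho_F (F_pure T \<Gamma> p) = (\<lambda>x\<in>carrier T. act x p)"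
  using free_rho_image[of "frag_of p"] assms
  by (auto simp: rho_F_def F_pure_eq free_rho_eq ev_of)

lemma abelian_group_hom_rho_F: "abelian_group_hom (F_ring T \<Gamma> m) (End_ring T) rho_F"
  by (intro abelian_group_homI group_hom.intro group_hom_axioms.intro F.abelian_group_axioms
      E.abelian_group_axioms F.a_group E.a_group rho_F_hom)

lemma rho_F_diff:
  assumes "X \<in> carrier (F_ring T \<Gamma> m)" "Y \<in> carrier (F_ring T \<Gamma> m)" "rho_F X = rho_F Y"
  shows "rho_F (X \<ominus>\<^bsub>F_ring T \<Gamma> m\<^esub> Y) = \<zero>\<^bsub>End_ring T\<^esub>"
proof -
  interpret H: abelian_group_hom "F_ring T \<Gamma> m" "End_ring T" rho_F
    by (rule abelian_group_hom_rho_F)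
  show ?thesis
    using assms by (simp add: F.minus_eq E.r_neg)
qed

text \<open>The kernel of \<open>rho_F\<close> is a two-sided ideal, so only the generators of
  \<open>J\<close> matter, and for them the claim is the law \<open>assoc_left\<close> applied to
  the vector.\<close>

lemma rho_F_J:
  assumes "X \<in> J_ideal T \<Gamma> m"
  shows "rho_F X = \<zero>\<^bsub>End_ring T\<^esub>"
proof -
  let ?F = "F_ring T \<Gamma> m"
  let ?I = "a_kernel ?F (End_ring T) rho_F"
  interpret H: abelian_group_hom ?F "End_ring T" rho_F
    by (rule abelian_group_hom_rho_F)
  have I: "X \<in> ?I \<longleftrightarrow> X \<in> carrier ?F \<and> rho_F X = \<zero>\<^bsub>End_ring T\<^esub>" for X
    unfolding a_kernel_def' by simp
  have "rng_ideal ?F ?I"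
    unfolding rng_ideal_def
    using H.additive_subgroup_a_kernel hom_mult[OF rho_F_hom(2)]
    by (auto simp: I F.mult_closed)
  moreover have "J_gens \<subseteq> ?I"
  proof
    fix Y assume "Y \<in> J_gens"
    then obtain a \<alpha> b \<beta> c \<gamma> d \<delta> where
      Y: "Y = F_pure T \<Gamma> (m a \<alpha> b \<beta> c, \<gamma>, d, \<delta>) \<ominus>\<^bsub>?F\<^esub> F_pure T \<Gamma> (a, \<alpha>, m b \<beta> c \<gamma> d, \<delta>)"
      and car: "a \<in> carrier T" "\<alpha> \<in> carrier \<Gamma>" "b \<in> carrier T" "\<beta> \<in> carrier \<Gamma>"
        "c \<in> carrier T" "\<gamma> \<in> carrier \<Gamma>" "d \<in> carrier T" "\<delta> \<in> carrier \<Gamma>"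
      unfolding J_gens_def by blast
    have Q: "(m a \<alpha> b \<beta> c, \<gamma>, d, \<delta>) \<in> Q" "(a, \<alpha>, m b \<beta> c \<gamma> d, \<delta>) \<in> Q"
      using car by (simp_all add: quads_def closed)
    have "rho_F (F_pure T \<Gamma> (m a \<alpha> b \<beta> c, \<gamma>, d, \<delta>)) = rho_F (F_pure T \<Gamma> (a, \<alpha>, m b \<beta> c \<gamma> d, \<delta>))"
      using Q car by (auto simp: rho_F_pure act_def assoc_left)
    then show "Y \<in> ?I"
      unfolding I Y using Q by (auto intro!: rho_F_diff F.minus_closed simp: F_pure_closed)
  qed
  ultimately have "J_ideal T \<Gamma> m \<subseteq> ?I"
    unfolding J_ideal_eq rng_genideal_def by blast
  then show ?thesis
    using assms I by blast
qed

text \<open>On each inner coset \<open>free_rho\<close> is constant with value given by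
  \<open>rho_F\<close>, so the image of the flattened union is the image of \<open>u\<close> under
  \<open>rho_F\<close>.\<close>

lemma rho_eq:
  assumes "u \<in> carrier (O_ring T \<Gamma> m)"
  shows "rho T m u = the_elem (rho_F ` u)"
proof -
  interpret J: abelian_subgroup "J_ideal T \<Gamma> m" "F_ring T \<Gamma> m"
    using rng_ideal_J F.abelian_subgroupI_additive unfolding rng_ideal_def by blast
  have "u \<subseteq> carrier (F_ring T \<Gamma> m)"
    using assms J.a_elemrcos_carrier by (auto simp: O_ring_def J.Quot_carrier)
  then have "free_rho T m ` X = {rho_F X}" if X: "X \<in> u" for X
  proof -
    obtain f where "f \<in> carrier (free_ab Q)" "X = TR +>\<^bsub>B\<^esub> f"
      using \<open>u \<subseteq> carrier (F_ring T \<Gamma> m)\<close> X unfolding carrier_F by blast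
    then show ?thesis
      by (simp add: rho_F_def free_rho_image)
  qed
  then have "free_rho T m ` \<Union> u = rho_F ` u"
    by (auto simp: image_Union)
  then show ?thesis
    by (simp add: rho_def)
qed

lemma rho_hom:
  "rho T m \<in> hom (add_monoid (O_ring T \<Gamma> m)) (add_monoid (End_ring T))"
  "rho T m \<in> hom (O_ring T \<Gamma> m) (End_ring T)"
proof -
  have *: "(\<lambda>X. the_elem (rho_F ` X)) \<in> hom (add_monoid (O_ring T \<Gamma> m)) (add_monoid (End_ring T))"
    "(\<lambda>X. the_elem (rho_F ` X)) \<in> hom (O_ring T \<Gamma> m) (End_ring T)"
    using F.hom_Quot(1,2)[OF rng_ideal_J E.abelian_group_axioms rho_F_hom rho_F_J]
    by (simp_all add: O_ring_def)
  show "rho T m \<in> hom (add_monoid (O_ring T \<Gamma> m)) (add_monoid (End_ring T))"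
    by (rule O.add.hom_restrict[OF *(1)]) (rule rho_eq[symmetric])
  have "rho T m u = (\<lambda>X. the_elem (rho_F ` X)) u" if "u \<in> carrier (O_ring T \<Gamma> m)" for u
    using that by (simp add: rho_eq)
  then show "rho T m \<in> hom (O_ring T \<Gamma> m) (End_ring T)"
    using *(2) O.mult_closed by (auto simp: hom_def Pi_iff)
qed

lemma rho_hat_hom: "rho_hat T m \<in> ring_hom (A_ring T \<Gamma> m) (End_ring T)"
  unfolding rho_hat_def A_ring_eq by (rule O.unitization_hom[OF E.ring_axioms rho_hom])

lemma ring_surjection_rho_hat: "ring_surjection (A_ring T \<Gamma> m) (R_ring T \<Gamma> m) (rho_hat T m)"
proof -
  interpret A: ring "A_ring T \<Gamma> m"
    by (rule ring_A)
  interpret h: ring_hom_ring "A_ring T \<Gamma> m" "End_ring T" "rho_hat T m"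
    by (intro ring_hom_ringI2 A.ring_axioms E.ring_axioms rho_hat_hom)
  have "subring (rho_hat T m ` carrier (A_ring T \<Gamma> m)) (End_ring T)"
    by (rule h.img_is_subring[OF A.carrier_is_subring])
  then have "ring (R_ring T \<Gamma> m)"
    unfolding R_ring_def by (rule E.subring_is_ring)
  moreover have "rho_hat T m \<in> ring_hom (A_ring T \<Gamma> m) (R_ring T \<Gamma> m)"
    by (rule ring_hom_memI) (simp_all add: R_ring_def)
  ultimately show ?thesis
    by (intro ring_surjection.intro ring_surjection_axioms.intro A.ring_axioms) (simp_all add: R_ring_def)
qed

section \<open>The concrete definitions as instances of the abstract ones\<close>

sublocale S: ring_surjection "A_ring T \<Gamma> m" "R_ring T \<Gamma> m" "rho_hat T m"
  by (rule ring_surjection_rho_hat)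

text \<open>Shrinking the codomain to the image keeps the same zero, hence the same kernel.\<close>

lemma K_defect_eq: "K_defect T \<Gamma> m = S.K"
  unfolding K_defect_def S.K_def a_kernel_def' by (simp add: R_ring_def)

lemma K_pow_eq: "K_pow T \<Gamma> m n = S.P n"
  by (simp add: K_pow_def S.P_def K_defect_eq)

lemma K_class_eq: "K_class T \<Gamma> m n = S.cls n"
  by (simp add: fun_eq_iff K_class_def S.cls_def K_pow_eq)

lemma lifts_eq: "lifts T \<Gamma> m = S.lft"
  by (simp add: fun_eq_iff lifts_def S.lft_def)

lemma C_bimod_eq: "C_bimod T \<Gamma> m = S.C"
  by (simp add: fun_eq_iff C_bimod_def S.C_def K_pow_eq lifts_eq)

lemma gr_zero_fun_eq: "gr_zero_fun T \<Gamma> m = S.gr_zero"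
  by (simp add: gr_zero_fun_def S.gr_zero_def C_bimod_eq)

lemma gr_ring_eq: "gr_ring T \<Gamma> m = S.gr"
  by (simp add: gr_ring_def S.gr_def Let_def C_bimod_eq K_pow_eq gr_zero_fun_eq)

lemma gr_comp_eq: "gr_comp T \<Gamma> m = S.gr_part"
  by (simp add: fun_eq_iff gr_comp_def S.gr_part_def C_bimod_eq gr_ring_eq)

end

text \<open>The clause on \<open>lact\<close> and \<open>ract\<close> says that the actions are the
  ones obtained by lifting to \<open>A\<close>, and the values on pure tensors determine \<phi>.
  Generation as an algebra over \<open>R\<close> is expressed as generation as a ring by degrees
  zero and one, with degree zero identified with \<open>R\<close> by the isomorphism clause.\<close>

theorem proposition8p2:
  fixes T :: "('t, 'x) ring_scheme" and \<Gamma> :: "('g, 'y) ring_scheme"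
    and m :: "'t \<Rightarrow> 'g \<Rightarrow> 't \<Rightarrow> 'g \<Rightarrow> 't \<Rightarrow> 't"
  assumes "ternary_gamma_ring T \<Gamma> m"
  shows "(\<forall>n\<ge>1. bimodule (R_ring T \<Gamma> m) (C_bimod T \<Gamma> m n)) \<and>
         (\<forall>n\<ge>1. \<forall>a\<in>carrier (A_ring T \<Gamma> m). \<forall>x\<in>K_pow T \<Gamma> m n.
           lact (C_bimod T \<Gamma> m n) (rho_hat T m a) (K_class T \<Gamma> m n x)
             = K_class T \<Gamma> m n (a \<otimes>\<^bsub>A_ring T \<Gamma> m\<^esub> x) \<and>
           ract (C_bimod T \<Gamma> m n) (K_class T \<Gamma> m n x) (rho_hat T m a)
             = K_class T \<Gamma> m n (x \<otimes>\<^bsub>A_ring T \<Gamma> m\<^esub> a)) \<and>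
         (\<forall>n\<ge>1. bimodule (R_ring T \<Gamma> m) (tensor_power (R_ring T \<Gamma> m) (C_bimod T \<Gamma> m 1) n) \<and>
           (\<exists>\<phi>\<in>bimodule_hom (R_ring T \<Gamma> m)
                  (tensor_power (R_ring T \<Gamma> m) (C_bimod T \<Gamma> m 1) n) (C_bimod T \<Gamma> m n).
              (\<forall>xs. set xs \<subseteq> K_defect T \<Gamma> m \<and> length xs = n \<longrightarrow>
                 \<phi> (tpow_pure (R_ring T \<Gamma> m) (C_bimod T \<Gamma> m 1) (map (K_class T \<Gamma> m 1) xs))
                   = K_class T \<Gamma> m n (foldr (\<otimes>\<^bsub>A_ring T \<Gamma> m\<^esub>) xs \<one>\<^bsub>A_ring T \<Gamma> m\<^esub>)) \<and>
              \<phi> ` carrier (tensor_power (R_ring T \<Gamma> m) (C_bimod T \<Gamma> m 1) n)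
                = carrier (C_bimod T \<Gamma> m n))) \<and>
         (graded_ring (gr_ring T \<Gamma> m) (gr_comp T \<Gamma> m)) \<and>
         ((\<lambda>r. (r, gr_zero_fun T \<Gamma> m))
           \<in> ring_iso (R_ring T \<Gamma> m) ((gr_ring T \<Gamma> m) \<lparr>carrier := gr_comp T \<Gamma> m 0\<rparr>)) \<and>
         (generate_ring (gr_ring T \<Gamma> m) (gr_comp T \<Gamma> m 0 \<union> gr_comp T \<Gamma> m 1)
           = carrier (gr_ring T \<Gamma> m))"
proof -
  interpret ternary_gamma_ring T \<Gamma> m
    by (rule assms)
  show ?thesis
    unfolding C_bimod_eq K_pow_eq K_class_eq K_defect_eq gr_ring_eq gr_comp_eq gr_zero_fun_eq
  proof (intro conjI allI impI ballI)
    show "bimodule (R_ring T \<Gamma> m) (S.C n)" for n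
      by (rule S.bimodule_C)
    show "lact (S.C n) (rho_hat T m a) (S.cls n x) = S.cls n (a \<otimes>\<^bsub>A_ring T \<Gamma> m\<^esub> x)"
      "ract (S.C n) (S.cls n x) (rho_hat T m a) = S.cls n (x \<otimes>\<^bsub>A_ring T \<Gamma> m\<^esub> a)"
      if "a \<in> carrier (A_ring T \<Gamma> m)" "x \<in> S.P n" for n a x
      using that by (rule S.lact_C S.ract_C)+
    fix n :: nat assume n: "1 \<le> n"
    show "bimodule (R_ring T \<Gamma> m) (tensor_power (R_ring T \<Gamma> m) (S.C 1) n)"
      by (rule bimodule.bimodule_tensor_power[OF S.bimodule_C n])
    obtain \<phi> where "\<phi> \<in> bimodule_hom (R_ring T \<Gamma> m) (tensor_power (R_ring T \<Gamma> m) (S.C 1) n) (S.C n)"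
      and "\<And>xs. \<lbrakk>set xs \<subseteq> S.K; length xs = n\<rbrakk>
        \<Longrightarrow> \<phi> (tpow_pure (R_ring T \<Gamma> m) (S.C 1) (map (S.cls 1) xs)) = S.cls n (S.lprod xs)"
      and "\<phi> ` carrier (tensor_power (R_ring T \<Gamma> m) (S.C 1) n) = carrier (S.C n)"
      using S.multiplication_map[OF n] unfolding One_nat_def by blast
    then show "\<exists>\<phi>\<in>bimodule_hom (R_ring T \<Gamma> m) (tensor_power (R_ring T \<Gamma> m) (S.C 1) n) (S.C n).
        (\<forall>xs. set xs \<subseteq> S.K \<and> length xs = n \<longrightarrow>
          \<phi> (tpow_pure (R_ring T \<Gamma> m) (S.C 1) (map (S.cls 1) xs))
            = S.cls n (foldr (\<otimes>\<^bsub>A_ring T \<Gamma> m\<^esub>) xs \<one>\<^bsub>A_ring T \<Gamma> m\<^esub>)) \<and>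
        \<phi> ` carrier (tensor_power (R_ring T \<Gamma> m) (S.C 1) n) = carrier (S.C n)"
      unfolding S.lprod_def by blast
  qed (rule S.graded_ring_gr S.degree_zero_iso S.generate_gr)+
qed

end
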